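(* Let $\alpha>0$ and let $H_1,H_2,\ldots$ be i.i.d. real random variables whose common law has regularly varying tails with tail exponent $\alpha$. For each $n$ let $X_1,\ldots,X_n$ be the associated sample with truncated power tails, with truncation level $M_n>0$ and auxiliary variables $R_j$ (see context). Let $A$ satisfy $\alpha<A<\infty$ and put $$Z_n(A)=\frac{\sum_{i=1}^n|X_i|^A}{\max_{1\le i\le n}|X_i|^A}.$$ (i) If $\lim_{n\to\infty}nP(|H_1|>M_n)=0$ (soft truncation), then $$Z_n(A)\Longrightarrow\Gamma_1^{A/\alpha}\sum_{j=1}^\infty\Gamma_j^{-A/\alpha}\quad(n\to\infty),$$ where $(\Gamma_j,\,j\ge1)$ are the arrival times of a unit rate Poisson process on $(0,\infty)$. (ii) If $ER_1^A<\infty$ and $\lim_{n\to\infty}nP(|H_1|>M_n)=\infty$ (hard truncation), then $Z_n(A)\to\infty$ in probability as $n\to\infty$.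
   Context: $\Longrightarrow$ denotes weak convergence. Regularly varying tails (on $\mathbb{R}$): there exist a sequence $a_n\uparrow\infty$ and a non-null Radon measure $\mu$ on $[-\infty,\infty]\setminus\{0\}$ with $\mu(\{-\infty,\infty\})=0$ such that $nP(a_n^{-1}H_1\in\cdot)\to\mu(\cdot)$ vaguely on $[-\infty,\infty]\setminus\{0\}$, where $\mu(cB)=c^{-\alpha}\mu(B)$ for all $c>0$ and Borel $B$; $\alpha$ is the tail exponent. Truncated model: $R_1,R_2,\ldots$ are i.i.d. nonnegative random variables independent of $(H_j)$, $M_n>0$ is deterministic, and for each $n$ the sample is $X_j=X_{nj}$, $j=1,\ldots,n$, where $$X_{nj}=H_j\mathbf 1(|H_j|\le M_n)+\frac{H_j}{|H_j|}(M_n+R_j)\mathbf 1(|H_j|>M_n).$$ $Z_n(A)$ is defined arbitrarily when its denominator is $0$. *)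

theory Defs
  imports "HOL-Probability.Probability"
begin

text \<open>On a locally compact second countable space every Borel measure that is finite on
  compact sets is automatically regular, so the finiteness condition is all that Radon means here.\<close>

definition radon_measure_on :: "'a::topological_space set \<Rightarrow> 'a measure \<Rightarrow> bool" where
  "radon_measure_on S \<mu> \<longleftrightarrow>
     sets \<mu> = sets (restrict_space borel S) \<and>
     (\<forall>K. compact K \<and> K \<subseteq> S \<longrightarrow> emeasure \<mu> K < \<infinity>)"

definition vague_conv_on ::
  "'a::topological_space set \<Rightarrow> (nat \<Rightarrow> 'a measure) \<Rightarrow> 'a measure \<Rightarrow> bool" where
  "vague_conv_on S \<mu>s \<mu> \<longleftrightarrow>
     (\<forall>f :: 'a \<Rightarrow> real.
        continuous_on S f \<and> (\<exists>K. compact K \<and> K \<subseteq> S \<and> (\<forall>x\<in>S - K. f x = 0)) \<longrightarrow>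
        (\<lambda>n. integral\<^sup>L (\<mu>s n) f) \<longlonglongrightarrow> integral\<^sup>L \<mu> f)"

text \<open>The space \<open>[-\<infinity>, \<infinity>] - {0}\<close> is \<open>- {0} :: ereal set\<close>; its compact subsets are the closed
  sets of extended reals that avoid a neighbourhood of \<open>0\<close>. The argument \<open>D\<close> is the law of
  \<open>H\<^sub>1\<close>.\<close>

definition regularly_varying_tails :: "real measure \<Rightarrow> real \<Rightarrow> bool" where
  "regularly_varying_tails D \<alpha> \<longleftrightarrow>
     (\<exists>(a :: nat \<Rightarrow> real) (\<mu> :: ereal measure).
        incseq a \<and> filterlim a at_top sequentially \<and>
        radon_measure_on (- {0}) \<mu> \<and>
        emeasure \<mu> (- {0}) \<noteq> 0 \<and>
        emeasure \<mu> {-\<infinity>, \<infinity>} = 0 \<and>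
        vague_conv_on (- {0})
          (\<lambda>n. restrict_space
                 (scale_measure (of_nat n) (distr D borel (\<lambda>x. ereal (x / a n)))) (- {0}))
          \<mu> \<and>
        (\<forall>c>0. \<forall>B\<in>sets \<mu>.
           emeasure \<mu> ((\<lambda>x. ereal c * x) ` B) = ennreal (c powr - \<alpha>) * emeasure \<mu> B))"

definition iid :: "'a measure \<Rightarrow> nat set \<Rightarrow> (nat \<Rightarrow> 'a \<Rightarrow> real) \<Rightarrow> bool" where
  "iid M I X \<longleftrightarrow>
     prob_space.indep_vars M (\<lambda>_. borel) X I \<and>
     (\<forall>i\<in>I. \<forall>j\<in>I. distr M borel (X i) = distr M borel (X j))"

definition indep_sequences ::
  "'a measure \<Rightarrow> nat set \<Rightarrow> (nat \<Rightarrow> 'a \<Rightarrow> real) \<Rightarrow> (nat \<Rightarrow> 'a \<Rightarrow> real) \<Rightarrow> bool" where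
  "indep_sequences M I X Y \<longleftrightarrow>
     prob_space.indep_var M
       (Pi\<^sub>M I (\<lambda>_. borel)) (\<lambda>\<omega>. \<lambda>j\<in>I. X j \<omega>)
       (Pi\<^sub>M I (\<lambda>_. borel)) (\<lambda>\<omega>. \<lambda>j\<in>I. Y j \<omega>)"

text \<open>When \<open>H j \<omega> = 0\<close> the second summand vanishes because of the indicator (for positive
  truncation level), so the value of \<open>0 / 0\<close> is irrelevant.\<close>

definition truncated_sample ::
  "(nat \<Rightarrow> 'a \<Rightarrow> real) \<Rightarrow> (nat \<Rightarrow> 'a \<Rightarrow> real) \<Rightarrow> (nat \<Rightarrow> real) \<Rightarrow> nat \<Rightarrow> nat \<Rightarrow> 'a \<Rightarrow> real" where
  "truncated_sample H R L n j \<omega> =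
     H j \<omega> * of_bool (\<bar>H j \<omega>\<bar> \<le> L n) +
     H j \<omega> / \<bar>H j \<omega>\<bar> * (L n + R j \<omega>) * of_bool (\<bar>H j \<omega>\<bar> > L n)"

text \<open>The argument \<open>d\<close> supplies the arbitrary value taken when the denominator is \<open>0\<close>. The
  index \<open>n = 0\<close> (maximum over the empty set) carries no meaning and only limits as
  \<open>n \<rightarrow> \<infinity>\<close> are considered.\<close>

definition sum_max_ratio ::
  "(nat \<Rightarrow> 'a \<Rightarrow> real) \<Rightarrow> (nat \<Rightarrow> nat \<Rightarrow> 'a \<Rightarrow> real) \<Rightarrow> real \<Rightarrow> nat \<Rightarrow> 'a \<Rightarrow> real" where
  "sum_max_ratio d X A n \<omega> =
     (let m = Max ((\<lambda>i. \<bar>X n i \<omega>\<bar> powr A) ` {1..n})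
      in if m = 0 then d n \<omega> else (\<Sum>i=1..n. \<bar>X n i \<omega>\<bar> powr A) / m)"

definition arrival_count :: "(nat \<Rightarrow> 'b \<Rightarrow> real) \<Rightarrow> real \<Rightarrow> real \<Rightarrow> 'b \<Rightarrow> nat" where
  "arrival_count \<Gamma> s t \<omega> = card {j\<in>{1..}. s < \<Gamma> j \<omega> \<and> \<Gamma> j \<omega> \<le> t}"

text \<open>\<open>\<Gamma> 1, \<Gamma> 2, \<dots>\<close> are the successive arrival times of a unit rate Poisson process on
  \<open>(0, \<infinity>)\<close>: the process counting them has independent increments, and its increment over
  \<open>(s, t]\<close> is Poisson distributed with mean \<open>t - s\<close>. Divergence of the arrival times makes the
  counts finite, so that \<^const>\<open>card\<close> is the true count almost surely. Independence over every
  finite partition follows from the formulation with infinite increasing sequences.\<close>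

definition unit_poisson_arrival_times :: "'b measure \<Rightarrow> (nat \<Rightarrow> 'b \<Rightarrow> real) \<Rightarrow> bool" where
  "unit_poisson_arrival_times P \<Gamma> \<longleftrightarrow>
     (\<forall>j\<ge>1. \<Gamma> j \<in> borel_measurable P) \<and>
     (AE \<omega> in P. 0 < \<Gamma> 1 \<omega> \<and> (\<forall>j\<ge>1. \<Gamma> j \<omega> < \<Gamma> (Suc j) \<omega>) \<and>
        filterlim (\<lambda>j. \<Gamma> j \<omega>) at_top sequentially) \<and>
     (\<forall>s t. 0 \<le> s \<and> s < t \<longrightarrow>
        distr P (count_space UNIV) (arrival_count \<Gamma> s t) = measure_pmf (poisson_pmf (t - s))) \<and>
     (\<forall>t :: nat \<Rightarrow> real. 0 \<le> t 0 \<and> strict_mono t \<longrightarrow>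
        prob_space.indep_vars P (\<lambda>_. count_space UNIV)
          (\<lambda>i. arrival_count \<Gamma> (t i) (t (Suc i))) UNIV)"

definition tends_to_infinity_in_prob :: "'a measure \<Rightarrow> (nat \<Rightarrow> 'a \<Rightarrow> real) \<Rightarrow> bool" where
  "tends_to_infinity_in_prob M Z \<longleftrightarrow>
     (\<forall>C. (\<lambda>n. measure M {\<omega>\<in>space M. Z n \<omega> > C}) \<longlonglongrightarrow> 1)"

end

theory Submission
  imports Defs
begin

text \<open>
  Writing \<open>\<beta> = A / \<alpha> > 1\<close> and normalising the \<open>\<bar>H j\<bar>\<close> so that \<open>n P(\<bar>H 1\<bar> \<ge> a n x) \<longlonglongrightarrow> x powr -\<alpha>\<close>,
  the points \<open>U j = (\<bar>H j\<bar> / a n) powr -\<alpha>\<close> behave like the arrival times of a unit rate Poisson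
  process, and under soft truncation \<open>Z n\<close> is, off an event of vanishing probability, the ratio of
  the sum and the maximum of the \<open>U j powr -\<beta>\<close>. Group the points into the cells of a geometric grid.
  The multinomial vector of cell counts converges in law to independent Poisson counts. Rounding every
  point to the end of its cell changes the ratio by a factor close to \<open>1\<close>, and the points beyond
  the grid contribute little: in mean at most a multiple of \<open>T powr (1 - \<beta>)\<close> beyond \<open>T\<close>,
  for the sample by a Karamata type estimate. This rounding is the same for the sample and for the
  Poisson process, so the distribution functions of the two ratios are squeezed together.

  Under hard truncation the number of \<open>j \<le> n\<close> with \<open>\<bar>H j\<bar> > L n\<close> has mean
  \<open>x \<longlonglongrightarrow> \<infinity>\<close>. Chebyshev's inequality gives a sum of at least order
  \<open>x (L n powr A + m)\<close>, where \<open>m = E min (R 1 powr A) 1\<close>, whereas integrability of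
  \<open>R 1 powr A\<close> makes every single term \<open>o(x (L n powr A + m))\<close> uniformly.
\<close>

section \<open>Tails\<close>

text \<open>Two obstacles shape the soft case. Neither the series nor the maximum is determined by
  finitely many counts, and the description of the arrival times gives the laws of counts but of no
  single arrival. Hence everything is expressed through counts, and what counts miss must be bounded
  in probability. The grid is geometric because rounding within a cell whose end points have ratio
  \<open>s\<close> changes every weight by a factor of at most \<open>s powr \<beta>\<close>,
  whatever its size. Only the cell next to 0 has no such ratio; it is made so short that it is
  probably empty. The remainder beyond the grid has to be small relative to the maximum, so the
  maximum needs a lower bound, which an occupied cell well inside the grid supplies. The exponent
  \<beta> above 1 makes the mean of the remainder decay. Under hard truncation the obstacle is that
  \<open>R 1 powr A\<close> has a first moment only. Capping it at 1 in the lower bound for the sum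
  supplies a variance, and the uncapped variable enters only through its tail.\<close>

text \<open>A continuous substitute for the indicator of a two-sided tail that vanishes near 0,
  hence a test function for vague convergence on the punctured extended line. The inner
  \<open>min\<close> precedes \<open>real_of_ereal\<close>, which sends infinite values to 0 and
  would make the function jump at the two infinite points.\<close>

definition abs_ramp :: "real \<Rightarrow> real \<Rightarrow> ereal \<Rightarrow> real" where
  "abs_ramp x y z = max 0 ((real_of_ereal (min \<bar>z\<bar> (ereal y)) - x) / (y - x))"

lemma abs_ramp_ereal: "abs_ramp x y (ereal u) = max 0 ((min \<bar>u\<bar> y - x) / (y - x))"
  by (simp add: abs_ramp_def min_def)

lemma continuous_on_abs_ramp:
  assumes "0 < x" "x < y" shows "continuous_on UNIV (abs_ramp x y)"
proof -
  have "continuous_on UNIV (\<lambda>z::ereal. min \<bar>z\<bar> (ereal y))"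
  proof -
    have "continuous_on UNIV (\<lambda>z::ereal. max z (- z))"
      by (intro continuous_intros continuous_on_max)
    moreover have "(\<lambda>z::ereal. \<bar>z\<bar>) = (\<lambda>z. max z (- z))"
    proof
      fix z :: ereal show "\<bar>z\<bar> = max z (- z)" by (cases z) (auto simp: max_def)
    qed
    ultimately show ?thesis
      by (intro continuous_on_min continuous_on_const) auto
  qed
  moreover have "\<bar>min \<bar>z\<bar> (ereal y)\<bar> \<noteq> \<infinity>" for z :: ereal
    using assms by (cases z) (auto simp: min_def)
  ultimately have "continuous_on UNIV (\<lambda>z::ereal. real_of_ereal (min \<bar>z\<bar> (ereal y)))"
    unfolding continuous_on_def by (intro ballI lim_real_of_ereal) (auto simp: ereal_real)
  then show ?thesis
    unfolding abs_ramp_def using assms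
    by (intro continuous_intros continuous_on_max) auto
qed

lemma abs_ramp_bounds:
  assumes "0 < x" "x < y"
  shows "indicator {z. ereal y \<le> \<bar>z\<bar>} z \<le> abs_ramp x y z" "abs_ramp x y z \<le> indicator {z. ereal x \<le> \<bar>z\<bar>} z"
  using assms by (cases z; auto simp: abs_ramp_def indicator_def min_def divide_simps max_def)+

lemma borel_measurable_abs_ramp [measurable]:
  assumes "0 < x" "x < y" shows "abs_ramp x y \<in> borel_measurable borel"
  using continuous_on_abs_ramp[OF assms] by (rule borel_measurable_continuous_onI)

lemma closed_abs_ge: "closed {z::ereal. x \<le> \<bar>z\<bar>}"
proof -
  have "{z::ereal. x \<le> \<bar>z\<bar>} = {x..} \<union> {..-x} \<union> (if x \<le> 0 then UNIV else {})"
  proof (intro set_eqI)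
    fix z show "(z \<in> {z. x \<le> \<bar>z\<bar>}) = (z \<in> {x..} \<union> {..-x} \<union> (if x \<le> 0 then UNIV else {}))"
      by (cases z; cases x) auto
  qed
  then show ?thesis by auto
qed

text \<open>The ramp vanishes at 0, so deleting the origin from the space leaves its integral
  unchanged; what vague convergence controls is therefore n times an expectation.\<close>

lemma integral_rescaled_law_abs_ramp:
  fixes D :: "real measure"
  assumes "prob_space D" and D[measurable_cong]: "sets D = sets borel" and "0 < x" "x < y"
  shows "integral\<^sup>L (restrict_space (scale_measure (of_nat n) (distr D borel (\<lambda>z. ereal (z / b)))) (- {0}))
           (abs_ramp x y) = real n * (\<integral>z. abs_ramp x y (ereal (z / b)) \<partial>D)"
proof -
  interpret prob_space D by fact
  note [measurable] = borel_measurable_abs_ramp[OF assms(3,4)]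
  have nn: "0 \<le> abs_ramp x y z" for z by (simp add: abs_ramp_def)
  have 0: "abs_ramp x y 0 = 0" using assms by (simp add: abs_ramp_def)
  have "integral\<^sup>L (restrict_space (scale_measure (of_nat n) (distr D borel (\<lambda>z. ereal (z / b)))) (- {0})) (abs_ramp x y)
    = (\<integral>z. indicator (-{0}) z *\<^sub>R abs_ramp x y z \<partial>scale_measure (of_nat n) (distr D borel (\<lambda>z. ereal (z / b))))"
    by (rule integral_restrict_space) auto
  also have "(\<lambda>z. indicator (-{0}) z *\<^sub>R abs_ramp x y z) = abs_ramp x y"
    using 0 by (auto simp: indicator_def fun_eq_iff)
  also have "integral\<^sup>L (scale_measure (of_nat n) (distr D borel (\<lambda>z. ereal (z / b)))) (abs_ramp x y)
    = enn2real (of_nat n * (\<integral>\<^sup>+z. abs_ramp x y (ereal (z / b)) \<partial>D))"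
    by (subst integral_eq_nn_integral) (auto simp: nn nn_integral_scale_measure nn_integral_distr)
  also have "\<dots> = real n * enn2real (\<integral>\<^sup>+z. abs_ramp x y (ereal (z / b)) \<partial>D)"
    by (simp add: enn2real_mult ennreal_of_nat_eq_real_of_nat)
  also have "enn2real (\<integral>\<^sup>+z. abs_ramp x y (ereal (z / b)) \<partial>D) = (\<integral>z. abs_ramp x y (ereal (z / b)) \<partial>D)"
    by (subst integral_eq_nn_integral) (auto simp: nn)
  finally show ?thesis .
qed

text \<open>Homogeneity makes the limit measure of the two-sided tail at x equal to
  \<open>c * x powr - \<alpha>\<close>. This is continuous in x, so ramps with nearby corners pin
  down the tail limit. The constant c is absorbed by rescaling the norming sequence.\<close>

lemma regularly_varying_tails_tail_limit:
  assumes rv: "regularly_varying_tails D \<alpha>" and "prob_space D" and D[measurable_cong]: "sets D = sets borel"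
    and "0 < \<alpha>"
  obtains a :: "nat \<Rightarrow> real" where "\<And>n. 0 < a n" "incseq a" "filterlim a at_top sequentially"
    "\<And>x. 0 < x \<Longrightarrow> (\<lambda>n. real n * measure D {z. a n * x \<le> \<bar>z\<bar>}) \<longlonglongrightarrow> x powr - \<alpha>"
proof -
  interpret D: prob_space D by fact
  obtain a \<mu> where a: "incseq a" "filterlim a at_top sequentially" and
    rad: "radon_measure_on (- {0}) \<mu>" and nz: "emeasure \<mu> (- {0}) \<noteq> 0" and
    vc: "vague_conv_on (- {0})
          (\<lambda>n. restrict_space
                 (scale_measure (of_nat n) (distr D borel (\<lambda>x. ereal (x / a n)))) (- {0}))
          \<mu>" and
    hom: "\<And>c B. c>0 \<Longrightarrow> B\<in>sets \<mu> \<Longrightarrow>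
           emeasure \<mu> ((\<lambda>x. ereal c * x) ` B) = ennreal (c powr - \<alpha>) * emeasure \<mu> B"
    using rv unfolding regularly_varying_tails_def by blast
  have smu: "sets \<mu> = sets (restrict_space borel (- {0}))"
    using rad by (simp add: radon_measure_on_def)
  define T where "T x = {z. ereal x \<le> \<bar>z\<bar>}" for x
  have T_sub: "T x \<subseteq> - {0}" if "0 < x" for x using that by (auto simp: T_def)
  have clT: "closed (T x)" for x unfolding T_def by (rule closed_abs_ge)
  have T_sets: "T x \<in> sets \<mu>" if "0 < x" for x
    unfolding smu sets_restrict_space using T_sub[OF that] clT[of x] by (auto intro!: image_eqI[of _ _ "T x"])
  have T_fin: "emeasure \<mu> (T x) < \<infinity>" if "0 < x" for x
    using rad T_sub[OF that] clT[of x] by (auto simp: radon_measure_on_def compact_eq_closed)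
  have T_img: "(\<lambda>z. ereal c * z) ` T 1 = T c" if "0 < c" for c
  proof (intro equalityI subsetI)
    fix z assume "z \<in> (\<lambda>z. ereal c * z) ` T 1"
    then obtain y where y: "z = ereal c * y" "ereal 1 \<le> \<bar>y\<bar>" unfolding T_def by blast
    then show "z \<in> T c" using that by (cases y) (auto simp: T_def abs_mult)
  next
    fix z assume "z \<in> T c"
    then show "z \<in> (\<lambda>z. ereal c * z) ` T 1" using that
      by (intro image_eqI[of _ _ "ereal (1/c) * z"]) (cases z; auto simp: T_def abs_mult divide_simps one_ereal_def)+
  qed
  have T_hom: "measure \<mu> (T c) = c powr - \<alpha> * measure \<mu> (T 1)" if "0 < c" for c
    using hom[OF that T_sets[of 1]] that by (simp add: T_img measure_def enn2real_mult)
  \<comment> \<open>If the tail at level 1 were null, homogeneity would make every tail null, and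
    the tails at the levels \<open>1 / Suc n\<close> exhaust the punctured line.\<close>
  have pos: "0 < measure \<mu> (T 1)"
  proof (rule ccontr)
    assume "\<not> ?thesis"
    then have "measure \<mu> (T 1) = 0" by (simp add: zero_less_measure_iff)
    then have "emeasure \<mu> (T c) = 0" if "0 < c" for c
      using T_hom[OF that] T_fin[OF that] emeasure_eq_ennreal_measure[of \<mu> "T c"] by simp
    then have "emeasure \<mu> (\<Union>n. T (1 / Suc n)) = 0"
      by (intro emeasure_UN_eq_0) (auto intro!: T_sets)
    moreover have "(\<Union>n. T (1 / Suc n)) = - {0}"
    proof (intro equalityI subsetI)
      fix z :: ereal assume z: "z \<in> - {0}"
      show "z \<in> (\<Union>n. T (1 / Suc n))"
      proof (cases z)
        case (real r)
        then have "0 < \<bar>r\<bar>" using z by auto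
        then obtain n where "inverse (real (Suc n)) < \<bar>r\<bar>" using reals_Archimedean by blast
        then show ?thesis using real by (auto simp: T_def divide_simps intro!: exI[of _ n])
      qed (auto simp: T_def)
    qed (use T_sub[of "1 / Suc n" for n] in auto)
    ultimately show False using nz by simp
  qed
  define c where "c = measure \<mu> (T 1)"
  define G where "G n x = real n * measure D {z. a n * x \<le> \<bar>z\<bar>}" for n x
  have meas_ramp[measurable]: "abs_ramp x y \<in> borel_measurable \<mu>" if "0 < x" "x < y" for x y
    using borel_measurable_abs_ramp[OF that] by (simp add: measurable_cong_sets[OF smu refl] measurable_restrict_space1)
  have step: "\<exists>I. (\<lambda>n. real n * (\<integral>z. abs_ramp x y (ereal (z / a n)) \<partial>D)) \<longlonglongrightarrow> I \<and>
       c * y powr - \<alpha> \<le> I \<and> I \<le> c * x powr - \<alpha>" if xy: "0 < x" "x < y" for x y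
  proof (intro exI conjI)
    have "continuous_on (-{0}) (abs_ramp x y)" using continuous_on_abs_ramp[OF xy] continuous_on_subset by blast
    moreover have "\<forall>z\<in>-{0} - T x. abs_ramp x y z = 0"
    proof
      fix z assume "z \<in> -{0} - T x"
      then show "abs_ramp x y z = 0" using abs_ramp_bounds[OF xy, of z] by (auto simp: T_def indicator_def split: if_splits) (simp add: abs_ramp_def)
    qed
    moreover have "compact (T x)" using clT by (simp add: compact_eq_closed)
    ultimately have "continuous_on (-{0}) (abs_ramp x y) \<and> (\<exists>K. compact K \<and> K \<subseteq> - {0} \<and> (\<forall>z\<in>- {0} - K. abs_ramp x y z = 0))"
      using T_sub[OF xy(1)] by blast
    then show "(\<lambda>n. real n * (\<integral>z. abs_ramp x y (ereal (z / a n)) \<partial>D)) \<longlonglongrightarrow> integral\<^sup>L \<mu> (abs_ramp x y)"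
      using vc unfolding vague_conv_on_def
      by (auto simp: integral_rescaled_law_abs_ramp[OF \<open>prob_space D\<close> D xy])
    have iT: "integrable \<mu> (indicator (T u) :: _ \<Rightarrow> real)" if "0 < u" for u
      using T_fin[OF that] T_sets[OF that] by (simp add: integrable_indicator_iff)
    have ic: "integrable \<mu> (abs_ramp x y)"
      by (rule Bochner_Integration.integrable_bound[OF iT[OF xy(1)]])
         (use xy abs_ramp_bounds[OF xy] in \<open>auto simp: T_def abs_ramp_def\<close>)
    have sp: "T u \<inter> space \<mu> = T u" if "0 < u" for u using sets.sets_into_space[OF T_sets[OF that]] by auto
    have "measure \<mu> (T y) = integral\<^sup>L \<mu> (indicator (T y))" using xy sp[of y] by simp
    also have "\<dots> \<le> integral\<^sup>L \<mu> (abs_ramp x y)"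
      using xy abs_ramp_bounds[OF xy] by (intro integral_mono iT ic) (auto simp: T_def)
    finally show "c * y powr - \<alpha> \<le> integral\<^sup>L \<mu> (abs_ramp x y)" using T_hom[of y] xy by (simp add: c_def mult.commute)
    have "integral\<^sup>L \<mu> (abs_ramp x y) \<le> integral\<^sup>L \<mu> (indicator (T x))"
      using xy abs_ramp_bounds[OF xy] by (intro integral_mono iT ic) (auto simp: T_def)
    also have "\<dots> = measure \<mu> (T x)" using xy sp[of x] by simp
    finally show "integral\<^sup>L \<mu> (abs_ramp x y) \<le> c * x powr - \<alpha>" using T_hom[of x] xy by (simp add: c_def mult.commute)
  qed
  have ev_pos: "\<forall>\<^sub>F n in sequentially. 0 < a n"
    using a(2) by (rule filterlim_at_top_dense[THEN iffD1, rule_format])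
  have tail: "{z. a n * u \<le> \<bar>z\<bar>} = {z. ereal u \<le> \<bar>ereal (z / a n)\<bar>}" if "0 < a n" for n u
    using that by (auto simp: field_simps)
  have icD: "integrable D (\<lambda>z. abs_ramp x y (ereal (z / b)))" if xy: "0 < x" "x < y" for x y b
  proof (rule D.integrable_const_bound[of _ 1])
    have "\<bar>abs_ramp x y z\<bar> \<le> 1" for z
      using abs_ramp_bounds(2)[OF xy, of z] by (simp add: abs_ramp_def split: split_indicator_asm)
    then show "AE z in D. norm (abs_ramp x y (ereal (z / b))) \<le> 1" by (auto simp del: abs_ramp_ereal)
    show "(\<lambda>z. abs_ramp x y (ereal (z / b))) \<in> borel_measurable D"
      using borel_measurable_abs_ramp[OF xy] by measurable
  qed
  have G_up: "\<forall>\<^sub>F n in sequentially. G n y \<le> real n * (\<integral>z. abs_ramp x y (ereal (z / a n)) \<partial>D)" if xy: "0 < x" "x < y" for x y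
    using ev_pos
  proof eventually_elim
    case (elim n)
    have "measure D {z. a n * y \<le> \<bar>z\<bar>} = integral\<^sup>L D (indicator {z. a n * y \<le> \<bar>z\<bar>})" by (simp add: sets_eq_imp_space_eq[OF D])
    also have "\<dots> \<le> (\<integral>z. abs_ramp x y (ereal (z / a n)) \<partial>D)"
    proof (intro integral_mono icD xy)
      show "indicator {z. a n * y \<le> \<bar>z\<bar>} z \<le> abs_ramp x y (ereal (z / a n))" for z
        using abs_ramp_bounds(1)[OF xy, of "ereal (z / a n)"] by (simp add: tail[OF elim] indicator_def)
    qed (simp add: integrable_indicator_iff D.emeasure_eq_measure)
    finally show ?case unfolding G_def by (intro mult_left_mono) auto
  qed
  have G_low: "\<forall>\<^sub>F n in sequentially. real n * (\<integral>z. abs_ramp x y (ereal (z / a n)) \<partial>D) \<le> G n x" if xy: "0 < x" "x < y" for x y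
    using ev_pos
  proof eventually_elim
    case (elim n)
    have "(\<integral>z. abs_ramp x y (ereal (z / a n)) \<partial>D) \<le> integral\<^sup>L D (indicator {z. a n * x \<le> \<bar>z\<bar>})"
    proof (intro integral_mono icD xy)
      show "abs_ramp x y (ereal (z / a n)) \<le> indicator {z. a n * x \<le> \<bar>z\<bar>} z" for z
        using abs_ramp_bounds(2)[OF xy, of "ereal (z / a n)"] by (simp add: tail[OF elim] indicator_def)
    qed (simp add: integrable_indicator_iff D.emeasure_eq_measure)
    also have "\<dots> = measure D {z. a n * x \<le> \<bar>z\<bar>}" by (simp add: sets_eq_imp_space_eq[OF D])
    finally show ?case unfolding G_def by (intro mult_left_mono) auto
  qed
  have lim: "(\<lambda>n. G n x) \<longlonglongrightarrow> c * x powr - \<alpha>" if x: "0 < x" for x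
  proof (rule order_tendstoI)
    fix l assume l: "l < c * x powr - \<alpha>"
    have "((\<lambda>y. c * y powr - \<alpha>) \<longlongrightarrow> c * x powr - \<alpha>) (at_right x)"
      using x by (intro tendsto_intros) auto
    from order_tendstoD(1)[OF this l] obtain b where b: "x < b" "\<And>y. x < y \<Longrightarrow> y < b \<Longrightarrow> l < c * y powr - \<alpha>"
      using eventually_at_right[of x "x+1"] by auto
    obtain y where "x < y" "y < b" using dense[OF b(1)] by auto
    then have y: "x < y" "l < c * y powr - \<alpha>" using b(2) by auto
    from step[OF x y(1)] obtain I where I: "(\<lambda>n. real n * (\<integral>z. abs_ramp x y (ereal (z / a n)) \<partial>D)) \<longlonglongrightarrow> I" "c * y powr - \<alpha> \<le> I" by blast
    from order_tendstoD(1)[OF I(1), of l] y I(2) have "\<forall>\<^sub>F n in sequentially. l < real n * (\<integral>z. abs_ramp x y (ereal (z / a n)) \<partial>D)" by simp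
    with G_low[OF x y(1)] show "\<forall>\<^sub>F n in sequentially. l < G n x" by eventually_elim simp
  next
    fix l assume l: "c * x powr - \<alpha> < l"
    have "((\<lambda>y. c * y powr - \<alpha>) \<longlongrightarrow> c * x powr - \<alpha>) (at_left x)"
      using x by (intro tendsto_intros) auto
    from order_tendstoD(2)[OF this l] obtain b where b: "b < x" "\<And>y. b < y \<Longrightarrow> y < x \<Longrightarrow> c * y powr - \<alpha> < l"
      using eventually_at_left[of "x-1" x] by auto
    obtain y where y: "max b 0 < y" "y < x" using dense[of "max b 0" x] b(1) x by auto
    then have y: "0 < y" "y < x" "c * y powr - \<alpha> < l" using b(2) by auto
    from step[OF y(1,2)] obtain I where I: "(\<lambda>n. real n * (\<integral>z. abs_ramp y x (ereal (z / a n)) \<partial>D)) \<longlonglongrightarrow> I" "I \<le> c * y powr - \<alpha>" by blast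
    from order_tendstoD(2)[OF I(1), of l] y I(2) have "\<forall>\<^sub>F n in sequentially. real n * (\<integral>z. abs_ramp y x (ereal (z / a n)) \<partial>D) < l" by simp
    with G_up[OF y(1,2)] show "\<forall>\<^sub>F n in sequentially. G n x < l" by eventually_elim simp
  qed
  \<comment> \<open>Chosen so that \<open>c * (b * x) powr - \<alpha>\<close> becomes
    \<open>x powr - \<alpha>\<close>.\<close>
  define b where "b = c powr (1 / \<alpha>)"
  have b: "0 < b" "b powr - \<alpha> = 1 / c" using pos \<open>0 < \<alpha>\<close> by (auto simp: b_def c_def powr_powr powr_minus divide_simps)
  show thesis
  \<comment> \<open>The first terms of the given sequence may be nonpositive; the maximum with 1
    repairs them and changes only finitely many terms.\<close>
  proof (rule that[of "\<lambda>n. max 1 (a n * b)"])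
    show "0 < max 1 (a n * b)" for n by simp
    show "incseq (\<lambda>n. max 1 (a n * b))"
      unfolding incseq_def using incseqD[OF a(1)] b by (intro allI impI max.mono mult_right_mono) auto
    have ab: "filterlim (\<lambda>n. a n * b) at_top sequentially"
      using a(2) b by (intro filterlim_at_top_mult_tendsto_pos[OF tendsto_const]) auto
    then show "filterlim (\<lambda>n. max 1 (a n * b)) at_top sequentially"
      by (rule filterlim_at_top_mono) simp
    fix x :: real assume x: "0 < x"
    have "(\<lambda>n. G n (b * x)) \<longlonglongrightarrow> c * (b * x) powr - \<alpha>" using lim[of "b * x"] x b by simp
    also have "c * (b * x) powr - \<alpha> = x powr - \<alpha>" using x b pos by (simp add: powr_mult c_def)
    finally have *: "(\<lambda>n. real n * measure D {z. a n * b * x \<le> \<bar>z\<bar>}) \<longlonglongrightarrow> x powr - \<alpha>"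
      by (simp add: G_def mult.assoc)
    have "\<forall>\<^sub>F n in sequentially. 1 \<le> a n * b"
      using ab unfolding filterlim_at_top by blast
    then have "\<forall>\<^sub>F n in sequentially. real n * measure D {z. a n * b * x \<le> \<bar>z\<bar>} =
        real n * measure D {z. max 1 (a n * b) * x \<le> \<bar>z\<bar>}"
      by eventually_elim (simp add: max_def)
    then show "(\<lambda>n. real n * measure D {z. max 1 (a n * b) * x \<le> \<bar>z\<bar>}) \<longlonglongrightarrow> x powr - \<alpha>"
      using * by (rule Lim_transform_eventually[rotated])
  qed
qed

section \<open>Doubling of the tail and truncated moments\<close>

text \<open>The quotient of the tails at \<open>a n / 2\<close> and \<open>a (Suc n)\<close> tends
  to \<open>2 powr \<alpha>\<close>, since passing from n to \<open>Suc n\<close> costs only the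
  factor \<open>Suc n / n\<close>. Monotonicity carries the bound to every t between two consecutive
  terms, and the gap between \<alpha> and \<open>\<alpha>'\<close> turns the limit into an
  inequality for all large t.\<close>

lemma tail_doubling:
  fixes G :: "real \<Rightarrow> real" and a :: "nat \<Rightarrow> real"
  assumes a: "incseq a" "filterlim a at_top sequentially"
    and anti: "\<And>s t. s \<le> t \<Longrightarrow> G t \<le> G s"
    and lim: "\<And>x. 0 < x \<Longrightarrow> (\<lambda>n. real n * G (a n * x)) \<longlonglongrightarrow> x powr - \<alpha>"
    and "\<alpha> < \<alpha>'"
  obtains t0 where "0 < t0" "\<And>t. t0 \<le> t \<Longrightarrow> 0 < G t" "\<And>t. t0 \<le> t \<Longrightarrow> G (t / 2) \<le> 2 powr \<alpha>' * G t"
proof -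
  have l1: "(\<lambda>n. real (Suc n) * G (a (Suc n))) \<longlonglongrightarrow> 1"
    using LIMSEQ_Suc[OF lim[of 1]] by simp
  have l2: "(\<lambda>n. real (Suc n) / real n * (real n * G (a n / 2))) \<longlonglongrightarrow> 1 * 2 powr \<alpha>"
  proof (intro tendsto_mult)
    show "(\<lambda>n. real (Suc n) / real n) \<longlonglongrightarrow> 1" by (rule LIMSEQ_Suc_n_over_n)
    show "(\<lambda>n. real n * G (a n / 2)) \<longlonglongrightarrow> 2 powr \<alpha>"
      using lim[of "1/2"] by (simp add: powr_divide powr_minus divide_simps)
  qed
  have "(\<lambda>n. 2 powr \<alpha>' * (real (Suc n) * G (a (Suc n))) - real (Suc n) / real n * (real n * G (a n / 2)))
      \<longlonglongrightarrow> 2 powr \<alpha>' * 1 - 1 * 2 powr \<alpha>"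
    by (intro tendsto_diff tendsto_mult[OF tendsto_const] l1 l2)
  moreover have "0 < 2 powr \<alpha>' * 1 - 1 * (2::real) powr \<alpha>" using \<open>\<alpha> < \<alpha>'\<close> by simp
  ultimately have "\<forall>\<^sub>F n in sequentially. 0 < 2 powr \<alpha>' * (real (Suc n) * G (a (Suc n))) - real (Suc n) / real n * (real n * G (a n / 2))"
    by (rule order_tendstoD)
  moreover have "\<forall>\<^sub>F n in sequentially. 0 < real (Suc n) * G (a (Suc n))"
    using order_tendstoD(1)[OF l1, of 0] by simp
  moreover have "\<forall>\<^sub>F n in sequentially. 0 < a n"
    using a(2) by (rule filterlim_at_top_dense[THEN iffD1, rule_format])
  moreover note eventually_gt_at_top[of "0::nat"]
  ultimately have "\<forall>\<^sub>F n in sequentially. G (a n / 2) \<le> 2 powr \<alpha>' * G (a (Suc n)) \<and> 0 < G (a (Suc n)) \<and> 0 < a n"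
  proof eventually_elim
    case (elim n)
    have "real (Suc n) / real n * (real n * G (a n / 2)) = real (Suc n) * G (a n / 2)"
      using elim(4) by simp
    with elim(1) have "real (Suc n) * G (a n / 2) \<le> real (Suc n) * (2 powr \<alpha>' * G (a (Suc n)))"
      by (simp only: mult.left_commute[of "2 powr \<alpha>'"])
    then have "G (a n / 2) \<le> 2 powr \<alpha>' * G (a (Suc n))"
      by (rule mult_left_le_imp_le) simp
    then show ?case using elim by (auto simp: zero_less_mult_iff)
  qed
  then obtain N where N: "\<And>n. N \<le> n \<Longrightarrow> G (a n / 2) \<le> 2 powr \<alpha>' * G (a (Suc n)) \<and> 0 < G (a (Suc n)) \<and> 0 < a n"
    unfolding eventually_sequentially by blast
  have bracket: "\<exists>n\<ge>N. a n \<le> t \<and> t < a (Suc n)" if "a N \<le> t" for t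
  proof -
    \<comment> \<open>The first term of \<open>a\<close> that exceeds t; its predecessor is at most
      t.\<close>
    define n where "n = (LEAST n. t < a n)"
    have ex: "\<exists>n. t < a n"
      using a(2) by (metis eventually_sequentially filterlim_at_top_dense order_refl)
    have n: "t < a n" unfolding n_def using ex by (rule LeastI_ex)
    then have "N < n" using that a(1) by (metis incseqD linorder_not_le order_less_le_trans not_less_iff_gr_or_eq)
    then obtain m where m: "n = Suc m" by (cases n) auto
    have "\<not> t < a m" using not_less_Least[of m "\<lambda>n. t < a n"] m by (simp add: n_def)
    then show ?thesis using n m \<open>N < n\<close> by (intro exI[of _ m]) auto
  qed
  show thesis
  proof (rule that[of "a N"])
    show "0 < a N" using N by blast
    fix t assume "a N \<le> t"
    then obtain n where n: "N \<le> n" "a n \<le> t" "t < a (Suc n)" using bracket by blast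
    have up: "G (a (Suc n)) \<le> G t" using n by (intro anti) simp
    then show "0 < G t" using N[OF n(1)] by simp
    have "G (t / 2) \<le> G (a n / 2)" using n by (intro anti) simp
    also have "\<dots> \<le> 2 powr \<alpha>' * G (a (Suc n))" using N[OF n(1)] by simp
    also have "\<dots> \<le> 2 powr \<alpha>' * G t" using up by simp
    finally show "G (t / 2) \<le> 2 powr \<alpha>' * G t" .
  qed
qed

text \<open>Cut the range below s into dyadic shells. The shell from u to \<open>2 * u\<close>
  contributes at most \<open>(2 * u) powr A * G u\<close>, and by doubling these bounds shrink
  geometrically towards 0, because \<open>\<alpha>'\<close> can be taken below A. So the outermost
  shell, of order \<open>s powr A * G s\<close>, dominates, and what lies below the range of the
  doubling inequality is absorbed into K.\<close>

lemma truncated_moment_bound: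
  fixes D :: "real measure" and a :: "nat \<Rightarrow> real"
  defines "G \<equiv> \<lambda>t. measure D {z. t \<le> \<bar>z\<bar>}"
  assumes "prob_space D" and D[measurable_cong]: "sets D = sets borel"
    and a: "incseq a" "filterlim a at_top sequentially"
    and lim: "\<And>x. 0 < x \<Longrightarrow> (\<lambda>n. real n * G (a n * x)) \<longlonglongrightarrow> x powr - \<alpha>"
    and A: "\<alpha> < A" "0 < A"
  obtains K t0 where "0 < K" "0 < t0"
    "\<And>s. t0 \<le> s \<Longrightarrow> (\<integral>z. \<bar>z\<bar> powr A * indicator {z. \<bar>z\<bar> < s} z \<partial>D) \<le> K * s powr A * G s"
proof -
  interpret D: prob_space D by fact
  have anti: "G t \<le> G s" if "s \<le> t" for s t
    unfolding G_def using that sets_eq_imp_space_eq[OF D] by (intro D.finite_measure_mono) auto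
  obtain \<alpha>' where \<alpha>': "\<alpha> < \<alpha>'" "\<alpha>' < A" using dense[OF A(1)] by blast
  obtain t0 where t0: "0 < t0" "\<And>t. t0 \<le> t \<Longrightarrow> 0 < G t" "\<And>t. t0 \<le> t \<Longrightarrow> G (t / 2) \<le> 2 powr \<alpha>' * G t"
    using tail_doubling[OF a anti lim \<alpha>'(1)] by metis
  define h where "h s = (\<integral>z. \<bar>z\<bar> powr A * indicator {z. \<bar>z\<bar> < s} z \<partial>D)" for s
  have int: "integrable D (\<lambda>z. \<bar>z\<bar> powr A * indicator {z. \<bar>z\<bar> < s} z)" for s
    by (rule D.integrable_const_bound[of _ "\<bar>s\<bar> powr A"])
       (use A in \<open>auto simp: indicator_def intro!: powr_mono2\<close>)
  have bound: "(\<integral>z. \<bar>z\<bar> powr A * indicator {z. s \<le> \<bar>z\<bar> \<and> \<bar>z\<bar> < u} z \<partial>D) \<le> u powr A * G s"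
    and int2: "integrable D (\<lambda>z. \<bar>z\<bar> powr A * indicator {z. s \<le> \<bar>z\<bar> \<and> \<bar>z\<bar> < u} z)" if "0 \<le> u" for s u
  proof -
    show i: "integrable D (\<lambda>z. \<bar>z\<bar> powr A * indicator {z. s \<le> \<bar>z\<bar> \<and> \<bar>z\<bar> < u} z)"
      by (rule D.integrable_const_bound[of _ "\<bar>u\<bar> powr A"])
         (use A in \<open>auto simp: indicator_def intro!: powr_mono2\<close>)
    have "(\<integral>z. \<bar>z\<bar> powr A * indicator {z. s \<le> \<bar>z\<bar> \<and> \<bar>z\<bar> < u} z \<partial>D) \<le> (\<integral>z. u powr A * indicator {z. s \<le> \<bar>z\<bar>} z \<partial>D)"
    proof (intro integral_mono i)
      show "\<bar>z\<bar> powr A * indicator {z. s \<le> \<bar>z\<bar> \<and> \<bar>z\<bar> < u} z \<le> u powr A * indicator {z. s \<le> \<bar>z\<bar>} z" for z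
        using A that by (auto simp: indicator_def intro!: powr_mono2)
    qed (auto intro!: integrable_mult_right simp: integrable_indicator_iff D.emeasure_eq_measure)
    also have "\<dots> = u powr A * G s" by (simp add: G_def sets_eq_imp_space_eq[OF D])
    finally show "(\<integral>z. \<bar>z\<bar> powr A * indicator {z. s \<le> \<bar>z\<bar> \<and> \<bar>z\<bar> < u} z \<partial>D) \<le> u powr A * G s" .
  qed
  have h0: "h u \<le> u powr A" if "0 \<le> u" for u
  proof -
    have "h u \<le> u powr A * G 0" using bound[OF that, of 0] by (simp add: h_def)
    also have "\<dots> \<le> u powr A" by (simp add: G_def mult_left_le)
    finally show ?thesis .
  qed
  have h_double: "h (2 * s) \<le> h s + (2 * s) powr A * G s" if "0 < s" for s
  proof -
    have "h (2 * s) = (\<integral>z. \<bar>z\<bar> powr A * indicator {z. \<bar>z\<bar> < s} z +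
        \<bar>z\<bar> powr A * indicator {z. s \<le> \<bar>z\<bar> \<and> \<bar>z\<bar> < 2 * s} z \<partial>D)"
      unfolding h_def using that by (intro Bochner_Integration.integral_cong) (auto simp: indicator_def)
    also have "\<dots> = h s + (\<integral>z. \<bar>z\<bar> powr A * indicator {z. s \<le> \<bar>z\<bar> \<and> \<bar>z\<bar> < 2 * s} z \<partial>D)"
      unfolding h_def using that by (intro Bochner_Integration.integral_add int int2) auto
    finally show ?thesis using bound[of "2 * s" s] that by simp
  qed
  \<comment> \<open>\<open>h (2 s) \<le> h s + (2 s) powr A G s\<close> propagates the bound from \<open>s\<close> to \<open>2 s\<close> because \<open>q < 1\<close>\<close>
  define q where "q = (2::real) powr (\<alpha>' - A)"
  have q: "0 < q" "q < 1" using \<alpha>' by (auto simp: q_def powr_less_one)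
  \<comment> \<open>The first entry is the least K with \<open>(K + 2 powr A) * q \<le> K\<close>,
    as the inductive step requires. The second covers the interval from \<open>t0\<close> to
    \<open>2 * t0\<close>, where the moment is at most \<open>(2 * t0) powr A\<close> and
    \<open>s powr A * G s\<close> is at least \<open>t0 powr A * G (2 * t0)\<close>.\<close>
  define K where "K = max (2 powr A * q / (1 - q)) ((2 * t0) powr A / (t0 powr A * G (2 * t0)))"
  have K0: "0 < K" using q by (simp add: K_def less_max_iff_disj)
  have "2 powr A * q / (1 - q) \<le> K" by (simp add: K_def)
  then have K1: "(K + 2 powr A) * q \<le> K" using q by (simp add: field_simps)
  have ind: "h s \<le> K * s powr A * G s" if "t0 \<le> s" "s < t0 * 2 ^ Suc k" for k s
    using that
  proof (induction k arbitrary: s)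
    case 0
    then have "h s \<le> (2 * t0) powr A" using h0[of s] t0(1) A by (intro order_trans[OF h0] powr_mono2) auto
    also have "\<dots> = (2 * t0) powr A / (t0 powr A * G (2 * t0)) * (t0 powr A * G (2 * t0))"
      using t0(1) t0(2)[of "2 * t0"] by simp
    also have "\<dots> \<le> K * (s powr A * G s)"
      using 0 t0(1) t0(2)[of "2 * t0"] A K0
      by (intro mult_mono powr_mono2 anti) (auto simp: K_def)
    finally show ?case by (simp add: mult.assoc)
  next
    case (Suc k)
    show ?case
    proof (cases "s < t0 * 2 ^ Suc k")
      case True then show ?thesis using Suc by blast
    next
      case False
      define u where "u = s / 2"
      have s: "s = 2 * u" by (simp add: u_def)
      have "t0 * 2 \<le> t0 * 2 ^ Suc k" using t0(1) by simp
      with False have u: "t0 \<le> u" by (simp add: s)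
      have u2: "u < t0 * 2 ^ Suc k" using Suc.prems(2) by (simp add: s)
      have "h s \<le> h u + (2 * u) powr A * G u" unfolding s using u t0(1) by (intro h_double) simp
      also have "\<dots> \<le> K * u powr A * G u + (2 * u) powr A * G u" using Suc.IH[OF u u2] by simp
      also have "\<dots> = (K + 2 powr A) * u powr A * G u" using u t0(1) by (simp add: powr_mult algebra_simps)
      also have "\<dots> \<le> (K + 2 powr A) * u powr A * (2 powr \<alpha>' * G s)"
        using t0(3)[of s] u t0(1) K0 by (intro mult_left_mono) (auto simp: s)
      also have "\<dots> = ((K + 2 powr A) * q) * s powr A * G s"
        using u t0(1) by (simp add: s powr_mult q_def powr_diff field_simps)
      also have "\<dots> \<le> K * s powr A * G s" using K1 by (intro mult_right_mono) (auto simp: G_def)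
      finally show ?thesis .
    qed
  qed
  show thesis
  proof (rule that[OF K0 t0(1)])
    fix s assume s: "t0 \<le> s"
    obtain k where "s / t0 < 2 ^ k" using real_arch_pow[of 2 "s / t0"] by auto
    then have "s < t0 * 2 ^ k" using t0(1) by (simp add: field_simps)
    also have "\<dots> \<le> t0 * 2 ^ Suc k" using t0(1) by simp
    finally show "(\<integral>z. \<bar>z\<bar> powr A * indicator {z. \<bar>z\<bar> < s} z \<partial>D) \<le> K * s powr A * G s"
      using ind[OF s] by (simp add: h_def)
  qed
qed

section \<open>Multinomial counts and the Poisson limit\<close>

text \<open>The multinomial probability of the counts \<open>c\<close>, with \<open>q\<close> for
  the bins and \<open>r\<close> for the remaining cell, as a recursion that fills the last bin
  first. If \<open>c m > n\<close>, the binomial coefficient is 0, so the truncated difference does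
  no harm.\<close>

primrec multinomial_prob :: "real \<Rightarrow> (nat \<Rightarrow> real) \<Rightarrow> (nat \<Rightarrow> nat) \<Rightarrow> nat \<Rightarrow> nat \<Rightarrow> real" where
  "multinomial_prob r q c n 0 = r ^ n"
| "multinomial_prob r q c n (Suc m) = real (n choose c m) * q m ^ c m * multinomial_prob r q c (n - c m) m"

text \<open>The event on the indices in \<open>J\<close> makes the induction work: removing the last bin moves the
  indices of the points in it from \<open>I\<close> to \<open>J\<close>.\<close>

lemma (in prob_space) prob_bin_counts:
  fixes X :: "'i \<Rightarrow> 'a \<Rightarrow> 'b" and B :: "nat \<Rightarrow> 'b set"
  assumes indep: "indep_vars (\<lambda>_. N) X I0"
    and B: "\<And>k. k < m \<Longrightarrow> B k \<in> sets N" and r: "C \<in> sets N"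
    and disj: "\<And>k l. k < l \<Longrightarrow> l < m \<Longrightarrow> B k \<inter> B l = {}" "\<And>k. k < m \<Longrightarrow> B k \<inter> C = {}"
    and q: "\<And>i k. i \<in> I0 \<Longrightarrow> k < m \<Longrightarrow> prob (X i -` B k \<inter> space M) = q k"
    and rq: "\<And>i. i \<in> I0 \<Longrightarrow> prob (X i -` C \<inter> space M) = r"
    and I: "finite I" "I \<subseteq> I0" and J: "finite J" "J \<subseteq> I0" "I \<inter> J = {}"
    and A: "\<And>j. j \<in> J \<Longrightarrow> A j \<in> sets N"
  shows "{\<omega>\<in>space M. (\<forall>j\<in>J. X j \<omega> \<in> A j) \<and> (\<forall>i\<in>I. X i \<omega> \<in> C \<union> (\<Union>k<m. B k)) \<and>
            (\<forall>k<m. card {i\<in>I. X i \<omega> \<in> B k} = c k)} \<in> events \<and>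
    prob {\<omega>\<in>space M. (\<forall>j\<in>J. X j \<omega> \<in> A j) \<and> (\<forall>i\<in>I. X i \<omega> \<in> C \<union> (\<Union>k<m. B k)) \<and>
            (\<forall>k<m. card {i\<in>I. X i \<omega> \<in> B k} = c k)} =
         (\<Prod>j\<in>J. prob (X j -` A j \<inter> space M)) * multinomial_prob r q c (card I) m"
  using B disj q I J A
proof (induction m arbitrary: I J A)
  case 0
  define A' where "A' i = (if i \<in> J then A i else C)" for i
  have AC: "i \<in> I \<Longrightarrow> A' i = C" "i \<in> J \<Longrightarrow> A' i = A i" for i
    using "0.prems" by (auto simp: A'_def)
  have eq: "{\<omega>\<in>space M. (\<forall>j\<in>J. X j \<omega> \<in> A j) \<and> (\<forall>i\<in>I. X i \<omega> \<in> C)} =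
     (\<Inter>i\<in>I\<union>J. X i -` A' i \<inter> space M) \<inter> space M"
    using AC by fastforce
  have meas: "X i -` A' i \<inter> space M \<in> events" if "i \<in> I \<union> J" for i
    using "0.prems" that indep r by (intro measurable_sets[of _ _ N]) (auto simp: indep_vars_def A'_def)
  have "(\<Inter>i\<in>I\<union>J. X i -` A' i \<inter> space M) \<inter> space M \<in> events"
  proof (cases "I \<union> J = {}")
    case False
    then show ?thesis using meas "0.prems" by (intro sets.Int[OF sets.finite_INT sets.top]) auto
  qed auto
  moreover have "prob ((\<Inter>i\<in>I\<union>J. X i -` A' i \<inter> space M) \<inter> space M) =
      (\<Prod>j\<in>J. prob (X j -` A j \<inter> space M)) * r ^ card I"
  proof (cases "I \<union> J = {}")
    case False
    then have "(\<Inter>i\<in>I\<union>J. X i -` A' i \<inter> space M) \<inter> space M = (\<Inter>i\<in>I\<union>J. X i -` A' i \<inter> space M)" by auto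
    also have "prob \<dots> = (\<Prod>i\<in>I\<union>J. prob (X i -` A' i \<inter> space M))"
      using False "0.prems" r by (intro indep_varsD[OF indep]) (auto simp: A'_def)
    also have "\<dots> = (\<Prod>i\<in>I. prob (X i -` A' i \<inter> space M)) * (\<Prod>i\<in>J. prob (X i -` A' i \<inter> space M))"
      using "0.prems" by (intro prod.union_disjoint) auto
    also have "(\<Prod>i\<in>I. prob (X i -` A' i \<inter> space M)) = (\<Prod>i\<in>I. r)"
      using "0.prems" by (intro prod.cong) (auto simp: A'_def rq)
    also have "(\<Prod>i\<in>J. prob (X i -` A' i \<inter> space M)) = (\<Prod>j\<in>J. prob (X j -` A j \<inter> space M))"
      by (intro prod.cong) (auto simp: A'_def)
    finally show ?thesis by simp
  qed (simp add: prob_space)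
  ultimately show ?case by (simp add: eq)
next
  case (Suc m)
  define \<S> where "\<S> = {S. S \<subseteq> I \<and> card S = c m}"
  have fin: "finite \<S>" using Suc.prems by (auto simp: \<S>_def)
  define A' where "A' S i = (if i \<in> S then B m else A i)" for S i
  define E where "E S = {\<omega>\<in>space M. (\<forall>j\<in>J \<union> S. X j \<omega> \<in> A' S j) \<and> (\<forall>i\<in>I - S. X i \<omega> \<in> C \<union> (\<Union>k<m. B k)) \<and>
            (\<forall>k<m. card {i\<in>I - S. X i \<omega> \<in> B k} = c k)}" for S
  have E: "E S \<in> events \<and> prob (E S) =
     (\<Prod>j\<in>J. prob (X j -` A j \<inter> space M)) * q m ^ c m * multinomial_prob r q c (card I - c m) m"
    if S: "S \<in> \<S>" for S
  proof -
    have "finite S" using S Suc.prems by (auto simp: \<S>_def intro: finite_subset)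
    have "E S \<in> events \<and> prob (E S) =
       (\<Prod>j\<in>J\<union>S. prob (X j -` A' S j \<inter> space M)) * multinomial_prob r q c (card (I - S)) m"
      unfolding E_def using Suc.prems S \<open>finite S\<close>
      by (intro Suc.IH) (auto simp: A'_def \<S>_def less_Suc_eq)
    moreover have "(\<Prod>j\<in>J\<union>S. prob (X j -` A' S j \<inter> space M)) =
       (\<Prod>j\<in>J. prob (X j -` A' S j \<inter> space M)) * (\<Prod>j\<in>S. prob (X j -` A' S j \<inter> space M))"
      using Suc.prems S \<open>finite S\<close> by (intro prod.union_disjoint) (auto simp: \<S>_def)
    moreover have "(\<Prod>j\<in>J. prob (X j -` A' S j \<inter> space M)) = (\<Prod>j\<in>J. prob (X j -` A j \<inter> space M))"
      using Suc.prems S by (intro prod.cong) (auto simp: \<S>_def A'_def)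
    moreover have "(\<Prod>j\<in>S. prob (X j -` A' S j \<inter> space M)) = (\<Prod>j\<in>S. q m)"
      using Suc.prems S by (intro prod.cong) (auto simp: \<S>_def A'_def)
    moreover have "card (I - S) = card I - c m"
      using S \<open>finite S\<close> by (auto simp: \<S>_def card_Diff_subset)
    ultimately show ?thesis using S by (simp add: \<S>_def mult.assoc)
  qed
  \<comment> \<open>The set S can be read off from any outcome in \<open>E S\<close>, as the indices
    of the points in the last bin, so different S give disjoint events.\<close>
  have disjE: "disjoint_family_on E \<S>"
  proof (unfold disjoint_family_on_def, intro ballI impI)
    have *: "S = {i\<in>I. X i \<omega> \<in> B m}" if "S \<in> \<S>" "\<omega> \<in> E S" for S \<omega>
    proof (intro equalityI subsetI)
      fix i assume i: "i \<in> S"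
      then have "X i \<omega> \<in> A' S i" using that unfolding E_def by blast
      then show "i \<in> {i\<in>I. X i \<omega> \<in> B m}" using that i by (auto simp: \<S>_def A'_def)
    next
      fix i assume i: "i \<in> {i\<in>I. X i \<omega> \<in> B m}"
      show "i \<in> S"
      proof (rule ccontr)
        assume "i \<notin> S"
        then have "X i \<omega> \<in> C \<union> (\<Union>k<m. B k)" using that i by (auto simp: E_def)
        then show False using i Suc.prems(2)[of _ m] Suc.prems(3)[of m] by auto
      qed
    qed
    fix S T assume "S \<in> \<S>" "T \<in> \<S>" "S \<noteq> T"
    then show "E S \<inter> E T = {}" using * by blast
  qed
  have un: "{\<omega>\<in>space M. (\<forall>j\<in>J. X j \<omega> \<in> A j) \<and> (\<forall>i\<in>I. X i \<omega> \<in> C \<union> (\<Union>k<Suc m. B k)) \<and>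
            (\<forall>k<Suc m. card {i\<in>I. X i \<omega> \<in> B k} = c k)} = (\<Union>S\<in>\<S>. E S)" (is "?L = _")
  proof (intro equalityI subsetI)
    fix \<omega> assume w: "\<omega> \<in> ?L"
    define S where "S = {i\<in>I. X i \<omega> \<in> B m}"
    have "S \<in> \<S>" using w by (auto simp: S_def \<S>_def)
    moreover have "{i\<in>I - S. X i \<omega> \<in> B k} = {i\<in>I. X i \<omega> \<in> B k}" if "k < m" for k
      using Suc.prems(2)[OF that] by (auto simp: S_def)
    then have "\<omega> \<in> E S"
      using w Suc.prems(7) by (auto simp: E_def A'_def S_def less_Suc_eq lessThan_Suc)
    ultimately show "\<omega> \<in> (\<Union>S\<in>\<S>. E S)" by blast
  next
    fix \<omega> assume "\<omega> \<in> (\<Union>S\<in>\<S>. E S)"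
    then obtain S where S: "S \<in> \<S>" "\<omega> \<in> E S" by blast
    have SB: "X i \<omega> \<in> B m" if "i \<in> S" for i
    proof -
      have "X i \<omega> \<in> A' S i" using S that unfolding E_def by blast
      then show ?thesis using that by (simp add: A'_def)
    qed
    have nSB: "X i \<omega> \<notin> B m" if "i \<in> I - S" for i
    proof -
      have "X i \<omega> \<in> C \<union> (\<Union>k<m. B k)" using S that by (auto simp: E_def)
      then show ?thesis using Suc.prems(2)[of _ m] Suc.prems(3)[of m] by auto
    qed
    have "{i\<in>I. X i \<omega> \<in> B m} = S" using SB nSB S by (auto simp: \<S>_def)
    moreover have "{i\<in>I. X i \<omega> \<in> B k} = {i\<in>I - S. X i \<omega> \<in> B k}" if "k < m" for k
      using Suc.prems(2)[OF that] SB by auto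
    moreover have "X j \<omega> \<in> A j" if "j \<in> J" for j
    proof -
      have "j \<notin> S" using S that Suc.prems(9) by (auto simp: \<S>_def)
      moreover have "X j \<omega> \<in> A' S j" using S that unfolding E_def by blast
      ultimately show ?thesis by (simp add: A'_def)
    qed
    moreover have "X i \<omega> \<in> C \<union> (\<Union>k<Suc m. B k)" if "i \<in> I" for i
      using S SB[of i] that by (cases "i \<in> S") (auto simp: E_def lessThan_Suc)
    ultimately show "\<omega> \<in> ?L" using S by (auto simp: \<S>_def E_def less_Suc_eq)
  qed
  have "(\<Union>S\<in>\<S>. E S) \<in> events" using E fin by auto
  moreover have "prob (\<Union>S\<in>\<S>. E S) = (\<Sum>S\<in>\<S>. prob (E S))"
    using E fin disjE by (intro finite_measure_finite_Union) auto
  moreover have "\<dots> = real (card I choose c m) * ((\<Prod>j\<in>J. prob (X j -` A j \<inter> space M)) * q m ^ c m *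
      multinomial_prob r q c (card I - c m) m)"
    using E n_subsets[of I "c m"] Suc.prems by (simp add: \<S>_def)
  ultimately show ?case unfolding un by (simp add: algebra_simps)
qed

section \<open>Poisson limit of the multinomial probabilities\<close>

text \<open>Compare with \<open>(1 - \<Lambda> / n) ^ n\<close>: for numbers of modulus at most 1
  the n-th powers differ by at most n times the difference of the bases, here
  \<open>\<bar>n * (1 - r n) - \<Lambda>\<bar>\<close>. Dropping a fixed number s of factors does
  not affect the limit since \<open>r n\<close> tends to 1.\<close>

lemma power_tendsto_exp:
  fixes r :: "nat \<Rightarrow> real"
  assumes lim: "(\<lambda>n. real n * (1 - r n)) \<longlonglongrightarrow> \<Lambda>" and r: "\<And>n. 0 \<le> r n" "\<And>n. r n \<le> 1" and "0 \<le> \<Lambda>"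
  shows "(\<lambda>n. r n ^ (n - s)) \<longlonglongrightarrow> exp (- \<Lambda>)"
proof -
  have r1: "r \<longlonglongrightarrow> 1"
  proof -
    have "(\<lambda>n. 1 - real n * (1 - r n) * inverse (real n)) \<longlonglongrightarrow> 1 - \<Lambda> * 0"
      by (intro tendsto_intros lim lim_inverse_n)
    moreover have "\<forall>\<^sub>F n in sequentially. 1 - real n * (1 - r n) * inverse (real n) = r n"
      using eventually_gt_at_top[of 0] by eventually_elim (simp add: field_simps)
    ultimately show ?thesis by (simp add: tendsto_cong)
  qed
  have "(\<lambda>n. r n ^ n - (1 + (- \<Lambda>) / real n) ^ n) \<longlonglongrightarrow> 0"
  proof (rule Lim_null_comparison)
    show "(\<lambda>n. \<bar>real n * (1 - r n) - \<Lambda>\<bar>) \<longlonglongrightarrow> 0"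
      using lim by (simp add: LIM_zero_iff tendsto_rabs_zero)
    show "\<forall>\<^sub>F n in sequentially. norm (r n ^ n - (1 + (- \<Lambda>) / real n) ^ n) \<le> \<bar>real n * (1 - r n) - \<Lambda>\<bar>"
      using eventually_gt_at_top[of "0::nat"] eventually_ge_at_top[of "nat \<lceil>\<Lambda>\<rceil>"]
    proof eventually_elim
      case (elim n)
      then have "\<Lambda> \<le> real n" by linarith
      with elim have "norm (1 + (- \<Lambda>) / real n) \<le> 1" using \<open>0 \<le> \<Lambda>\<close> by (simp add: field_simps abs_le_iff)
      then have "norm (r n ^ n - (1 + (- \<Lambda>) / real n) ^ n) \<le> real n * norm (r n - (1 + (- \<Lambda>) / real n))"
        using r by (intro norm_power_diff) (auto simp: abs_le_iff intro: order_trans[of _ 0])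
      also have "\<dots> = \<bar>real n * (r n - (1 + (- \<Lambda>) / real n))\<bar>" by (simp add: abs_mult)
      also have "real n * (r n - (1 + (- \<Lambda>) / real n)) = - (real n * (1 - r n) - \<Lambda>)"
        using elim by (simp add: field_simps)
      finally show ?case by simp
    qed
  qed
  from tendsto_add[OF this tendsto_exp_limit_sequentially[of "- \<Lambda>"]]
  have n: "(\<lambda>n. r n ^ n) \<longlonglongrightarrow> exp (- \<Lambda>)" by simp
  have "(\<lambda>n. r n ^ n / r n ^ s) \<longlonglongrightarrow> exp (- \<Lambda>) / 1 ^ s"
    by (intro tendsto_intros n r1) auto
  moreover have "\<forall>\<^sub>F n in sequentially. r n ^ n / r n ^ s = r n ^ (n - s)"
    using order_tendstoD(1)[OF r1 zero_less_one] eventually_ge_at_top[of s]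
    by eventually_elim (simp add: power_diff)
  ultimately show ?thesis by (simp add: tendsto_cong)
qed

text \<open>The coefficient is a product of k factors \<open>n - s - i\<close> over
  \<open>fact k\<close>. Each of them, paired with one factor \<open>q n\<close>, tends to \<mu>
  because s and i are fixed.\<close>

lemma choose_times_power_tendsto:
  fixes q :: "nat \<Rightarrow> real"
  assumes lim: "(\<lambda>n. real n * q n) \<longlonglongrightarrow> \<mu>"
  shows "(\<lambda>n. real (n - s choose k) * q n ^ k) \<longlonglongrightarrow> \<mu> ^ k / fact k"
proof -
  have "(\<lambda>n. (\<Prod>i<k. (1 - real s * inverse (real n) - real i * inverse (real n)) * (real n * q n)) / fact k)
     \<longlonglongrightarrow> (\<Prod>i<k. (1 - real s * 0 - real i * 0) * \<mu>) / fact k"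
    by (intro tendsto_intros lim lim_inverse_n) auto
  moreover have "\<forall>\<^sub>F n in sequentially. (\<Prod>i<k. (1 - real s * inverse (real n) - real i * inverse (real n)) * (real n * q n)) / fact k
      = real (n - s choose k) * q n ^ k"
    using eventually_gt_at_top[of "0::nat"] eventually_ge_at_top[of s]
  proof eventually_elim
    case (elim n)
    have "(\<Prod>i<k. (1 - real s * inverse (real n) - real i * inverse (real n)) * (real n * q n)) =
        (\<Prod>i<k. (real (n - s) - real i) * q n)"
      using elim by (intro prod.cong) (auto simp: of_nat_diff field_simps)
    also have "\<dots> = (\<Prod>i<k. real (n - s) - real i) * q n ^ k" by (simp add: prod.distrib)
    finally show ?case by (simp add: binomial_gbinomial gbinomial_prod_rev atLeast0LessThan)
  qed
  ultimately show ?thesis by (simp add: tendsto_cong)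
qed

text \<open>The shift s is there for the induction: splitting off a bin replaces s by
  \<open>s + c m\<close>.\<close>

lemma multinomial_prob_tendsto:
  assumes r: "(\<lambda>n. real n * (1 - r n)) \<longlonglongrightarrow> \<Lambda>" "\<And>n. 0 \<le> r n" "\<And>n. r n \<le> 1" "0 \<le> \<Lambda>"
    and q: "\<And>k. k < m \<Longrightarrow> (\<lambda>n. real n * q n k) \<longlonglongrightarrow> \<mu> k"
  shows "(\<lambda>n. multinomial_prob (r n) (q n) c (n - s) m) \<longlonglongrightarrow> exp (- \<Lambda>) * (\<Prod>k<m. \<mu> k ^ c k / fact (c k))"
  using q
proof (induction m arbitrary: s)
  case 0
  then show ?case using power_tendsto_exp[OF r] by simp
next
  case (Suc m)
  have "(\<lambda>n. real (n - s choose c m) * q n m ^ c m * multinomial_prob (r n) (q n) c (n - (s + c m)) m) \<longlonglongrightarrow>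
      \<mu> m ^ c m / fact (c m) * (exp (- \<Lambda>) * (\<Prod>k<m. \<mu> k ^ c k / fact (c k)))"
    using Suc.prems by (intro tendsto_mult[OF choose_times_power_tendsto Suc.IH]) auto
  then show ?case by (simp add: mult_ac)
qed

text \<open>For fixed n the counts are dependent, as they compete for the same n points. In the
  limit nearly all points fall into the remaining cell, whose probability contributes the
  exponential of minus the sum of the means; this exponential splits over the bins, which yields
  independent Poisson counts.\<close>

lemma (in prob_space) bin_counts_tendsto_poisson:
  fixes X :: "nat \<Rightarrow> 'a \<Rightarrow> 'b" and B :: "nat \<Rightarrow> nat \<Rightarrow> 'b set"
  assumes indep: "indep_vars (\<lambda>_. N) X {1..}"
    and B: "\<And>n k. k < m \<Longrightarrow> B n k \<in> sets N"
    and disj: "\<And>n k l. k < l \<Longrightarrow> l < m \<Longrightarrow> B n k \<inter> B n l = {}"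
    and id: "\<And>i A. 1 \<le> i \<Longrightarrow> A \<in> sets N \<Longrightarrow> prob (X i -` A \<inter> space M) = prob (X 1 -` A \<inter> space M)"
    and lim: "\<And>k. k < m \<Longrightarrow> (\<lambda>n. real n * prob (X 1 -` B n k \<inter> space M)) \<longlonglongrightarrow> \<mu> k"
    and pos: "\<And>k. k < m \<Longrightarrow> 0 < \<mu> k"
  shows "(\<lambda>n. prob {\<omega>\<in>space M. \<forall>k<m. card {i\<in>{1..n}. X i \<omega> \<in> B n k} = c k})
     \<longlonglongrightarrow> (\<Prod>k<m. pmf (poisson_pmf (\<mu> k)) (c k))"
proof -
  have X1: "X i \<in> measurable M N" if "1 \<le> i" for i using indep that by (auto simp: indep_vars_def)
  define C where "C n = space N - (\<Union>k<m. B n k)" for n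
  define q where "q n k = prob (X 1 -` B n k \<inter> space M)" for n k
  define r where "r n = prob (X 1 -` C n \<inter> space M)" for n
  have C: "C n \<in> sets N" for n using B by (auto simp: C_def)
  have rq: "1 - r n = (\<Sum>k<m. q n k)" for n
  proof -
    have "X 1 -` C n \<inter> space M = space M - (\<Union>k<m. X 1 -` B n k \<inter> space M)"
      using measurable_space[OF X1[of 1]] by (auto simp: C_def)
    moreover have "(\<Union>k<m. X 1 -` B n k \<inter> space M) \<in> events"
      using B X1[of 1] by (intro sets.finite_UN) (auto intro: measurable_sets)
    ultimately have "r n = 1 - prob (\<Union>k<m. X 1 -` B n k \<inter> space M)"
      by (simp add: r_def prob_compl)
    moreover have "prob (\<Union>k<m. X 1 -` B n k \<inter> space M) = (\<Sum>k<m. q n k)"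
      unfolding q_def
    proof (rule finite_measure_finite_Union)
      show "(\<lambda>k. X 1 -` B n k \<inter> space M) ` {..<m} \<subseteq> events"
        using B X1[of 1] by (auto intro: measurable_sets)
      show "disjoint_family_on (\<lambda>k. X 1 -` B n k \<inter> space M) {..<m}"
        unfolding disjoint_family_on_def
      proof (intro ballI impI)
        fix k l assume "k \<in> {..<m}" "l \<in> {..<m}" "k \<noteq> l"
        then have "B n k \<inter> B n l = {}"
          using disj[of k l n] disj[of l k n] by (cases "k < l") (auto simp: Int_commute)
        then show "(X 1 -` B n k \<inter> space M) \<inter> (X 1 -` B n l \<inter> space M) = {}" by blast
      qed
    qed simp
    ultimately show ?thesis by simp
  qed
  have eq: "prob {\<omega>\<in>space M. \<forall>k<m. card {i\<in>{1..n}. X i \<omega> \<in> B n k} = c k} =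
      multinomial_prob (r n) (q n) c (n - 0) m" for n
  proof -
    \<comment> \<open>With no prescribed indices, and \<open>C n\<close> the complement of the bins,
      the first two conditions are void.\<close>
    have "{\<omega>\<in>space M. (\<forall>j\<in>{}. X j \<omega> \<in> {}) \<and> (\<forall>i\<in>{1..n}. X i \<omega> \<in> C n \<union> (\<Union>k<m. B n k)) \<and>
            (\<forall>k<m. card {i\<in>{1..n}. X i \<omega> \<in> B n k} = c k)}
        = {\<omega>\<in>space M. \<forall>k<m. card {i\<in>{1..n}. X i \<omega> \<in> B n k} = c k}"
      using measurable_space[OF X1] by (auto simp: C_def)
    moreover have "prob {\<omega>\<in>space M. (\<forall>j\<in>{}. X j \<omega> \<in> {}) \<and> (\<forall>i\<in>{1..n}. X i \<omega> \<in> C n \<union> (\<Union>k<m. B n k)) \<and>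
            (\<forall>k<m. card {i\<in>{1..n}. X i \<omega> \<in> B n k} = c k)} =
         (\<Prod>j\<in>{}. prob (X j -` {} \<inter> space M)) * multinomial_prob (r n) (q n) c (card {1..n}) m"
    proof (intro prob_bin_counts[OF indep, THEN conjunct2])
      show "prob (X i -` B n k \<inter> space M) = q n k" if "i \<in> {1..}" "k < m" for i k
        unfolding q_def using that by (intro id B) auto
      show "prob (X i -` C n \<inter> space M) = r n" if "i \<in> {1..}" for i
        unfolding r_def using that by (intro id C) auto
    qed (use B C disj in \<open>auto simp: C_def\<close>)
    ultimately show ?thesis by simp
  qed
  have "(\<lambda>n. multinomial_prob (r n) (q n) c (n - 0) m) \<longlonglongrightarrow>
     exp (- (\<Sum>k<m. \<mu> k)) * (\<Prod>k<m. \<mu> k ^ c k / fact (c k))"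
  proof (rule multinomial_prob_tendsto)
    show "(\<lambda>n. real n * (1 - r n)) \<longlonglongrightarrow> (\<Sum>k<m. \<mu> k)"
      unfolding rq sum_distrib_left using lim by (intro tendsto_sum) (auto simp: q_def)
    show "0 \<le> (\<Sum>k<m. \<mu> k)" using pos by (intro sum_nonneg) (auto intro: less_imp_le)
  qed (use lim in \<open>auto simp: r_def q_def\<close>)
  also have "exp (- (\<Sum>k<m. \<mu> k)) * (\<Prod>k<m. \<mu> k ^ c k / fact (c k)) = (\<Prod>k<m. pmf (poisson_pmf (\<mu> k)) (c k))"
    using pos by (simp add: sum_negf[symmetric] exp_sum prod.distrib[symmetric] less_imp_le mult_ac)
  finally show ?thesis unfolding eq .
qed

text \<open>The limit is a probability, so no mass can escape: finite subsets of B bound the limit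
  inferior from below, and the same bound for the complement of B bounds the limit superior from
  above.\<close>

lemma (in prob_space) prob_tendsto_of_pmf_tendsto:
  fixes X :: "nat \<Rightarrow> 'a \<Rightarrow> 'b"
  assumes X: "\<And>n. X n \<in> measurable M (count_space UNIV)"
    and lim: "\<And>c. (\<lambda>n. prob (X n -` {c} \<inter> space M)) \<longlonglongrightarrow> pmf Q c"
  shows "(\<lambda>n. prob (X n -` B \<inter> space M)) \<longlonglongrightarrow> measure_pmf.prob Q B"
proof -
  have meas: "X n -` B \<inter> space M \<in> events" for n B using X by (rule measurable_sets) simp
  have low: "\<forall>\<^sub>F n in sequentially. measure_pmf.prob Q B - e < prob (X n -` B \<inter> space M)" if "0 < e" for B e
  proof -
    have "pmf Q summable_on B" using abs_summable_equivalent pmf_abs_summable by (blast intro: abs_summable_summable)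
    then have "(pmf Q has_sum measure_pmf.prob Q B) B"
      by (simp add: measure_pmf_conv_infsetsum infsetsum_infsum pmf_abs_summable)
    then have "((sum (pmf Q)) \<longlongrightarrow> measure_pmf.prob Q B) (finite_subsets_at_top B)"
      by (simp add: has_sum_def)
    from order_tendstoD(1)[OF this, of "measure_pmf.prob Q B - e"] \<open>0 < e\<close>
    obtain F where F: "finite F" "F \<subseteq> B" "measure_pmf.prob Q B - e < sum (pmf Q) F"
      unfolding eventually_finite_subsets_at_top by auto
    have "(\<lambda>n. \<Sum>c\<in>F. prob (X n -` {c} \<inter> space M)) \<longlonglongrightarrow> sum (pmf Q) F"
      by (intro tendsto_sum lim)
    from order_tendstoD(1)[OF this F(3)] show ?thesis
    proof eventually_elim
      case (elim n)
      have "(\<Sum>c\<in>F. prob (X n -` {c} \<inter> space M)) = prob (\<Union>c\<in>F. X n -` {c} \<inter> space M)"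
        using F(1) meas by (intro finite_measure_finite_Union[symmetric]) (auto simp: disjoint_family_on_def)
      also have "\<dots> \<le> prob (X n -` B \<inter> space M)" using F meas by (intro finite_measure_mono) auto
      finally show ?case using elim by simp
    qed
  qed
  show ?thesis
  proof (rule order_tendstoI)
    fix l assume "l < measure_pmf.prob Q B"
    then show "\<forall>\<^sub>F n in sequentially. l < prob (X n -` B \<inter> space M)"
      using low[of "measure_pmf.prob Q B - l" B] by simp
  next
    fix l assume l: "measure_pmf.prob Q B < l"
    have "prob (X n -` (- B) \<inter> space M) = 1 - prob (X n -` B \<inter> space M)" for n
    proof -
      have "X n -` (- B) \<inter> space M = space M - (X n -` B \<inter> space M)" by auto
      then show ?thesis using prob_compl[OF meas[of n B]] by simp
    qed
    moreover have "measure_pmf.prob Q (- B) = 1 - measure_pmf.prob Q B"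
      using measure_pmf.prob_compl[of B Q] by (simp add: Compl_eq_Diff_UNIV)
    ultimately show "\<forall>\<^sub>F n in sequentially. prob (X n -` B \<inter> space M) < l"
      using low[of "l - measure_pmf.prob Q B" "- B"] l by simp
  qed
qed

section \<open>Discretising the ratio of sum and maximum\<close>

text \<open>The end points of the cells are 0, \<open>\<delta>\<close>, \<open>\<delta> * s\<close>,
  \<open>\<delta> * s ^ 2\<close> and so on. The cell next to the origin is the only one whose end
  points do not have ratio \<open>s\<close>.\<close>

definition geometric_grid :: "real \<Rightarrow> real \<Rightarrow> nat \<Rightarrow> real" where
  "geometric_grid \<delta> s k = (case k of 0 \<Rightarrow> 0 | Suc i \<Rightarrow> \<delta> * s ^ i)"

lemma geometric_grid_simps [simp]:
  "geometric_grid \<delta> s 0 = 0" "geometric_grid \<delta> s (Suc k) = \<delta> * s ^ k"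
  by (simp_all add: geometric_grid_def)

lemma strict_mono_geometric_grid:
  assumes "0 < \<delta>" "1 < s" shows "strict_mono (geometric_grid \<delta> s)"
proof (rule strict_mono_Suc_iff[THEN iffD2, rule_format])
  fix n show "geometric_grid \<delta> s n < geometric_grid \<delta> s (Suc n)"
    using assms by (cases n) auto
qed

text \<open>The ratio of sum to maximum when every point of cell k is given the weight
  \<open>w k\<close>. For decreasing weights the maximum is the weight of the first occupied
  cell.\<close>

definition binned_ratio :: "(nat \<Rightarrow> real) \<Rightarrow> nat \<Rightarrow> (nat \<Rightarrow> nat) \<Rightarrow> real" where
  "binned_ratio w m c = (\<Sum>k<m. real (c k) * w k) / w (LEAST k. 0 < c k)"

lemma exists_bin:
  fixes t :: "nat \<Rightarrow> real"
  assumes "t 0 < x" "x \<le> t m"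
  obtains k where "k < m" "t k < x" "x \<le> t (Suc k)"
proof -
  define l where "l = (LEAST l. x \<le> t l)"
  have l: "x \<le> t l" unfolding l_def using assms(2) by (rule LeastI)
  have lm: "l \<le> m" unfolding l_def using assms(2) by (rule Least_le)
  have "l \<noteq> 0" using l assms(1) by (intro notI) simp
  then obtain k where k: "l = Suc k" by (cases l) auto
  have "\<not> x \<le> t k" using not_less_Least[of k "\<lambda>l. x \<le> t l"] k by (simp add: l_def)
  then show thesis using that[of k] l lm k by simp
qed

lemma finite_bounded_below_of_summable:
  fixes f :: "nat \<Rightarrow> real"
  assumes "summable (\<lambda>j. f (Suc j))" "0 < w"
  shows "finite {j\<in>{1..}. w \<le> f j}"
proof -
  have "(\<lambda>j. f (Suc j)) \<longlonglongrightarrow> 0" using assms(1) by (rule summable_LIMSEQ_zero)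
  then have "\<forall>\<^sub>F j in sequentially. f (Suc j) < w" using assms(2) by (rule order_tendstoD)
  then obtain n where n: "\<And>j. n \<le> j \<Longrightarrow> f (Suc j) < w" unfolding eventually_sequentially by blast
  have "{j\<in>{1..}. w \<le> f j} \<subseteq> {..n}"
  proof
    fix j assume j: "j \<in> {j\<in>{1..}. w \<le> f j}"
    then obtain i where "j = Suc i" by (cases j) auto
    then show "j \<in> {..n}" using n[of i] j by (cases "n \<le> i") auto
  qed
  then show ?thesis by (rule finite_subset) simp
qed

text \<open>Outside the first cell, rounding a point up to the end of its cell divides its weight by
  a factor between 1 and \<open>s powr \<beta>\<close>, which compares both the sums and the maxima.
  The largest weight belongs to the first occupied cell. As this cell precedes \<open>m'\<close>,
  the hypothesis on the part beyond \<open>t m\<close> makes it small relative to the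
  maximum.\<close>

lemma sum_max_ratio_binned_bounds:
  fixes u :: "nat \<Rightarrow> real" and \<beta> \<delta> s \<eta> :: real
  defines "V \<equiv> \<lambda>j. u j powr - \<beta>" and "t \<equiv> geometric_grid \<delta> s"
  defines "N \<equiv> \<lambda>k. card {j\<in>{1..}. t k < u j \<and> u j \<le> t (Suc k)}"
  defines "w \<equiv> \<lambda>k. t (Suc k) powr - \<beta>"
  assumes "0 < \<beta>" "0 < \<delta>" "1 < s"
    and nonneg: "\<And>j. 1 \<le> j \<Longrightarrow> 0 \<le> u j"
    and summ: "summable (\<lambda>j. V (Suc j))"
    and N0: "N 0 = 0" and k0: "k0 < m'" "0 < N k0" "m' \<le> m"
    and j0: "1 \<le> j0" "\<And>j. 1 \<le> j \<Longrightarrow> V j \<le> V j0"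
    and c: "\<And>k. c k = (if k < m then N k else 0)"
    and rest: "(\<Sum>j. V (Suc j) * indicator {t m<..} (u (Suc j))) \<le> \<eta> * t m' powr - \<beta>"
    and "0 \<le> \<eta>"
  shows "0 < V j0" "binned_ratio w m c / s powr \<beta> \<le> (\<Sum>j. V (Suc j)) / V j0"
    "(\<Sum>j. V (Suc j)) / V j0 \<le> (1 + \<eta>) * s powr \<beta> * binned_ratio w m c"
proof -
  have sm: "strict_mono t" unfolding t_def using assms by (intro strict_mono_geometric_grid)
  have t0: "t 0 = 0" by (simp add: t_def)
  have t_pos: "0 < t (Suc k)" for k using assms by (simp add: t_def)
  have w_pos: "0 < w k" for k using t_pos[of k] by (simp add: w_def)
  have V_nonneg: "0 \<le> V j" for j by (simp add: V_def)
  define b where "b k = {j\<in>{1..}. t k < u j \<and> u j \<le> t (Suc k)}" for k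
  have u_pos: "0 < u j" if "j \<in> b k" for j k
    using that sm[THEN strict_mono_mono, THEN monoD, of 0 k] t0 by (auto simp: b_def)
  have V_ge: "w k \<le> V j" if "j \<in> b k" for j k
    unfolding w_def V_def using u_pos[OF that] that \<open>0 < \<beta>\<close> by (intro powr_mono2') (auto simp: b_def)
  have fin: "finite (b k)" for k
    by (rule finite_subset[OF _ finite_bounded_below_of_summable[OF summ w_pos[of k]]])
       (use V_ge in \<open>auto simp: b_def\<close>)
  have b_empty: "b k = {}" if "N k = 0" for k using that fin[of k] by (simp add: N_def b_def)
  have ratio: "t k powr - \<beta> = s powr \<beta> * w k" if k: "k \<noteq> 0" for k
  proof -
    obtain i where "k = Suc i" using k by (cases k) auto
    then have "t (Suc k) = s * t k" "0 < t k" using \<open>0 < \<delta>\<close> \<open>1 < s\<close> by (simp_all add: t_def)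
    then have "s powr \<beta> * w k = (s powr \<beta> * s powr - \<beta>) * t k powr - \<beta>"
      using \<open>1 < s\<close> by (simp add: w_def powr_mult)
    then show ?thesis using \<open>1 < s\<close> by (simp flip: powr_add)
  qed
  have V_le: "V j \<le> s powr \<beta> * w k" if "j \<in> b k" for j k
  proof -
    \<comment> \<open>The first cell is empty, so the left end point of the cell of j is
      positive.\<close>
    have "k \<noteq> 0" using that b_empty[OF N0] by (intro notI) auto
    then have "0 < t k" using t_pos by (cases k) auto
    have "V j \<le> t k powr - \<beta>"
      unfolding V_def using \<open>0 < t k\<close> that \<open>0 < \<beta>\<close> by (intro powr_mono2') (auto simp: b_def)
    then show ?thesis using ratio[OF \<open>k \<noteq> 0\<close>] by simp
  qed
  define kk where "kk = (LEAST k. 0 < N k)"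
  have kk: "0 < N kk" unfolding kk_def using k0(2) by (rule LeastI)
  have kk_le: "kk \<le> k0" unfolding kk_def using k0(2) by (rule Least_le)
  have kk_min: "N k = 0" if "k < kk" for k using not_less_Least[of k "\<lambda>k. 0 < N k"] that by (simp add: kk_def)
  have kk_eq: "(LEAST k. 0 < c k) = kk"
  proof (rule Least_equality)
    show "0 < c kk" using kk kk_le k0 by (simp add: c)
    fix k assume "0 < c k" then show "kk \<le> k" using kk_min[of k] by (auto simp: c split: if_splits intro: leI)
  qed
  have "card (b kk) > 0" using kk by (simp add: N_def b_def)
  then obtain j1 where j1: "j1 \<in> b kk" by (cases "b kk = {}") auto
  have "w kk \<le> V j1" using V_ge[OF j1] .
  also have "V j1 \<le> V j0" using j1 by (intro j0) (auto simp: b_def)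
  finally have V0_ge: "w kk \<le> V j0" .
  then show V0_pos: "0 < V j0" using w_pos[of kk] by simp
  have u0: "0 < u j0" using V0_pos nonneg[OF j0(1)] by (cases "u j0 = 0") (auto simp: V_def)
  \<comment> \<open>The largest weight is at least the rounded weight of cell \<open>kk\<close>, so
    its point lies no further out than this cell; and no earlier cell is occupied.\<close>
  have "u j0 \<le> t (Suc kk)"
  proof (rule ccontr)
    assume "\<not> ?thesis"
    then have "V j0 < w kk" unfolding V_def w_def using \<open>0 < \<beta>\<close> t_pos by (intro powr_less_mono2_neg) auto
    then show False using V0_ge by simp
  qed
  then obtain k where k: "k < Suc kk" "t k < u j0" "u j0 \<le> t (Suc k)"
    using exists_bin[of t "u j0" "Suc kk"] u0 t0 by auto
  then have "j0 \<in> b k" using j0(1) by (simp add: b_def)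
  then have "k = kk" using k(1) kk_min[of k] b_empty[of k] by (cases "k = kk") auto
  then have V0_le: "V j0 \<le> s powr \<beta> * w kk" using V_le[OF \<open>j0 \<in> b k\<close>] by simp
  define R where "R = (\<Sum>j. V (Suc j) * indicator {t m<..} (u (Suc j)))"
  define S where "S = (\<Sum>k<m. \<Sum>j\<in>b k. V j)"
  have bdisj: "b k \<inter> b l = {}" if "k < l" for k l
    using sm[THEN strict_mono_mono, THEN monoD, of "Suc k" l] that by (auto simp: b_def)
  have total: "(\<Sum>j. V (Suc j)) = R + S"
  proof -
    have sR: "summable (\<lambda>j. V (Suc j) * indicator {t m<..} (u (Suc j)))"
      by (rule summable_comparison_test'[OF summ, of 0]) (auto simp: indicator_def V_nonneg)
    \<comment> \<open>A positive point lies beyond \<open>t m\<close> or in one of the first m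
      cells. A point 0 is in neither place, but its weight \<open>0 powr - \<beta>\<close> is
      0.\<close>
    have dec: "V (Suc j) = V (Suc j) * indicator {t m<..} (u (Suc j)) + (if Suc j \<in> (\<Union>k<m. b k) then V (Suc j) else 0)" for j
    proof (cases "u (Suc j) = 0")
      case False
      then have u: "0 < u (Suc j)" using nonneg[of "Suc j"] by simp
      show ?thesis
      proof (cases "u (Suc j) \<le> t m")
        case True
        then obtain k where "k < m" "t k < u (Suc j)" "u (Suc j) \<le> t (Suc k)"
          using exists_bin[of t "u (Suc j)" m] u t0 by auto
        then have "Suc j \<in> (\<Union>k<m. b k)" by (auto simp: b_def)
        then show ?thesis using True by simp
      next
        case False
        have "Suc j \<notin> (\<Union>k<m. b k)"
        proof
          assume "Suc j \<in> (\<Union>k<m. b k)"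
          then obtain k where "k < m" "u (Suc j) \<le> t (Suc k)" by (auto simp: b_def)
          then show False using False sm[THEN strict_mono_mono, THEN monoD, of "Suc k" m] by simp
        qed
        then show ?thesis using False by simp
      qed
    qed (simp add: V_def)
    define I where "I = {j. Suc j \<in> (\<Union>k<m. b k)}"
    have sucI: "Suc ` I = (\<Union>k<m. b k)"
    proof (intro equalityI subsetI)
      fix i assume i: "i \<in> (\<Union>k<m. b k)"
      then obtain j where "i = Suc j" by (cases i) (auto simp: b_def)
      then show "i \<in> Suc ` I" using i by (auto simp: I_def)
    qed (auto simp: I_def)
    have "finite (Suc ` I)" unfolding sucI using fin by blast
    then have finI: "finite I" by (rule finite_imageD) simp
    have sums: "(\<lambda>j. if j \<in> I then V (Suc j) else 0) sums (\<Sum>j\<in>I. V (Suc j))"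
      by (rule sums_If_finite_set[OF finI])
    have "(\<Sum>j. V (Suc j)) = (\<Sum>j. V (Suc j) * indicator {t m<..} (u (Suc j)) + (if j \<in> I then V (Suc j) else 0))"
    proof (rule suminf_cong)
      show "V (Suc j) = V (Suc j) * indicator {t m<..} (u (Suc j)) + (if j \<in> I then V (Suc j) else 0)" for j
        using dec[of j] unfolding I_def mem_Collect_eq .
    qed
    also have "\<dots> = R + (\<Sum>j\<in>I. V (Suc j))"
      unfolding R_def using suminf_add[OF sR sums_summable[OF sums]] sums_unique[OF sums] by simp
    also have "(\<Sum>j\<in>I. V (Suc j)) = (\<Sum>j\<in>Suc ` I. V j)" by (simp add: sum.reindex)
    also have "\<dots> = S"
      unfolding sucI S_def
    proof (intro sum.UNION_disjoint ballI impI)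
      fix k l :: nat assume "k \<noteq> l"
      then show "b k \<inter> b l = {}" using bdisj[of k l] bdisj[of l k] by (cases "k < l") (auto simp: Int_commute)
    qed (use fin in auto)
    finally show ?thesis .
  qed
  define W where "W = (\<Sum>k<m. real (c k) * w k)"
  have cb: "c k = card (b k)" if "k < m" for k using that by (simp add: c N_def b_def)
  have "W \<le> S"
    unfolding W_def S_def
  proof (rule sum_mono)
    fix k assume "k \<in> {..<m}"
    then show "real (c k) * w k \<le> (\<Sum>j\<in>b k. V j)"
      using sum_bounded_below[of "b k" "w k" V] V_ge by (simp add: cb)
  qed
  have "S \<le> s powr \<beta> * W"
    unfolding W_def S_def sum_distrib_left
  proof (rule sum_mono)
    fix k assume "k \<in> {..<m}"
    then show "(\<Sum>j\<in>b k. V j) \<le> s powr \<beta> * (real (c k) * w k)"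
      using sum_bounded_above[of "b k" V "s powr \<beta> * w k"] V_le by (simp add: cb mult_ac)
  qed
  have F: "binned_ratio w m c = W / w kk" by (simp add: binned_ratio_def kk_eq W_def)
  have "real (c kk) * w kk \<le> W"
    unfolding W_def using kk_le k0 by (intro member_le_sum) (auto intro!: mult_nonneg_nonneg less_imp_le[OF w_pos])
  moreover have "1 * w kk \<le> real (c kk) * w kk"
    using w_pos[of kk] kk kk_le k0 by (intro mult_right_mono) (auto simp: c)
  ultimately have W_ge: "w kk \<le> W" by simp
  have R0: "0 \<le> R" unfolding R_def
    by (rule suminf_nonneg[OF summable_comparison_test'[OF summ, of 0]]) (auto simp: indicator_def V_nonneg)
  have s1: "1 \<le> s powr \<beta>" using assms by (intro ge_one_powr_ge_zero) auto
  have "W / w kk / s powr \<beta> = W / (s powr \<beta> * w kk)" by (simp add: field_simps)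
  also have "\<dots> \<le> S / V j0"
    using \<open>W \<le> S\<close> V0_le V0_pos W_ge w_pos[of kk] by (intro frac_le) auto
  also have "\<dots> \<le> (R + S) / V j0" using R0 V0_pos by (simp add: divide_right_mono)
  finally show "binned_ratio w m c / s powr \<beta> \<le> (\<Sum>j. V (Suc j)) / V j0" unfolding total F .
  have "R \<le> \<eta> * t m' powr - \<beta>" using rest by (simp add: R_def)
  \<comment> \<open>Since \<open>kk \<le> k0 < m'\<close>, the right end of cell \<open>kk\<close>
    is at most \<open>t m'\<close>.\<close>
  also have "\<dots> \<le> \<eta> * w kk"
    unfolding w_def using \<open>0 \<le> \<eta>\<close> \<open>0 < \<beta>\<close> t_pos kk_le k0 sm[THEN strict_mono_mono, THEN monoD, of "Suc kk" m']
    by (intro mult_left_mono powr_mono2') auto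
  also have "\<dots> \<le> \<eta> * W" using W_ge \<open>0 \<le> \<eta>\<close> by (rule mult_left_mono)
  also have "\<dots> \<le> \<eta> * (s powr \<beta> * W)"
    using s1 W_ge w_pos[of kk] \<open>0 \<le> \<eta>\<close> by (intro mult_left_mono) (auto simp: mult_le_cancel_right1)
  finally have "R + S \<le> (1 + \<eta>) * (s powr \<beta> * W)" using \<open>S \<le> s powr \<beta> * W\<close> by (simp add: algebra_simps)
  then have "(R + S) / V j0 \<le> (1 + \<eta>) * (s powr \<beta> * W) / w kk"
    using R0 \<open>W \<le> S\<close> W_ge w_pos[of kk] V0_ge by (intro frac_le) auto
  then show "(\<Sum>j. V (Suc j)) / V j0 \<le> (1 + \<eta>) * s powr \<beta> * binned_ratio w m c"
    unfolding total F by (simp add: mult_ac)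
qed

section \<open>Vectors of cell counts and their Poisson law\<close>

text \<open>Entries from \<open>m\<close> on are set to 0, the default value in
  \<open>poisson_bin_law\<close>, so that both laws live on the same countable set of
  functions.\<close>

definition bin_counts :: "(nat \<Rightarrow> real) \<Rightarrow> nat \<Rightarrow> (nat \<Rightarrow> 'a \<Rightarrow> real) \<Rightarrow> 'a \<Rightarrow> nat \<Rightarrow> nat" where
  "bin_counts t m U \<omega> = (\<lambda>k. if k < m then arrival_count U (t k) (t (Suc k)) \<omega> else 0)"

definition poisson_bin_law :: "(nat \<Rightarrow> real) \<Rightarrow> nat \<Rightarrow> (nat \<Rightarrow> nat) pmf" where
  "poisson_bin_law t m = Pi_pmf {..<m} 0 (\<lambda>k. poisson_pmf (t (Suc k) - t k))"

lemma measurable_arrival_count: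
  assumes [measurable]: "\<And>j. 1 \<le> j \<Longrightarrow> U j \<in> borel_measurable M"
  shows "arrival_count U x y \<in> measurable M (count_space UNIV)"
  unfolding arrival_count_def
proof (rule measurable_card)
  fix j
  show "{\<omega>\<in>space M. j \<in> {j \<in> {1..}. x < U j \<omega> \<and> U j \<omega> \<le> y}} \<in> sets M"
  proof (cases "1 \<le> j")
    case True
    then have [measurable]: "U j \<in> borel_measurable M" by (rule assms)
    have "{\<omega>\<in>space M. x < U j \<omega> \<and> U j \<omega> \<le> y} \<in> sets M" by measurable
    then show ?thesis using True by simp
  qed simp
qed

lemma bin_counts_vimage:
  "bin_counts t m U -` {c} = (if \<forall>k\<ge>m. c k = 0 then {\<omega>. \<forall>k<m. arrival_count U (t k) (t (Suc k)) \<omega> = c k} else {})"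
proof (cases "\<forall>k\<ge>m. c k = 0")
  case True
  then show ?thesis by (auto simp: bin_counts_def fun_eq_iff not_less)
next
  case False
  then obtain k where "m \<le> k" "c k \<noteq> 0" by blast
  then have "bin_counts t m U \<omega> \<noteq> c" for \<omega> by (auto simp: bin_counts_def fun_eq_iff not_less intro!: exI[of _ k])
  then show ?thesis using False by auto
qed

text \<open>The type of the values is uncountable, so preimages of singletons do not settle
  measurability into \<open>count_space UNIV\<close> by themselves. All values vanish from m on, and
  such functions form a countable set because finite lists parametrise them.\<close>

lemma measurable_bin_counts:
  assumes "\<And>j. 1 \<le> j \<Longrightarrow> U j \<in> borel_measurable M"
  shows "bin_counts t m U \<in> measurable M (count_space UNIV)"
proof -
  have [measurable]: "arrival_count U x y \<in> measurable M (count_space UNIV)" for x y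
    using assms by (rule measurable_arrival_count)
  define C where "C = {c :: nat \<Rightarrow> nat. \<forall>k\<ge>m. c k = 0}"
  have "C \<subseteq> (\<lambda>l k. if k < length l then l ! k else 0) ` (UNIV :: nat list set)"
  proof
    fix c assume "c \<in> C"
    then have "c = (\<lambda>k. if k < length (map c [0..<m]) then map c [0..<m] ! k else 0)"
      by (auto simp: C_def fun_eq_iff)
    then show "c \<in> (\<lambda>l k. if k < length l then l ! k else 0) ` (UNIV :: nat list set)" by blast
  qed
  then have C: "countable C" by (rule countable_subset) simp
  have sing: "bin_counts t m U -` {c} \<inter> space M \<in> sets M" for c
  proof -
    have "{\<omega>\<in>space M. \<forall>k<m. arrival_count U (t k) (t (Suc k)) \<omega> = c k} \<in> sets M" by measurable
    then show ?thesis by (simp add: bin_counts_vimage Int_def conj_commute)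
  qed
  have "bin_counts t m U \<in> measurable M (count_space C)"
    unfolding measurable_count_space_eq_countable[OF C] using sing by (auto simp: C_def bin_counts_def)
  then show ?thesis by (rule measurable_compose) simp
qed

text \<open>The value \<open>U n j = 0\<close> encodes a point at infinity: it lies in no bin \<open>(t k, t (k + 1)]\<close>, and
  \<open>0 powr - \<beta> = 0\<close>.\<close>

locale asymptotically_poisson = prob_space M for M :: "'a measure" +
  fixes U :: "nat \<Rightarrow> nat \<Rightarrow> 'a \<Rightarrow> real" and \<beta> K :: real
  assumes \<beta>: "1 < \<beta>"
    and measurable_U: "\<And>n j. 1 \<le> j \<Longrightarrow> U n j \<in> borel_measurable M"
    and U_nonneg: "\<And>n. AE \<omega> in M. \<forall>j\<ge>1. 0 \<le> U n j \<omega>"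
    and U_summable: "\<And>n. AE \<omega> in M. summable (\<lambda>j. U n (Suc j) \<omega> powr - \<beta>)"
    and bin_counts_tendsto: "\<And>t m B. strict_mono t \<Longrightarrow> t 0 = 0 \<Longrightarrow>
       (\<lambda>n. prob (bin_counts t m (U n) -` B \<inter> space M)) \<longlonglongrightarrow> measure_pmf.prob (poisson_bin_law t m) B"
    and tail_sum_bound: "\<And>T. 0 < T \<Longrightarrow> \<forall>\<^sub>F n in sequentially.
       (\<integral>\<^sup>+\<omega>. (\<Sum>j. ennreal (U n (Suc j) \<omega> powr - \<beta> * indicator {T<..} (U n (Suc j) \<omega>))) \<partial>M)
         \<le> ennreal (K * T powr (1 - \<beta>))"

text \<open>The two ways in which the discretisation can fail: a point next to 0, where rounding is
  uncontrolled, or no point in the first \<open>m'\<close> cells, hence no lower bound for the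
  maximum. Under the Poisson law their probabilities are \<open>1 - exp (- t 1)\<close> and
  \<open>exp (- t m')\<close>.\<close>

lemma prob_poisson_bin_law_bad:
  assumes t: "strict_mono t" "t 0 = 0" and "1 \<le> m'" "m' \<le> m"
  shows "measure_pmf.prob (poisson_bin_law t m) {c. c 0 \<noteq> 0 \<or> (\<forall>k<m'. c k = 0)} \<le> t 1 + exp (- t m')"
proof -
  let ?Q = "poisson_bin_law t m" and ?p = "\<lambda>k. poisson_pmf (t (Suc k) - t k)"
  have inc: "0 < t (Suc k) - t k" for k using strict_monoD[OF t(1), of k "Suc k"] by simp
  have "measure_pmf.prob ?Q {c. c 0 \<noteq> 0} = measure_pmf.prob (map_pmf (\<lambda>c. c 0) ?Q) {0<..}"
    by (auto simp: intro!: arg_cong[where f = "measure_pmf.prob ?Q"])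
  also have "map_pmf (\<lambda>c. c 0) ?Q = ?p 0"
    unfolding poisson_bin_law_def using assms by (subst Pi_pmf_component) auto
  also have "measure_pmf.prob (?p 0) {0<..} = 1 - measure_pmf.prob (?p 0) {0}"
  proof -
    have "{0<..} = UNIV - {0::nat}" by auto
    then show ?thesis using measure_pmf.prob_compl[of "{0}" "?p 0"] by simp
  qed
  also have "\<dots> = 1 - exp (- t 1)" using inc[of 0] t(2) by (simp add: measure_pmf_single less_imp_le)
  also have "\<dots> \<le> t 1" using exp_ge_add_one_self[of "- t 1"] by simp
  finally have 1: "measure_pmf.prob ?Q {c. c 0 \<noteq> 0} \<le> t 1" .
  have "measure_pmf.prob ?Q {c. \<forall>k<m'. c k = 0} = measure_pmf.prob ?Q (PiE_dflt {..<m} 0 (\<lambda>k. if k < m' then {0} else UNIV))"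
  proof (rule measure_pmf.finite_measure_eq_AE)
    show "AE c in ?Q. (c \<in> {c. \<forall>k<m'. c k = 0}) = (c \<in> PiE_dflt {..<m} 0 (\<lambda>k. if k < m' then {0} else UNIV))"
    proof (rule AE_pmfI)
      fix c assume "c \<in> set_pmf ?Q"
      then have "\<forall>k. k \<notin> {..<m} \<longrightarrow> c k = 0" unfolding poisson_bin_law_def using set_Pi_pmf_subset by fastforce
      then show "(c \<in> {c. \<forall>k<m'. c k = 0}) = (c \<in> PiE_dflt {..<m} 0 (\<lambda>k. if k < m' then {0} else UNIV))"
        using assms(4) by (auto simp: PiE_dflt_def)
    qed
  qed auto
  also have "\<dots> = (\<Prod>k<m. measure_pmf.prob (?p k) (if k < m' then {0} else UNIV))"
    unfolding poisson_bin_law_def by (rule measure_Pi_pmf_PiE_dflt) simp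
  also have "\<dots> = (\<Prod>k<m'. measure_pmf.prob (?p k) {0})"
    using assms(4) by (intro prod.mono_neutral_cong_right) auto
  also have "\<dots> = (\<Prod>k<m'. exp (- (t (Suc k) - t k)))"
    using inc by (intro prod.cong) (auto simp: measure_pmf_single less_imp_le)
  also have "\<dots> = exp (\<Sum>k<m'. - (t (Suc k) - t k))" by (rule exp_sum[symmetric]) simp
  also have "(\<Sum>k<m'. - (t (Suc k) - t k)) = - t m'"
    using t(2) by (simp only: sum_negf sum_lessThan_telescope)
  finally have 2: "measure_pmf.prob ?Q {c. \<forall>k<m'. c k = 0} = exp (- t m')" .
  have un: "{c. c 0 \<noteq> 0 \<or> (\<forall>k<m'. c k = 0)} = {c. c 0 \<noteq> 0} \<union> {c. \<forall>k<m'. c k = 0}" by auto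
  have "measure_pmf.prob ?Q ({c. c 0 \<noteq> 0} \<union> {c. \<forall>k<m'. c k = 0}) \<le>
      measure_pmf.prob ?Q {c. c 0 \<noteq> 0} + measure_pmf.prob ?Q {c. \<forall>k<m'. c k = 0}"
    by (rule measure_Un_le) auto
  then show ?thesis unfolding un 2 using 1 by linarith
qed

text \<open>A relation instead of a function: when the largest weight is 0 it leaves
  \<open>z\<close> free, matching the arbitrary value of the ratio in that case. It covers the
  finite sample, continued by weights 0, and the infinite sequence of arrivals alike.\<close>

definition is_sum_max_ratio :: "real \<Rightarrow> (nat \<Rightarrow> real) \<Rightarrow> real \<Rightarrow> bool" where
  "is_sum_max_ratio \<beta> u z \<longleftrightarrow> (\<exists>j\<ge>1. (\<forall>i\<ge>1. u i powr - \<beta> \<le> u j powr - \<beta>) \<and>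
     (0 < u j powr - \<beta> \<longrightarrow> z = (\<Sum>i. u (Suc i) powr - \<beta>) / u j powr - \<beta>))"

context asymptotically_poisson
begin

lemma measurable_bin_counts_U: "bin_counts t m (U n) \<in> measurable M (count_space UNIV)"
  using measurable_U by (rule measurable_bin_counts)

text \<open>Two exceptional events are removed: bad counts, and a contribution beyond
  \<open>t m\<close> of at least \<open>\<eta> * t m' powr - \<beta>\<close>. The limit law of the
  counts handles the former; Markov's inequality and the choice of m bound the latter by \<epsilon>.
  On what remains the deterministic bounds apply.\<close>

lemma ratio_approximation:
  fixes Z :: "nat \<Rightarrow> 'a \<Rightarrow> real"
  assumes Z: "\<And>n. Z n \<in> borel_measurable M"
    and ratio: "\<And>n. 1 \<le> n \<Longrightarrow> AE \<omega> in M. is_sum_max_ratio \<beta> (\<lambda>j. U n j \<omega>) (Z n \<omega>)"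
    and par: "0 < \<epsilon>" "0 < \<delta>" "\<delta> \<le> \<epsilon>" "1 < s" "0 < \<eta>" "1 \<le> m'" "m' \<le> m"
    and t: "t = geometric_grid \<delta> s"
    and m': "exp (- t m') \<le> \<epsilon>" and m: "K * t m powr (1 - \<beta>) \<le> \<epsilon> * (\<eta> * t m' powr - \<beta>)"
    and w: "w = (\<lambda>k. t (Suc k) powr - \<beta>)"
    and \<rho>: "s powr \<beta> \<le> \<rho>" "(1 + \<eta>) * s powr \<beta> = \<rho>"
  shows "\<forall>\<^sub>F n in sequentially. prob {\<omega>\<in>space M.
     \<not> (binned_ratio w m (bin_counts t m (U n) \<omega>) \<le> \<rho> * Z n \<omega> \<and>
        Z n \<omega> \<le> \<rho> * binned_ratio w m (bin_counts t m (U n) \<omega>))} \<le> 4 * \<epsilon>"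
proof -
  have sm: "strict_mono t" and t0: "t 0 = 0" and t1: "t 1 = \<delta>"
    using par strict_mono_geometric_grid[of \<delta> s] by (auto simp: t)
  have t_pos: "0 < t k" if "1 \<le> k" for k using strict_monoD[OF sm, of 0 k] that t0 by simp
  define Bad where "Bad = {c :: nat \<Rightarrow> nat. c 0 \<noteq> 0 \<or> (\<forall>k<m'. c k = 0)}"
  define h where "h = \<eta> * t m' powr - \<beta>"
  have h: "0 < h" using par t_pos[of m'] by (simp add: h_def)
  \<comment> \<open>The limit is at most \<open>\<delta> + \<epsilon> \<le> 2 * \<epsilon>\<close>;
    the larger bound leaves room to pass to large n.\<close>
  have "measure_pmf.prob (poisson_bin_law t m) Bad < 3 * \<epsilon>"
    using prob_poisson_bin_law_bad[OF sm t0, of m' m] par m' t1 by (simp add: Bad_def)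
  from order_tendstoD(2)[OF bin_counts_tendsto[OF sm t0] this]
  have "\<forall>\<^sub>F n in sequentially. prob (bin_counts t m (U n) -` Bad \<inter> space M) < 3 * \<epsilon>" .
  moreover have "0 < t m" using t_pos par by simp
  note tail_sum_bound[OF this]
  moreover note eventually_ge_at_top[of "1::nat"]
  ultimately show ?thesis
  proof eventually_elim
    case (elim n)
    note [measurable] = measurable_U[of _ n] Z[of n]
    have [measurable]: "(\<lambda>\<omega>. binned_ratio w m (bin_counts t m (U n) \<omega>)) \<in> borel_measurable M"
      by (rule measurable_compose[OF measurable_bin_counts_U]) simp
    let ?r = "\<lambda>j \<omega>. U n (Suc j) \<omega> powr - \<beta> * indicator {t m<..} (U n (Suc j) \<omega>)"
    let ?R = "\<lambda>\<omega>. (\<Sum>j. ennreal (?r j \<omega>))"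
    define Big where "Big = {\<omega>\<in>space M. 1 \<le> ennreal (1 / h) * ?R \<omega>}"
    have Big_meas[measurable]: "Big \<in> events" unfolding Big_def by measurable
    have R_meas[measurable]: "?R \<in> borel_measurable M" by measurable
    have "emeasure M Big \<le> ennreal (1 / h) * (\<integral>\<^sup>+\<omega>. ?R \<omega> * indicator (space M) \<omega> \<partial>M)"
      unfolding Big_def by (rule nn_integral_Markov_inequality) measurable
    also have "(\<integral>\<^sup>+\<omega>. ?R \<omega> * indicator (space M) \<omega> \<partial>M) = (\<integral>\<^sup>+\<omega>. ?R \<omega> \<partial>M)"
      by (intro nn_integral_cong) simp
    also have "ennreal (1 / h) * (\<integral>\<^sup>+\<omega>. ?R \<omega> \<partial>M) \<le> ennreal (1 / h) * ennreal (\<epsilon> * h)"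
    proof (rule mult_left_mono)
      have "(\<integral>\<^sup>+\<omega>. ?R \<omega> \<partial>M) \<le> ennreal (K * t m powr (1 - \<beta>))" using elim(2) .
      also have "\<dots> \<le> ennreal (\<epsilon> * h)" using m by (intro ennreal_leI) (simp add: h_def)
      finally show "(\<integral>\<^sup>+\<omega>. ?R \<omega> \<partial>M) \<le> ennreal (\<epsilon> * h)" .
    qed simp
    also have "\<dots> = ennreal (1 / h * (\<epsilon> * h))"
      using h par by (intro ennreal_mult[symmetric]) auto
    finally have PBig: "prob Big \<le> \<epsilon>" using par h by (simp add: emeasure_eq_measure)
    let ?E = "{\<omega>\<in>space M. \<not> (binned_ratio w m (bin_counts t m (U n) \<omega>) \<le> \<rho> * Z n \<omega> \<and>
        Z n \<omega> \<le> \<rho> * binned_ratio w m (bin_counts t m (U n) \<omega>))}"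
    let ?C = "bin_counts t m (U n) -` Bad \<inter> space M"
    have C[measurable]: "?C \<in> events" by (rule measurable_sets[OF measurable_bin_counts_U]) simp
    have "prob ?E \<le> prob (?C \<union> Big)"
    proof (rule finite_measure_mono_AE)
      show "AE \<omega> in M. \<omega> \<in> ?E \<longrightarrow> \<omega> \<in> ?C \<union> Big"
        using U_nonneg[of n] U_summable[of n] ratio[OF elim(3)]
      proof eventually_elim
        case (elim \<omega>)
        show ?case
        proof (intro impI, rule ccontr)
          assume E: "\<omega> \<in> ?E" and "\<omega> \<notin> ?C \<union> Big"
          then have nC: "bin_counts t m (U n) \<omega> \<notin> Bad" and nB: "\<not> 1 \<le> ennreal (1 / h) * ?R \<omega>"
            by (auto simp: Big_def)
          obtain k0 where k0: "k0 < m'" "0 < arrival_count (U n) (t k0) (t (Suc k0)) \<omega>"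
            using nC par by (auto simp: Bad_def bin_counts_def split: if_splits)
          have N0: "arrival_count (U n) (t 0) (t (Suc 0)) \<omega> = 0"
            using nC par by (auto simp: Bad_def bin_counts_def split: if_splits)
          obtain j0 where j0: "1 \<le> j0" "\<And>i. 1 \<le> i \<Longrightarrow> U n i \<omega> powr - \<beta> \<le> U n j0 \<omega> powr - \<beta>"
            and Zeq: "0 < U n j0 \<omega> powr - \<beta> \<longrightarrow> Z n \<omega> = (\<Sum>i. U n (Suc i) \<omega> powr - \<beta>) / U n j0 \<omega> powr - \<beta>"
            using elim(3) by (auto simp: is_sum_max_ratio_def)
          have sr: "summable (\<lambda>j. ?r j \<omega>)"
            by (rule summable_comparison_test'[OF elim(2), of 0]) (auto simp: indicator_def)
          have R: "?R \<omega> = ennreal (\<Sum>j. ?r j \<omega>)" by (rule suminf_ennreal2[OF _ sr]) simp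
          have "(1 / h) * (\<Sum>j. ?r j \<omega>) < 1"
          proof (rule ccontr)
            assume "\<not> ?thesis"
            then have "ennreal 1 \<le> ennreal ((1 / h) * (\<Sum>j. ?r j \<omega>))" by (intro ennreal_leI) simp
            also have "\<dots> = ennreal (1 / h) * ?R \<omega>"
              unfolding R using h by (intro ennreal_mult suminf_nonneg[OF sr]) auto
            finally show False using nB by simp
          qed
          then have rest: "(\<Sum>j. ?r j \<omega>) \<le> \<eta> * t m' powr - \<beta>" using h by (simp add: field_simps flip: h_def)
          have "binned_ratio w m (bin_counts t m (U n) \<omega>) \<le> \<rho> * Z n \<omega> \<and>
             Z n \<omega> \<le> \<rho> * binned_ratio w m (bin_counts t m (U n) \<omega>)"
          proof -
            have "0 < \<beta>" "0 \<le> \<eta>" using \<beta> par by auto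
            have nn: "\<And>j. 1 \<le> j \<Longrightarrow> 0 \<le> U n j \<omega>" using elim(1) by blast
            have c: "bin_counts t m (U n) \<omega> k = (if k < m then card {j\<in>{1..}. t k < U n j \<omega> \<and> U n j \<omega> \<le> t (Suc k)} else 0)" for k
              by (simp add: bin_counts_def arrival_count_def)
            note b = sum_max_ratio_binned_bounds[where u = "\<lambda>j. U n j \<omega>" and c = "bin_counts t m (U n) \<omega>"
                and \<delta> = \<delta> and s = s and \<beta> = \<beta>,
                folded t, folded w, OF \<open>0 < \<beta>\<close> par(2,4) nn elim(2) N0[unfolded arrival_count_def]
                k0[unfolded arrival_count_def] par(7) j0 c rest \<open>0 \<le> \<eta>\<close>]
            have z: "Z n \<omega> = (\<Sum>i. U n (Suc i) \<omega> powr - \<beta>) / U n j0 \<omega> powr - \<beta>"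
              using Zeq b(1) by blast
            have "0 < s powr \<beta>" using par by simp
            then have "binned_ratio w m (bin_counts t m (U n) \<omega>) \<le> s powr \<beta> * Z n \<omega>"
              using b(2) by (simp only: z pos_divide_le_eq mult.commute)
            moreover have "0 \<le> Z n \<omega>" unfolding z by (intro divide_nonneg_nonneg suminf_nonneg elim(2)) auto
            ultimately have "binned_ratio w m (bin_counts t m (U n) \<omega>) \<le> \<rho> * Z n \<omega>"
              using mult_right_mono[OF \<rho>(1), of "Z n \<omega>"] by linarith
            then show ?thesis using b(3) unfolding z \<rho>(2) by simp
          qed
          then show False using E by simp
        qed
      qed
      show "?C \<union> Big \<in> events" by measurable
    qed
    also have "\<dots> \<le> prob ?C + prob Big" by (rule measure_Un_le) measurable
    also have "\<dots> \<le> 4 * \<epsilon>" using elim PBig by simp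
    finally show ?case .
  qed
qed

end

section \<open>Choice of the grid and comparison of distribution functions\<close>

text \<open>The admissible factor \<rho> is shared evenly: \<open>s powr \<beta>\<close> and
  \<open>1 + \<eta>\<close> both equal \<open>sqrt \<rho>\<close>. Then \<open>m'\<close> is chosen
  so that a point below \<open>t m'\<close> is likely, and only afterwards m, so far out that the
  tail bound is small against the weight at \<open>t m'\<close>; this is possible because
  \<open>1 - \<beta>\<close> is negative.\<close>

lemma grid_parameters:
  fixes \<beta> \<epsilon> \<rho> K :: real
  assumes "1 < \<beta>" "0 < \<epsilon>" "1 < \<rho>"
  obtains s \<eta> m m' where "1 < s" "0 < \<eta>" "1 \<le> m'" "m' \<le> m"
    "exp (- geometric_grid \<epsilon> s m') \<le> \<epsilon>"
    "K * geometric_grid \<epsilon> s m powr (1 - \<beta>) \<le> \<epsilon> * (\<eta> * geometric_grid \<epsilon> s m' powr - \<beta>)"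
    "s powr \<beta> \<le> \<rho>" "(1 + \<eta>) * s powr \<beta> = \<rho>"
proof -
  define s where "s = \<rho> powr (1 / (2 * \<beta>))"
  define \<eta> where "\<eta> = sqrt \<rho> - 1"
  have s: "1 < s" using assms by (simp add: s_def)
  have sb: "s powr \<beta> = sqrt \<rho>" using assms by (simp add: s_def powr_powr powr_half_sqrt)
  have \<eta>: "0 < \<eta>" using assms by (simp add: \<eta>_def)
  have grid: "filterlim (\<lambda>k. \<epsilon> * s ^ k) at_top sequentially"
  proof (rule filterlim_tendsto_pos_mult_at_top[OF tendsto_const \<open>0 < \<epsilon>\<close>])
    show "filterlim ((^) s) at_top sequentially"
      unfolding filterlim_at_top
    proof
      fix z :: real
      obtain n where "z < s ^ n" using real_arch_pow[OF s] by blast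
      then have "z \<le> s ^ k" if "n \<le> k" for k
        using \<open>z < s ^ n\<close> power_increasing[OF that, of s] s by linarith
      then show "\<forall>\<^sub>F k in sequentially. z \<le> s ^ k" unfolding eventually_sequentially by blast
    qed
  qed
  obtain i where i: "- ln \<epsilon> \<le> \<epsilon> * s ^ i"
    using grid unfolding filterlim_at_top eventually_sequentially by blast
  define m' where "m' = Suc i"
  have "exp (- geometric_grid \<epsilon> s m') \<le> exp (ln \<epsilon>)" using i by (simp add: m'_def)
  then have e: "exp (- geometric_grid \<epsilon> s m') \<le> \<epsilon>" using assms by simp
  have "((\<lambda>k. K * (\<epsilon> * s ^ k) powr (1 - \<beta>)) \<longlongrightarrow> K * 0) sequentially"
    by (intro tendsto_mult tendsto_const tendsto_neg_powr grid) (use assms in auto)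
  then have "\<forall>\<^sub>F k in sequentially. K * (\<epsilon> * s ^ k) powr (1 - \<beta>) < \<epsilon> * (\<eta> * geometric_grid \<epsilon> s m' powr - \<beta>)"
    using \<eta> assms s by (intro order_tendstoD) (auto simp: m'_def)
  moreover note eventually_ge_at_top[of i]
  ultimately have "\<forall>\<^sub>F k in sequentially. K * (\<epsilon> * s ^ k) powr (1 - \<beta>) < \<epsilon> * (\<eta> * geometric_grid \<epsilon> s m' powr - \<beta>) \<and> i \<le> k"
    by eventually_elim simp
  then obtain k where k: "K * (\<epsilon> * s ^ k) powr (1 - \<beta>) < \<epsilon> * (\<eta> * geometric_grid \<epsilon> s m' powr - \<beta>)" "i \<le> k"
    by (auto simp: eventually_sequentially)
  show thesis
  proof (rule that[of s \<eta> m' "Suc k"])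
    have "1 \<le> sqrt \<rho>" using assms by simp
    then have "sqrt \<rho> \<le> sqrt \<rho> * sqrt \<rho>" using mult_left_mono[of 1 "sqrt \<rho>" "sqrt \<rho>"] by simp
    then show "s powr \<beta> \<le> \<rho>" using assms sb by simp
    show "(1 + \<eta>) * s powr \<beta> = \<rho>" using assms sb by (simp add: \<eta>_def)
  qed (use s \<eta> e k in \<open>auto simp: m'_def\<close>)
qed

lemma (in prob_space) prob_le_of_comparable:
  fixes X Y :: "'a \<Rightarrow> real"
  assumes X[measurable]: "X \<in> borel_measurable M" and Y[measurable]: "Y \<in> borel_measurable M" and "0 \<le> \<rho>"
    and bad: "prob {\<omega>\<in>space M. \<not> (X \<omega> \<le> \<rho> * Y \<omega> \<and> Y \<omega> \<le> \<rho> * X \<omega>)} \<le> e"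
  shows "prob {\<omega>\<in>space M. Y \<omega> \<le> x} \<le> prob {\<omega>\<in>space M. X \<omega> \<le> \<rho> * x} + e"
    and "prob {\<omega>\<in>space M. X \<omega> \<le> x} \<le> prob {\<omega>\<in>space M. Y \<omega> \<le> \<rho> * x} + e"
proof -
  let ?B = "{\<omega>\<in>space M. \<not> (X \<omega> \<le> \<rho> * Y \<omega> \<and> Y \<omega> \<le> \<rho> * X \<omega>)}"
  have B: "?B \<in> events" by measurable
  have *: "prob {\<omega>\<in>space M. V \<omega> \<le> x} \<le> prob {\<omega>\<in>space M. W \<omega> \<le> \<rho> * x} + e"
    if V[measurable]: "V \<in> borel_measurable M" and W[measurable]: "W \<in> borel_measurable M"
      and VW: "\<And>\<omega>. \<omega> \<in> space M - ?B \<Longrightarrow> W \<omega> \<le> \<rho> * V \<omega>" for V W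
  proof -
    have ev: "{\<omega>\<in>space M. W \<omega> \<le> \<rho> * x} \<in> events" by measurable
    have "W \<omega> \<le> \<rho> * x" if "\<omega> \<in> space M - ?B" "V \<omega> \<le> x" for \<omega>
      using VW[OF that(1)] mult_left_mono[OF that(2) \<open>0 \<le> \<rho>\<close>] by linarith
    then have "prob {\<omega>\<in>space M. V \<omega> \<le> x} \<le> prob ({\<omega>\<in>space M. W \<omega> \<le> \<rho> * x} \<union> ?B)"
      by (intro finite_measure_mono sets.Un[OF ev B]) blast
    also have "\<dots> \<le> prob {\<omega>\<in>space M. W \<omega> \<le> \<rho> * x} + prob ?B" by (rule measure_Un_le[OF ev B])
    finally show ?thesis using bad by linarith
  qed
  show "prob {\<omega>\<in>space M. Y \<omega> \<le> x} \<le> prob {\<omega>\<in>space M. X \<omega> \<le> \<rho> * x} + e" by (rule *[OF Y X]) blast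
  show "prob {\<omega>\<in>space M. X \<omega> \<le> x} \<le> prob {\<omega>\<in>space M. Y \<omega> \<le> \<rho> * x} + e" by (rule *[OF X Y]) blast
qed

text \<open>With high probability each ratio is within a factor \<rho> of the same function F of its
  own counts. Passing from one ratio to the other uses two such factors, hence
  \<open>\<rho>\<^sup>2\<close>. On the Poisson side the sequence of point families is constant, so
  its counts have exactly the limit law.\<close>

lemma cdf_convergence_of_asymptotically_poisson:
  fixes M :: "'a measure" and P :: "'b measure"
  assumes MU: "asymptotically_poisson M U \<beta> K" and PU: "asymptotically_poisson P (\<lambda>_. \<Gamma>) \<beta> K"
    and Z: "\<And>n. Z n \<in> borel_measurable M"
      "\<And>n. 1 \<le> n \<Longrightarrow> AE \<omega> in M. is_sum_max_ratio \<beta> (\<lambda>j. U n j \<omega>) (Z n \<omega>)"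
    and W: "W \<in> borel_measurable P" "AE \<omega> in P. is_sum_max_ratio \<beta> (\<lambda>j. \<Gamma> j \<omega>) (W \<omega>)"
    and cont: "isCont (\<lambda>x. measure P {\<omega>\<in>space P. W \<omega> \<le> x}) x"
  shows "(\<lambda>n. measure M {\<omega>\<in>space M. Z n \<omega> \<le> x}) \<longlonglongrightarrow> measure P {\<omega>\<in>space P. W \<omega> \<le> x}"
proof -
  interpret M: asymptotically_poisson M U \<beta> K by fact
  interpret P: asymptotically_poisson P "\<lambda>_. \<Gamma>" \<beta> K by fact
  define G where "G y = measure P {\<omega>\<in>space P. W \<omega> \<le> y}" for y
  \<comment> \<open>The loss is \<open>4 * \<epsilon>\<close> for each of the two comparisons and
    \<epsilon> for the convergence of the counts, rounded up.\<close>
  have sandwich: "\<forall>\<^sub>F n in sequentially. G (x / \<rho>\<^sup>2) - 10 * \<epsilon> \<le> measure M {\<omega>\<in>space M. Z n \<omega> \<le> x} \<and>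
      measure M {\<omega>\<in>space M. Z n \<omega> \<le> x} \<le> G (\<rho>\<^sup>2 * x) + 10 * \<epsilon>"
    if \<epsilon>: "0 < \<epsilon>" and \<rho>: "1 < \<rho>" for \<epsilon> \<rho>
  proof -
    obtain s \<eta> m m' where par: "1 < s" "0 < \<eta>" "1 \<le> m'" "m' \<le> m"
      "exp (- geometric_grid \<epsilon> s m') \<le> \<epsilon>"
      "K * geometric_grid \<epsilon> s m powr (1 - \<beta>) \<le> \<epsilon> * (\<eta> * geometric_grid \<epsilon> s m' powr - \<beta>)"
      "s powr \<beta> \<le> \<rho>" "(1 + \<eta>) * s powr \<beta> = \<rho>"
      using grid_parameters[OF M.\<beta> \<epsilon> \<rho>] .
    define t where "t = geometric_grid \<epsilon> s"
    define w where "w = (\<lambda>k. t (Suc k) powr - \<beta>)"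
    define F where "F c = binned_ratio w m c" for c
    define Q where "Q = poisson_bin_law t m"
    have sm: "strict_mono t" "t 0 = 0" using strict_mono_geometric_grid[OF \<epsilon> par(1)] by (auto simp: t_def)
    have evM: "\<forall>\<^sub>F n in sequentially. M.prob {\<omega>\<in>space M.
         \<not> (F (bin_counts t m (U n) \<omega>) \<le> \<rho> * Z n \<omega> \<and> Z n \<omega> \<le> \<rho> * F (bin_counts t m (U n) \<omega>))} \<le> 4 * \<epsilon>"
      unfolding F_def
      by (rule M.ratio_approximation[OF Z(1) _ \<epsilon> \<epsilon> order_refl par(1-4) t_def par(5,6)[folded t_def] w_def par(7,8)])
         (rule Z(2))
    have evP: "P.prob {\<omega>\<in>space P.
         \<not> (F (bin_counts t m \<Gamma> \<omega>) \<le> \<rho> * W \<omega> \<and> W \<omega> \<le> \<rho> * F (bin_counts t m \<Gamma> \<omega>))} \<le> 4 * \<epsilon>"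
      using eventually_happens'[OF sequentially_bot
          P.ratio_approximation[OF W \<epsilon> \<epsilon> order_refl par(1-4) t_def par(5,6)[folded t_def] w_def par(7,8)]]
      unfolding F_def by simp
    have QP: "P.prob {\<omega>\<in>space P. bin_counts t m \<Gamma> \<omega> \<in> B} = measure_pmf.prob Q B" for B
    proof -
      have "(\<lambda>n::nat. P.prob (bin_counts t m \<Gamma> -` B \<inter> space P)) \<longlonglongrightarrow> measure_pmf.prob Q B"
        unfolding Q_def by (rule P.bin_counts_tendsto[OF sm])
      moreover have "bin_counts t m \<Gamma> -` B \<inter> space P = {\<omega>\<in>space P. bin_counts t m \<Gamma> \<omega> \<in> B}" by auto
      ultimately show ?thesis by (simp add: LIMSEQ_const_iff)
    qed
    have QM: "\<forall>\<^sub>F n in sequentially. \<bar>M.prob {\<omega>\<in>space M. bin_counts t m (U n) \<omega> \<in> B} - measure_pmf.prob Q B\<bar> < \<epsilon>" for B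
    proof -
      have "(\<lambda>n. M.prob (bin_counts t m (U n) -` B \<inter> space M)) \<longlonglongrightarrow> measure_pmf.prob Q B"
        unfolding Q_def by (rule M.bin_counts_tendsto[OF sm])
      moreover have "bin_counts t m (U n) -` B \<inter> space M = {\<omega>\<in>space M. bin_counts t m (U n) \<omega> \<in> B}" for n by auto
      ultimately show ?thesis using \<epsilon> by (simp add: tendsto_iff dist_real_def)
    qed
    have F_meas: "(\<lambda>\<omega>. F (bin_counts t m (U n) \<omega>)) \<in> borel_measurable M"
      "(\<lambda>\<omega>. F (bin_counts t m \<Gamma> \<omega>)) \<in> borel_measurable P" for n
      by (rule measurable_compose[OF M.measurable_bin_counts_U] measurable_compose[OF P.measurable_bin_counts_U], simp)+
    have \<rho>_eq: "\<rho> * (x / \<rho>\<^sup>2) = x / \<rho>" "\<rho> * (\<rho> * x) = \<rho>\<^sup>2 * x" "\<rho> * (x / \<rho>) = x" and "0 \<le> \<rho>"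
      using \<rho> by (auto simp: power2_eq_square)
    have QF: "P.prob {\<omega>\<in>space P. F (bin_counts t m \<Gamma> \<omega>) \<le> y} = measure_pmf.prob Q {c. F c \<le> y}" for y
      using QP[of "{c. F c \<le> y}"] by simp
    have G_up: "measure_pmf.prob Q {c. F c \<le> \<rho> * x} \<le> G (\<rho>\<^sup>2 * x) + 4 * \<epsilon>"
      using P.prob_le_of_comparable(2)[OF F_meas(2) W(1) \<open>0 \<le> \<rho>\<close> evP, of "\<rho> * x"] by (simp only: QF G_def \<rho>_eq)
    have G_low: "G (x / \<rho>\<^sup>2) \<le> measure_pmf.prob Q {c. F c \<le> x / \<rho>} + 4 * \<epsilon>"
      using P.prob_le_of_comparable(1)[OF F_meas(2) W(1) \<open>0 \<le> \<rho>\<close> evP, of "x / \<rho>\<^sup>2"] by (simp only: QF G_def \<rho>_eq)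
    show ?thesis using evM QM[of "{c. F c \<le> \<rho> * x}"] QM[of "{c. F c \<le> x / \<rho>}"]
    proof eventually_elim
      case (elim n)
      note * = M.prob_le_of_comparable[OF F_meas(1) Z(1) \<open>0 \<le> \<rho>\<close> elim(1)]
      show ?case
        using *(1)[of x] *(2)[of "x / \<rho>"] elim(2,3) G_up G_low \<epsilon>
        by (simp only: abs_less_iff \<rho>_eq mem_Collect_eq) linarith
    qed
  qed
  \<comment> \<open>Continuity at x enters here: both arguments tend to x as \<rho> decreases to
    1.\<close>
  have c1: "((\<lambda>\<rho>. G (\<rho>\<^sup>2 * x)) \<longlongrightarrow> G (1\<^sup>2 * x)) (at_right 1)"
    by (rule isCont_tendsto_compose) (use cont in \<open>auto simp: G_def[abs_def] intro!: tendsto_eq_intros\<close>)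
  have c2: "((\<lambda>\<rho>. G (x / \<rho>\<^sup>2)) \<longlongrightarrow> G (x / 1\<^sup>2)) (at_right 1)"
    by (rule isCont_tendsto_compose) (use cont in \<open>auto simp: G_def[abs_def] intro!: tendsto_eq_intros\<close>)
  have "(\<lambda>n. measure M {\<omega>\<in>space M. Z n \<omega> \<le> x}) \<longlonglongrightarrow> G x"
  proof (rule order_tendstoI)
    fix l assume l: "l < G x"
    have "\<forall>\<^sub>F \<rho> in at_right 1. (l + G x) / 2 < G (x / \<rho>\<^sup>2)" using l by (intro order_tendstoD(1)[OF c2]) simp
    moreover have "\<forall>\<^sub>F \<rho> in at_right 1. 1 < (\<rho>::real)" by (simp add: eventually_at_filter)
    ultimately have "\<forall>\<^sub>F \<rho> in at_right 1. (l + G x) / 2 < G (x / \<rho>\<^sup>2) \<and> 1 < \<rho>" by eventually_elim simp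
    from eventually_happens'[OF _ this] obtain \<rho> where \<rho>: "(l + G x) / 2 < G (x / \<rho>\<^sup>2)" "1 < \<rho>"
      by (auto simp: trivial_limit_at_right_real)
    \<comment> \<open>The choice of \<rho> gives up at most half of the gap between l and
      \<open>G x\<close>; with \<epsilon> a fortieth of the gap, the loss
      \<open>10 * \<epsilon>\<close> is a further quarter.\<close>
    show "\<forall>\<^sub>F n in sequentially. l < measure M {\<omega>\<in>space M. Z n \<omega> \<le> x}"
      using sandwich[of "(G x - l) / 40", OF _ \<rho>(2)] l
      by (auto elim!: eventually_mono) (use \<rho>(1) in \<open>simp add: field_simps\<close>)
  next
    fix l assume l: "G x < l"
    have "\<forall>\<^sub>F \<rho> in at_right 1. G (\<rho>\<^sup>2 * x) < (l + G x) / 2" using l by (intro order_tendstoD(2)[OF c1]) simp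
    moreover have "\<forall>\<^sub>F \<rho> in at_right 1. 1 < (\<rho>::real)" by (simp add: eventually_at_filter)
    ultimately have "\<forall>\<^sub>F \<rho> in at_right 1. G (\<rho>\<^sup>2 * x) < (l + G x) / 2 \<and> 1 < \<rho>" by eventually_elim simp
    from eventually_happens'[OF _ this] obtain \<rho> where \<rho>: "G (\<rho>\<^sup>2 * x) < (l + G x) / 2" "1 < \<rho>"
      by (auto simp: trivial_limit_at_right_real)
    show "\<forall>\<^sub>F n in sequentially. measure M {\<omega>\<in>space M. Z n \<omega> \<le> x} < l"
      using sandwich[of "(l - G x) / 40", OF _ \<rho>(2)] l
      by (auto elim!: eventually_mono) (use \<rho>(1) in \<open>simp add: field_simps\<close>)
  qed
  then show ?thesis by (simp add: G_def)
qed

section \<open>Poisson arrivals and rescaled samples\<close>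

text \<open>Vectors with a nonzero entry from m on have probability 0 on both sides; for the others
  the hypothesis applies, and convergence at single vectors extends to all sets.\<close>

lemma (in prob_space) bin_counts_tendsto_of_fdd:
  assumes U: "\<And>n j. 1 \<le> j \<Longrightarrow> U n j \<in> borel_measurable M"
    and lim: "\<And>c. (\<lambda>n. prob {\<omega>\<in>space M. \<forall>k<m. arrival_count (U n) (t k) (t (Suc k)) \<omega> = c k})
      \<longlonglongrightarrow> (\<Prod>k<m. pmf (poisson_pmf (t (Suc k) - t k)) (c k))"
  shows "(\<lambda>n. prob (bin_counts t m (U n) -` B \<inter> space M)) \<longlonglongrightarrow> measure_pmf.prob (poisson_bin_law t m) B"
proof (rule prob_tendsto_of_pmf_tendsto)
  show "bin_counts t m (U n) \<in> measurable M (count_space UNIV)" for n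
    using U by (rule measurable_bin_counts)
  fix c :: "nat \<Rightarrow> nat"
  show "(\<lambda>n. prob (bin_counts t m (U n) -` {c} \<inter> space M)) \<longlonglongrightarrow> pmf (poisson_bin_law t m) c"
  proof (cases "\<forall>k\<ge>m. c k = 0")
    case True
    then have "pmf (poisson_bin_law t m) c = (\<Prod>k<m. pmf (poisson_pmf (t (Suc k) - t k)) (c k))"
      unfolding poisson_bin_law_def by (subst pmf_Pi) (auto simp: not_less)
    then show ?thesis using lim[of c] True by (simp add: bin_counts_vimage Int_def conj_commute)
  next
    case False
    then have "pmf (poisson_bin_law t m) c = 0"
      unfolding poisson_bin_law_def by (subst pmf_Pi) (auto simp: not_less)
    then show ?thesis unfolding bin_counts_vimage if_not_P[OF False] by simp
  qed
qed

lemma nn_integral_poisson_pmf: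
  assumes "0 < r"
  shows "(\<integral>\<^sup>+n. ennreal (real n) \<partial>measure_pmf (poisson_pmf r)) = ennreal r"
proof -
  have "(\<lambda>n. r * exp (- r) * (r ^ n / fact n)) sums (r * exp (- r) * exp r)"
    using exp_converges[of r] by (intro sums_mult) (simp add: divide_inverse mult.commute)
  moreover have "r * exp (- r) * (r ^ n / fact n) = pmf (poisson_pmf r) (Suc n) * real (Suc n)" for n
    using assms by (simp add: field_simps del: of_nat_Suc)
  moreover have "r * exp (- r) * exp r = r" by (simp add: mult.assoc flip: exp_add)
  ultimately have "(\<lambda>n. pmf (poisson_pmf r) (Suc n) * real (Suc n)) sums r" by (simp only:)
  then have *: "(\<lambda>n. pmf (poisson_pmf r) n * real n) sums r"
    using sums_Suc_iff[of "\<lambda>n. pmf (poisson_pmf r) n * real n" r] by simp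
  have "(\<integral>\<^sup>+n. ennreal (real n) \<partial>measure_pmf (poisson_pmf r)) = (\<Sum>n. ennreal (pmf (poisson_pmf r) n * real n))"
    by (simp add: nn_integral_measure_pmf nn_integral_count_space_nat ennreal_mult)
  also have "\<dots> = ennreal r"
    using * by (subst suminf_ennreal2) (auto simp: sums_iff)
  finally show ?thesis .
qed

lemma suminf_ennreal_swap:
  fixes f :: "nat \<Rightarrow> nat \<Rightarrow> ennreal"
  shows "(\<Sum>j. \<Sum>k. f j k) = (\<Sum>k. \<Sum>j. f j k)"
  using nn_integral_suminf[of "\<lambda>k j. f j k" "count_space UNIV"]
  by (simp add: nn_integral_count_space_nat)

text \<open>Finiteness is assumed because \<open>card\<close> of an infinite set is 0, whereas the
  series would be infinite.\<close>

lemma suminf_indicator_arrival_count: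
  assumes "finite {j\<in>{1..}. x < \<Gamma> j \<omega> \<and> \<Gamma> j \<omega> \<le> y}"
  shows "(\<Sum>j. indicator {x<..y} (\<Gamma> (Suc j) \<omega>)) = (of_nat (arrival_count \<Gamma> x y \<omega>) :: ennreal)"
proof -
  let ?S = "{j. x < \<Gamma> (Suc j) \<omega> \<and> \<Gamma> (Suc j) \<omega> \<le> y}"
  have img: "Suc ` ?S = {j\<in>{1..}. x < \<Gamma> j \<omega> \<and> \<Gamma> j \<omega> \<le> y}"
  proof (intro equalityI subsetI)
    fix i assume "i \<in> {j\<in>{1..}. x < \<Gamma> j \<omega> \<and> \<Gamma> j \<omega> \<le> y}"
    then show "i \<in> Suc ` ?S" by (cases i) auto
  qed auto
  have fin: "finite ?S" using assms unfolding img[symmetric] by (rule finite_imageD) simp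
  have "(\<Sum>j. indicator {x<..y} (\<Gamma> (Suc j) \<omega>)) = (\<integral>\<^sup>+j. indicator ?S j \<partial>count_space UNIV)"
    unfolding nn_integral_count_space_nat by (intro suminf_cong) (simp add: indicator_def)
  also have "\<dots> = of_nat (card ?S)" using fin by simp
  also have "card ?S = arrival_count \<Gamma> x y \<omega>"
    unfolding arrival_count_def img[symmetric] by (simp add: card_image)
  finally show ?thesis .
qed

lemma finite_below_of_at_top:
  fixes f :: "nat \<Rightarrow> real"
  assumes "filterlim f at_top sequentially" shows "finite {j. f j \<le> y}"
proof -
  obtain n where n: "\<And>j. n \<le> j \<Longrightarrow> y < f j"
    using assms unfolding filterlim_at_top_dense eventually_sequentially by blast
  then have "{j. f j \<le> y} \<subseteq> {..<n}" by (auto simp: not_le[symmetric])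
  then show ?thesis by (rule finite_subset) simp
qed

text \<open>The weight is replaced by its value at the left end of the dyadic cell. This bounds sums
  of weights over the arrivals by cell counts, whose means are known.\<close>

lemma dyadic_indicator_bound:
  fixes x T \<beta> :: real
  assumes "0 < T" "0 < \<beta>"
  shows "ennreal (x powr - \<beta> * indicator {T<..} x) \<le>
    (\<Sum>k. ennreal ((T * 2 ^ k) powr - \<beta>) * indicator {T * 2 ^ k<..T * 2 ^ Suc k} x)"
proof (cases "T < x")
  case True
  obtain m where "x / T < 2 ^ m" using real_arch_pow[of 2 "x / T"] by auto
  then have "x \<le> T * 2 ^ m" using assms by (simp add: field_simps)
  then obtain k where k: "T * 2 ^ k < x" "x \<le> T * 2 ^ Suc k"
    using exists_bin[of "\<lambda>k. T * 2 ^ k" x m] True by auto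
  define f where "f k = ennreal ((T * 2 ^ k) powr - \<beta>) * indicator {T * 2 ^ k<..T * 2 ^ Suc k} x" for k
  have "ennreal (x powr - \<beta> * indicator {T<..} x) \<le> f k"
    using True k assms by (auto simp: f_def intro!: ennreal_leI powr_mono2')
  also have "\<dots> = sum f {k}" by simp
  also have "\<dots> \<le> suminf f" by (rule sum_le_suminf) auto
  also have "\<dots> = (\<Sum>k. ennreal ((T * 2 ^ k) powr - \<beta>) * indicator {T * 2 ^ k<..T * 2 ^ Suc k} x)"
    by (intro suminf_cong) (simp only: f_def)
  finally show ?thesis .
qed simp

text \<open>The cell that starts at \<open>T * 2 ^ k\<close> has length and mean count
  \<open>T * 2 ^ k\<close>, so the bound is a geometric series with ratio
  \<open>2 powr (1 - \<beta>)\<close>, which is less than 1.\<close>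

lemma poisson_arrivals_tail_sum:
  assumes "prob_space P" and \<Gamma>: "unit_poisson_arrival_times P \<Gamma>" and \<beta>: "1 < \<beta>" and T: "0 < T"
  shows "(\<integral>\<^sup>+\<omega>. (\<Sum>j. ennreal (\<Gamma> (Suc j) \<omega> powr - \<beta> * indicator {T<..} (\<Gamma> (Suc j) \<omega>))) \<partial>P)
    \<le> ennreal (1 / (1 - 2 powr (1 - \<beta>)) * T powr (1 - \<beta>))"
proof -
  interpret prob_space P by fact
  have meas: "\<And>j. 1 \<le> j \<Longrightarrow> \<Gamma> j \<in> borel_measurable P" using \<Gamma> by (simp add: unit_poisson_arrival_times_def)
  have [measurable]: "arrival_count \<Gamma> x y \<in> measurable P (count_space UNIV)" for x y
    using meas by (rule measurable_arrival_count)
  have top: "AE \<omega> in P. filterlim (\<lambda>j. \<Gamma> j \<omega>) at_top sequentially"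
    using \<Gamma> by (auto simp: unit_poisson_arrival_times_def elim!: eventually_mono)
  define t where "t k = T * 2 ^ k" for k :: nat
  have t: "0 < t k" "t k < t (Suc k)" for k using T by (auto simp: t_def)
  have mean: "(\<integral>\<^sup>+\<omega>. of_nat (arrival_count \<Gamma> (t k) (t (Suc k)) \<omega>) \<partial>P) = ennreal (t k)" for k
  proof -
    have "(\<integral>\<^sup>+\<omega>. of_nat (arrival_count \<Gamma> (t k) (t (Suc k)) \<omega>) \<partial>P) =
       (\<integral>\<^sup>+n. ennreal (real n) \<partial>distr P (count_space UNIV) (arrival_count \<Gamma> (t k) (t (Suc k))))"
      by (subst nn_integral_distr) (auto simp: ennreal_of_nat_eq_real_of_nat)
    also have "distr P (count_space UNIV) (arrival_count \<Gamma> (t k) (t (Suc k))) = measure_pmf (poisson_pmf (t (Suc k) - t k))"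
      using \<Gamma> t[of k] unfolding unit_poisson_arrival_times_def by (metis less_imp_le)
    also have "t (Suc k) - t k = t k" by (simp add: t_def)
    finally show ?thesis using t(1)[of k] by (simp only: nn_integral_poisson_pmf)
  qed
  have "(\<integral>\<^sup>+\<omega>. (\<Sum>j. ennreal (\<Gamma> (Suc j) \<omega> powr - \<beta> * indicator {T<..} (\<Gamma> (Suc j) \<omega>))) \<partial>P) \<le>
     (\<integral>\<^sup>+\<omega>. (\<Sum>k. ennreal (t k powr - \<beta>) * of_nat (arrival_count \<Gamma> (t k) (t (Suc k)) \<omega>)) \<partial>P)"
  proof (rule nn_integral_mono_AE)
    show "AE \<omega> in P. (\<Sum>j. ennreal (\<Gamma> (Suc j) \<omega> powr - \<beta> * indicator {T<..} (\<Gamma> (Suc j) \<omega>))) \<le>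
        (\<Sum>k. ennreal (t k powr - \<beta>) * of_nat (arrival_count \<Gamma> (t k) (t (Suc k)) \<omega>))"
      using top
    proof eventually_elim
      case (elim \<omega>)
      have c: "(\<Sum>j. indicator {t k<..t (Suc k)} (\<Gamma> (Suc j) \<omega>)) = (of_nat (arrival_count \<Gamma> (t k) (t (Suc k)) \<omega>) :: ennreal)" for k
      proof (rule suminf_indicator_arrival_count)
        show "finite {j\<in>{1..}. t k < \<Gamma> j \<omega> \<and> \<Gamma> j \<omega> \<le> t (Suc k)}"
          by (rule finite_subset[OF _ finite_below_of_at_top[OF elim, of "t (Suc k)"]]) auto
      qed
      have "(\<Sum>j. ennreal (\<Gamma> (Suc j) \<omega> powr - \<beta> * indicator {T<..} (\<Gamma> (Suc j) \<omega>))) \<le>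
         (\<Sum>j. \<Sum>k. ennreal (t k powr - \<beta>) * indicator {t k<..t (Suc k)} (\<Gamma> (Suc j) \<omega>))"
        unfolding t_def using T \<beta> by (intro suminf_le dyadic_indicator_bound) auto
      also have "\<dots> = (\<Sum>k. \<Sum>j. ennreal (t k powr - \<beta>) * indicator {t k<..t (Suc k)} (\<Gamma> (Suc j) \<omega>))"
        by (rule suminf_ennreal_swap)
      also have "\<dots> = (\<Sum>k. ennreal (t k powr - \<beta>) * of_nat (arrival_count \<Gamma> (t k) (t (Suc k)) \<omega>))"
        by (simp only: ennreal_suminf_cmult c)
      finally show ?case .
    qed
  qed
  also have "\<dots> = (\<Sum>k. ennreal (t k powr - \<beta>) * ennreal (t k))"
    by (subst nn_integral_suminf) (auto simp: nn_integral_cmult mean)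
  also have "\<dots> = (\<Sum>k. ennreal (T powr (1 - \<beta>) * (2 powr (1 - \<beta>)) ^ k))"
  proof (rule suminf_cong)
    fix k
    have "t k powr - \<beta> * t k = t k powr (1 - \<beta>)"
      using t(1)[of k] by (simp add: powr_diff powr_minus field_simps)
    also have "\<dots> = T powr (1 - \<beta>) * (2 powr (1 - \<beta>)) ^ k"
      using T by (simp add: t_def powr_mult powr_power flip: powr_realpow) (simp add: powr_powr mult.commute)
    finally show "ennreal (t k powr - \<beta>) * ennreal (t k) = ennreal (T powr (1 - \<beta>) * (2 powr (1 - \<beta>)) ^ k)"
      using t(1)[of k] by (simp flip: ennreal_mult)
  qed
  also have "\<dots> = ennreal (T powr (1 - \<beta>) * (1 / (1 - 2 powr (1 - \<beta>))))"
  proof -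
    have q: "norm ((2::real) powr (1 - \<beta>)) < 1" using \<beta> by (simp add: powr_less_one)
    have "(\<lambda>k. T powr (1 - \<beta>) * (2 powr (1 - \<beta>)) ^ k) sums (T powr (1 - \<beta>) * (1 / (1 - 2 powr (1 - \<beta>))))"
      by (intro sums_mult geometric_sums q)
    then show ?thesis by (subst suminf_ennreal2) (auto simp: sums_iff)
  qed
  finally show ?thesis by (simp add: mult.commute)
qed

text \<open>The counts have the limit law for every n. Summability follows from the tail bound at T
  = 1: the weights of the arrivals beyond 1 have a sum of finite mean, and almost surely only
  finitely many arrivals are at most 1.\<close>

lemma asymptotically_poisson_arrivals:
  assumes "prob_space P" and \<Gamma>: "unit_poisson_arrival_times P \<Gamma>" and \<beta>: "1 < \<beta>"
  shows "asymptotically_poisson P (\<lambda>_. \<Gamma>) \<beta> (1 / (1 - 2 powr (1 - \<beta>)))"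
proof -
  interpret prob_space P by fact
  have meas: "\<And>j. 1 \<le> j \<Longrightarrow> \<Gamma> j \<in> borel_measurable P" using \<Gamma> by (simp add: unit_poisson_arrival_times_def)
  have ae: "AE \<omega> in P. 0 < \<Gamma> 1 \<omega> \<and> (\<forall>j\<ge>1. \<Gamma> j \<omega> < \<Gamma> (Suc j) \<omega>) \<and> filterlim (\<lambda>j. \<Gamma> j \<omega>) at_top sequentially"
    using \<Gamma> by (simp add: unit_poisson_arrival_times_def)
  have tail: "(\<integral>\<^sup>+\<omega>. (\<Sum>j. ennreal (\<Gamma> (Suc j) \<omega> powr - \<beta> * indicator {T<..} (\<Gamma> (Suc j) \<omega>))) \<partial>P)
    \<le> ennreal (1 / (1 - 2 powr (1 - \<beta>)) * T powr (1 - \<beta>))" if "0 < T" for T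
    using poisson_arrivals_tail_sum[OF assms that] .
  show ?thesis
  proof unfold_locales
    show "1 < \<beta>" by fact
    show "\<Gamma> j \<in> borel_measurable P" if "1 \<le> j" for j using meas that .
    show "AE \<omega> in P. \<forall>j\<ge>1. 0 \<le> \<Gamma> j \<omega>"
      using ae
    proof eventually_elim
      case (elim \<omega>)
      have pos: "0 < \<Gamma> (Suc i) \<omega>" for i
      proof (induction i)
        case (Suc i) then show ?case using elim[THEN conjunct2, THEN conjunct1, rule_format, of "Suc i"] by simp
      qed (use elim in simp)
      show ?case
      proof (intro allI impI)
        fix j :: nat assume "1 \<le> j"
        then obtain i where "j = Suc i" by (cases j) auto
        then show "0 \<le> \<Gamma> j \<omega>" using pos[of i] by simp
      qed
    qed
    have m1: "(\<lambda>\<omega>. \<Sum>j. ennreal (\<Gamma> (Suc j) \<omega> powr - \<beta> * indicator {1<..} (\<Gamma> (Suc j) \<omega>))) \<in> borel_measurable P"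
    proof -
      have [measurable]: "\<Gamma> (Suc j) \<in> borel_measurable P" for j using meas by simp
      show ?thesis by measurable
    qed
    have "(\<integral>\<^sup>+\<omega>. (\<Sum>j. ennreal (\<Gamma> (Suc j) \<omega> powr - \<beta> * indicator {1<..} (\<Gamma> (Suc j) \<omega>))) \<partial>P) \<noteq> \<infinity>"
      using order.strict_trans1[OF tail[OF zero_less_one] ennreal_less_top]
      unfolding infinity_ennreal_def by (rule less_imp_neq)
    then have "AE \<omega> in P. (\<Sum>j. ennreal (\<Gamma> (Suc j) \<omega> powr - \<beta> * indicator {1<..} (\<Gamma> (Suc j) \<omega>))) \<noteq> \<infinity>"
      by (rule nn_integral_PInf_AE[OF m1])
    then show "AE \<omega> in P. summable (\<lambda>j. \<Gamma> (Suc j) \<omega> powr - \<beta>)"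
      using ae
    proof eventually_elim
      case (elim \<omega>)
      have s: "summable (\<lambda>j. \<Gamma> (Suc j) \<omega> powr - \<beta> * indicator {1<..} (\<Gamma> (Suc j) \<omega>))"
      proof (rule summable_suminf_not_top)
        show "(\<Sum>j. ennreal (\<Gamma> (Suc j) \<omega> powr - \<beta> * indicator {1<..} (\<Gamma> (Suc j) \<omega>))) \<noteq> \<top>"
          using elim(1) unfolding infinity_ennreal_def .
      qed simp
      have "filterlim (\<lambda>j. \<Gamma> j \<omega>) at_top sequentially" using elim(2) by blast
      then have "filterlim (\<lambda>j. \<Gamma> (Suc j) \<omega>) at_top sequentially"
        by (rule filterlim_compose[OF _ filterlim_Suc])
      then have "\<forall>\<^sub>F j in sequentially. 1 < \<Gamma> (Suc j) \<omega>" by (simp add: filterlim_at_top_dense)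
      then have "\<forall>\<^sub>F j in sequentially. \<Gamma> (Suc j) \<omega> powr - \<beta> * indicator {1<..} (\<Gamma> (Suc j) \<omega>) = \<Gamma> (Suc j) \<omega> powr - \<beta>"
        by eventually_elim simp
      from iffD1[OF summable_cong[OF this] s] show ?case .
    qed
    show "(\<lambda>n. prob (bin_counts t m \<Gamma> -` B \<inter> space P)) \<longlonglongrightarrow> measure_pmf.prob (poisson_bin_law t m) B"
      if t: "strict_mono t" "t 0 = 0" for t m B
    proof (rule bin_counts_tendsto_of_fdd[where U = "\<lambda>_. \<Gamma>"])
      fix c :: "nat \<Rightarrow> nat"
      have indep: "indep_vars (\<lambda>_. count_space UNIV) (\<lambda>i. arrival_count \<Gamma> (t i) (t (Suc i))) UNIV"
        using \<Gamma> t unfolding unit_poisson_arrival_times_def by auto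
      have [measurable]: "arrival_count \<Gamma> x y \<in> measurable P (count_space UNIV)" for x y
        using meas by (rule measurable_arrival_count)
      have one: "prob (arrival_count \<Gamma> (t k) (t (Suc k)) -` {c k} \<inter> space P) = pmf (poisson_pmf (t (Suc k) - t k)) (c k)" for k
      proof -
        have "0 \<le> t k" "t k < t (Suc k)"
          using strict_mono_mono[OF t(1), THEN monoD, of 0 k] strict_monoD[OF t(1), of k "Suc k"] t(2) by auto
        then have d: "distr P (count_space UNIV) (arrival_count \<Gamma> (t k) (t (Suc k))) = measure_pmf (poisson_pmf (t (Suc k) - t k))"
          using \<Gamma> unfolding unit_poisson_arrival_times_def by blast
        have "prob (arrival_count \<Gamma> (t k) (t (Suc k)) -` {c k} \<inter> space P) =
            measure (distr P (count_space UNIV) (arrival_count \<Gamma> (t k) (t (Suc k)))) {c k}"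
          by (subst measure_distr) auto
        then show ?thesis unfolding d by (simp add: measure_pmf_single)
      qed
      have "prob {\<omega>\<in>space P. \<forall>k<m. arrival_count \<Gamma> (t k) (t (Suc k)) \<omega> = c k} =
          (\<Prod>k<m. pmf (poisson_pmf (t (Suc k) - t k)) (c k))"
      proof (cases "m = 0")
        case False
        then have "{\<omega>\<in>space P. \<forall>k<m. arrival_count \<Gamma> (t k) (t (Suc k)) \<omega> = c k} =
            (\<Inter>k\<in>{..<m}. arrival_count \<Gamma> (t k) (t (Suc k)) -` {c k} \<inter> space P)" by auto
        moreover have "prob (\<Inter>k\<in>{..<m}. arrival_count \<Gamma> (t k) (t (Suc k)) -` {c k} \<inter> space P) =
            (\<Prod>k<m. prob (arrival_count \<Gamma> (t k) (t (Suc k)) -` {c k} \<inter> space P))"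
          using False by (intro indep_varsD[OF indep]) auto
        ultimately show ?thesis by (simp only: one)
      qed (simp add: prob_space)
      then show "(\<lambda>n. prob {\<omega>\<in>space P. \<forall>k<m. arrival_count \<Gamma> (t k) (t (Suc k)) \<omega> = c k})
          \<longlonglongrightarrow> (\<Prod>k<m. pmf (poisson_pmf (t (Suc k) - t k)) (c k))" by (simp only: tendsto_const)
    qed (rule meas)
    show "\<forall>\<^sub>F n in sequentially. (\<integral>\<^sup>+\<omega>. (\<Sum>j. ennreal (\<Gamma> (Suc j) \<omega> powr - \<beta> * indicator {T<..} (\<Gamma> (Suc j) \<omega>))) \<partial>P)
      \<le> ennreal (1 / (1 - 2 powr (1 - \<beta>)) * T powr (1 - \<beta>))" if "0 < T" for T
      using tail[OF that] by (rule always_eventually[OF allI])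
  qed
qed

lemma is_sum_max_ratio_arrivals:
  assumes "unit_poisson_arrival_times P \<Gamma>" and "0 < \<beta>"
  shows "AE \<omega> in P. is_sum_max_ratio \<beta> (\<lambda>j. \<Gamma> j \<omega>) (\<Gamma> 1 \<omega> powr \<beta> * (\<Sum>j. \<Gamma> (Suc j) \<omega> powr - \<beta>))"
proof -
  have "AE \<omega> in P. 0 < \<Gamma> 1 \<omega> \<and> (\<forall>j\<ge>1. \<Gamma> j \<omega> < \<Gamma> (Suc j) \<omega>)"
    using assms(1) by (auto simp: unit_poisson_arrival_times_def elim: eventually_mono)
  then show ?thesis
  proof eventually_elim
    case (elim \<omega>)
    have "\<Gamma> 1 \<omega> \<le> \<Gamma> (Suc i) \<omega>" for i
    proof (induction i)
      case (Suc i) then show ?case using elim[THEN conjunct2, rule_format, of "Suc i"] by simp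
    qed simp
    then have "\<Gamma> i \<omega> powr - \<beta> \<le> \<Gamma> 1 \<omega> powr - \<beta>" if "1 \<le> i" for i
      using that elim assms(2) by (cases i) (auto intro!: powr_mono2')
    then show ?case
      unfolding is_sum_max_ratio_def by (intro exI[of _ 1]) (auto simp: powr_minus divide_inverse)
  qed
qed

section \<open>The rescaled independent sample\<close>

lemma iid_measurable:
  assumes "prob_space M" "iid M {1..} H" "1 \<le> j" shows "H j \<in> borel_measurable M"
proof -
  interpret prob_space M by fact
  have "indep_vars (\<lambda>_. borel) H {1..}" using assms(2) by (simp only: iid_def)
  then show ?thesis using assms(3) by (simp add: indep_vars_def)
qed

lemma iid_distr:
  assumes "iid M {1..} H" "1 \<le> j" shows "distr M borel (H j) = distr M borel (H 1)"
  using assms unfolding iid_def by (metis atLeast_iff order_refl)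

lemma iid_prob:
  assumes "prob_space M" "iid M {1..} H" "1 \<le> j" and [measurable]: "B \<in> sets borel"
  shows "measure M (H j -` B \<inter> space M) = measure (distr M borel (H 1)) B"
  unfolding iid_distr[OF assms(2,3), symmetric]
  using measure_distr[OF iid_measurable[OF assms(1-3)] assms(4)] by (rule sym)

text \<open>The condition \<open>0 < x powr - \<alpha>\<close> excludes \<open>x = 0\<close>, where
  the power is 0 by convention although the point is meant to lie at infinity.\<close>

lemma powr_neg_le_iff:
  fixes x t \<alpha> :: real
  assumes "0 < \<alpha>" "0 < t" "0 \<le> x"
  shows "0 < x powr - \<alpha> \<and> x powr - \<alpha> \<le> t \<longleftrightarrow> t powr (- 1 / \<alpha>) \<le> x"
proof
  assume l: "0 < x powr - \<alpha> \<and> x powr - \<alpha> \<le> t"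
  then have x: "0 < x" using assms by (cases "x = 0") auto
  have "t powr (- 1 / \<alpha>) \<le> (x powr - \<alpha>) powr (- 1 / \<alpha>)"
    using l x assms by (intro powr_mono2') auto
  then show "t powr (- 1 / \<alpha>) \<le> x" using x assms by (simp add: powr_powr)
next
  assume r: "t powr (- 1 / \<alpha>) \<le> x"
  have t: "0 < t powr (- 1 / \<alpha>)" using assms by simp
  then have x: "0 < x" using r by linarith
  have "x powr - \<alpha> \<le> (t powr (- 1 / \<alpha>)) powr - \<alpha>"
    using r t assms by (intro powr_mono2') auto
  then show "0 < x powr - \<alpha> \<and> x powr - \<alpha> \<le> t" using x assms by (simp add: powr_powr)
qed

text \<open>For nonzero h, \<open>u n h \<le> t\<close> means
  \<open>a n * t powr (- 1 / \<alpha>) \<le> \<bar>h\<bar>\<close>, an event of probability about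
  \<open>t / n\<close>; this is why the limit has unit rate. Raised to the power
  \<open>- A / \<alpha>\<close> the points give back \<open>(\<bar>h\<bar> / a n) powr A\<close>, so
  the mean weight beyond T is a truncated moment.\<close>

lemma asymptotically_poisson_sample:
  fixes M :: "'a measure" and H :: "nat \<Rightarrow> 'a \<Rightarrow> real" and a :: "nat \<Rightarrow> real" and \<alpha> A :: real
  defines "D \<equiv> distr M borel (H 1)"
  assumes M: "prob_space M" and H: "iid M {1..} H" and \<alpha>: "0 < \<alpha>" "\<alpha> < A"
    and a: "\<And>n. 0 < a n" "incseq a" "filterlim a at_top sequentially"
    and lim: "\<And>x. 0 < x \<Longrightarrow> (\<lambda>n. real n * measure D {z. a n * x \<le> \<bar>z\<bar>}) \<longlonglongrightarrow> x powr - \<alpha>"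
  obtains K where
    "asymptotically_poisson M (\<lambda>n j \<omega>. if j \<le> n then (\<bar>H j \<omega>\<bar> / a n) powr - \<alpha> else 0) (A / \<alpha>) K"
proof -
  interpret prob_space M by fact
  have meas: "H j \<in> borel_measurable M" if "1 \<le> j" for j using iid_measurable[OF M H that] .
  interpret D: prob_space D unfolding D_def using meas by (intro prob_space_distr) simp
  have D[measurable_cong]: "sets D = sets borel" by (simp add: D_def)
  have spD: "space D = UNIV" by (simp add: D_def)
  define \<beta> where "\<beta> = A / \<alpha>"
  have \<beta>: "1 < \<beta>" "\<alpha> * \<beta> = A" using \<alpha> by (auto simp: \<beta>_def)
  define u where "u n h = (\<bar>h\<bar> / a n) powr - \<alpha>" for n and h :: real
  define U where "U n j \<omega> = (if j \<le> n then u n (H j \<omega>) else 0)" for n j \<omega>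
  have u_meas[measurable]: "u n \<in> borel_measurable borel" for n unfolding u_def by measurable
  have u_iff: "0 < u n h \<and> u n h \<le> t \<longleftrightarrow> a n * t powr (- 1 / \<alpha>) \<le> \<bar>h\<bar>" if "0 < t" for n h t
    unfolding u_def using powr_neg_le_iff[OF \<alpha>(1) that, of "\<bar>h\<bar> / a n"] a(1)[of n]
    by (simp add: pos_le_divide_eq mult.commute)
  have u_nonneg: "0 \<le> u n h" for n h by (simp add: u_def)
  define q where "q n t = measure D {h. 0 < u n h \<and> u n h \<le> t}" for n t
  have q_lim: "(\<lambda>n. real n * q n t) \<longlonglongrightarrow> t" if "0 \<le> t" for t
  proof (cases "t = 0")
    case True
    have "{h. 0 < u n h \<and> u n h \<le> t} = {}" for n using True by auto
    then show ?thesis using True unfolding q_def by (simp only: measure_empty mult_zero_right tendsto_const)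
  next
    case False
    then have t: "0 < t" using that by simp
    have "(\<lambda>n. real n * measure D {z. a n * t powr (- 1 / \<alpha>) \<le> \<bar>z\<bar>}) \<longlonglongrightarrow> (t powr (- 1 / \<alpha>)) powr - \<alpha>"
      using t by (intro lim) simp
    moreover have "(t powr (- 1 / \<alpha>)) powr - \<alpha> = t" using t \<alpha> by (simp add: powr_powr)
    ultimately show ?thesis unfolding q_def u_iff[OF t] by (simp only:)
  qed
  have A: "0 < A" using \<alpha> by simp
  obtain K t0 where K: "0 < K" "0 < t0"
    "\<And>s. t0 \<le> s \<Longrightarrow> (\<integral>z. \<bar>z\<bar> powr A * indicator {z. \<bar>z\<bar> < s} z \<partial>D) \<le> K * s powr A * measure D {z. s \<le> \<bar>z\<bar>}"
    using truncated_moment_bound[OF D.prob_space_axioms D a(2,3) lim \<alpha>(2) A] by blast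
  have U_meas: "U n j \<in> borel_measurable M" if "1 \<le> j" for n j
  proof -
    have [measurable]: "H j \<in> borel_measurable M" using meas that .
    show ?thesis unfolding U_def by measurable
  qed
  have "asymptotically_poisson M U \<beta> (2 * K)"
  proof unfold_locales
    show "1 < \<beta>" by fact
    show "U n j \<in> borel_measurable M" if "1 \<le> j" for n j using U_meas that .
    show "AE \<omega> in M. \<forall>j\<ge>1. 0 \<le> U n j \<omega>" for n by (simp add: U_def u_nonneg)
    show "AE \<omega> in M. summable (\<lambda>j. U n (Suc j) \<omega> powr - \<beta>)" for n
      by (intro always_eventually allI summable_finite[of "{..n}"]) (auto simp: U_def)
    show "(\<lambda>n. prob (bin_counts t m (U n) -` B \<inter> space M)) \<longlonglongrightarrow> measure_pmf.prob (poisson_bin_law t m) B"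
      if t: "strict_mono t" "t 0 = 0" for t m B
    proof (rule bin_counts_tendsto_of_fdd[OF U_meas])
      fix c :: "nat \<Rightarrow> nat"
      have tk: "0 \<le> t k" "t k < t (Suc k)" for k
        using strict_mono_mono[OF t(1), THEN monoD, of 0 k] strict_monoD[OF t(1), of k "Suc k"] t(2) by auto
      define E where "E n k = {h. t k < u n h \<and> u n h \<le> t (Suc k)}" for n k
      have E_meas[measurable]: "E n k \<in> sets borel" for n k unfolding E_def by measurable
      have E_prob: "prob (H 1 -` E n k \<inter> space M) = q n (t (Suc k)) - q n (t k)" for n k
      proof -
        have "E n k = {h. 0 < u n h \<and> u n h \<le> t (Suc k)} - {h. 0 < u n h \<and> u n h \<le> t k}"
          using tk(1)[of k] by (auto simp: E_def)
        moreover have "measure D ({h. 0 < u n h \<and> u n h \<le> t (Suc k)} - {h. 0 < u n h \<and> u n h \<le> t k}) =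
            q n (t (Suc k)) - q n (t k)"
          unfolding q_def using tk(2)[of k] by (intro D.finite_measure_Diff) auto
        ultimately have "measure D (E n k) = q n (t (Suc k)) - q n (t k)" by (simp only:)
        then show ?thesis using iid_prob[OF M H order_refl E_meas] by (simp only: D_def)
      qed
      have "(\<lambda>n. prob {\<omega>\<in>space M. \<forall>k<m. card {i\<in>{1..n}. H i \<omega> \<in> E n k} = c k})
        \<longlonglongrightarrow> (\<Prod>k<m. pmf (poisson_pmf (t (Suc k) - t k)) (c k))"
      proof (rule bin_counts_tendsto_poisson)
        show "indep_vars (\<lambda>_. borel) H {1..}" using H by (simp add: iid_def)
        show "E n k \<inter> E n l = {}" if "k < l" for n k l
          using strict_mono_mono[OF t(1), THEN monoD, of "Suc k" l] that by (auto simp: E_def)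
        show "prob (H i -` B \<inter> space M) = prob (H 1 -` B \<inter> space M)" if "1 \<le> i" "B \<in> sets borel" for i B
          using iid_prob[OF M H that] iid_prob[OF M H order_refl that(2)] by simp
        show "(\<lambda>n. real n * prob (H 1 -` E n k \<inter> space M)) \<longlonglongrightarrow> t (Suc k) - t k" for k
          unfolding E_prob right_diff_distrib by (intro tendsto_diff q_lim tk)
        show "0 < t (Suc k) - t k" for k using tk(2)[of k] by simp
      qed (rule E_meas)
      moreover have "arrival_count (U n) (t k) (t (Suc k)) \<omega> = card {i\<in>{1..n}. H i \<omega> \<in> E n k}" for n k \<omega>
        unfolding arrival_count_def using tk(1)[of k]
        by (intro arg_cong[where f = card]) (auto simp: U_def E_def split: if_splits)
      ultimately show "(\<lambda>n. prob {\<omega>\<in>space M. \<forall>k<m. arrival_count (U n) (t k) (t (Suc k)) \<omega> = c k})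
        \<longlonglongrightarrow> (\<Prod>k<m. pmf (poisson_pmf (t (Suc k) - t k)) (c k))" by (simp only:)
    qed
    show "\<forall>\<^sub>F n in sequentially. (\<integral>\<^sup>+\<omega>. (\<Sum>j. ennreal (U n (Suc j) \<omega> powr - \<beta> * indicator {T<..} (U n (Suc j) \<omega>))) \<partial>M)
         \<le> ennreal (2 * K * T powr (1 - \<beta>))" if T: "0 < T" for T
    proof -
      \<comment> \<open>The threshold that corresponds to T: a nonzero h has its point beyond T
        exactly when \<open>\<bar>h\<bar> < s n\<close>.\<close>
      define s where "s n = a n * T powr (- 1 / \<alpha>)" for n
      have s_pos: "0 < s n" for n using a(1)[of n] T by (simp add: s_def)
      have "filterlim s at_top sequentially"
        unfolding s_def using T by (intro filterlim_at_top_mult_tendsto_pos[OF tendsto_const _ a(3)]) simp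
      then have "\<forall>\<^sub>F n in sequentially. t0 \<le> s n" unfolding filterlim_at_top by blast
      moreover have "(\<lambda>n. real n * measure D {z. s n \<le> \<bar>z\<bar>}) \<longlonglongrightarrow> T"
        using q_lim[of T] T by (simp add: q_def u_iff s_def)
      \<comment> \<open>The limit is T; the factor 2 in the constant \<open>2 * K\<close> pays for
        an inequality at all large n.\<close>
      then have "\<forall>\<^sub>F n in sequentially. real n * measure D {z. s n \<le> \<bar>z\<bar>} < 2 * T"
        using T by (intro order_tendstoD) auto
      ultimately show ?thesis
      proof eventually_elim
        case (elim n)
        define \<phi> where "\<phi> h = ennreal (u n h powr - \<beta> * indicator {T<..} (u n h))" for h
        have \<phi>_meas[measurable]: "\<phi> \<in> borel_measurable borel" unfolding \<phi>_def by measurable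
        have \<phi>_le: "\<phi> h \<le> ennreal (a n powr - A * (\<bar>h\<bar> powr A * indicator {z. \<bar>z\<bar> < s n} h))" for h
        proof (cases "T < u n h")
          case True
          then have "\<not> (0 < u n h \<and> u n h \<le> T)" by simp
          then have "\<bar>h\<bar> < s n" unfolding u_iff[OF T] s_def by simp
          moreover have "u n h powr - \<beta> = a n powr - A * \<bar>h\<bar> powr A"
          proof -
            have "u n h powr - \<beta> = (\<bar>h\<bar> / a n) powr A" unfolding u_def powr_powr using \<beta>(2) by simp
            then show ?thesis using a(1)[of n] by (simp add: powr_divide powr_minus_divide)
          qed
          ultimately show ?thesis using True by (simp add: \<phi>_def)
        qed (simp add: \<phi>_def)
        have "(\<integral>\<^sup>+h. \<phi> h \<partial>D) \<le> (\<integral>\<^sup>+h. ennreal (a n powr - A * (\<bar>h\<bar> powr A * indicator {z. \<bar>z\<bar> < s n} h)) \<partial>D)"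
          by (intro nn_integral_mono \<phi>_le)
        also have "\<dots> = ennreal (\<integral>h. a n powr - A * (\<bar>h\<bar> powr A * indicator {z. \<bar>z\<bar> < s n} h) \<partial>D)"
        proof (rule nn_integral_eq_integral)
          have "integrable D (\<lambda>h. \<bar>h\<bar> powr A * indicator {z. \<bar>z\<bar> < s n} h)"
          proof (rule D.integrable_const_bound[of _ "s n powr A"])
            show "AE h in D. norm (\<bar>h\<bar> powr A * indicator {z. \<bar>z\<bar> < s n} h) \<le> s n powr A"
              using \<alpha> by (auto simp: indicator_def intro!: powr_mono2)
          qed simp
          then show "integrable D (\<lambda>h. a n powr - A * (\<bar>h\<bar> powr A * indicator {z. \<bar>z\<bar> < s n} h))"
            by (rule integrable_mult_right)
        qed simp
        also have "\<dots> \<le> ennreal (a n powr - A * (K * s n powr A * measure D {z. s n \<le> \<bar>z\<bar>}))"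
          using K(3)[OF elim(1)] by (intro ennreal_leI) (simp add: mult_left_mono)
        also have "a n powr - A * (K * s n powr A * measure D {z. s n \<le> \<bar>z\<bar>}) = K * T powr - \<beta> * measure D {z. s n \<le> \<bar>z\<bar>}"
        proof -
          have "s n powr A = a n powr A * T powr - \<beta>"
            using a(1)[of n] by (simp add: s_def powr_mult powr_powr \<beta>_def)
          moreover have "a n powr - A * a n powr A = 1" using a(1)[of n] by (simp flip: powr_add)
          ultimately show ?thesis by (simp add: mult_ac)
        qed
        finally have \<phi>_int: "(\<integral>\<^sup>+h. \<phi> h \<partial>D) \<le> ennreal (K * T powr - \<beta> * measure D {z. s n \<le> \<bar>z\<bar>})" .
        have "(\<Sum>j. ennreal (U n (Suc j) \<omega> powr - \<beta> * indicator {T<..} (U n (Suc j) \<omega>))) = (\<Sum>j<n. \<phi> (H (Suc j) \<omega>))" for \<omega>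
        proof -
          have "(\<Sum>j. ennreal (U n (Suc j) \<omega> powr - \<beta> * indicator {T<..} (U n (Suc j) \<omega>))) =
             (\<Sum>j<n. ennreal (U n (Suc j) \<omega> powr - \<beta> * indicator {T<..} (U n (Suc j) \<omega>)))"
            by (rule suminf_finite) (auto simp: U_def)
          then show ?thesis by (simp add: U_def \<phi>_def Suc_le_eq)
        qed
        then have "(\<integral>\<^sup>+\<omega>. (\<Sum>j. ennreal (U n (Suc j) \<omega> powr - \<beta> * indicator {T<..} (U n (Suc j) \<omega>))) \<partial>M) =
            (\<integral>\<^sup>+\<omega>. (\<Sum>j<n. \<phi> (H (Suc j) \<omega>)) \<partial>M)" by (simp only:)
        also have "\<dots> = (\<Sum>j<n. \<integral>\<^sup>+\<omega>. \<phi> (H (Suc j) \<omega>) \<partial>M)"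
          using meas by (intro nn_integral_sum measurable_compose[OF _ \<phi>_meas]) simp
        also have "\<dots> = (\<Sum>j<n. \<integral>\<^sup>+h. \<phi> h \<partial>D)"
        proof (rule sum.cong)
          fix j
          have "(\<integral>\<^sup>+\<omega>. \<phi> (H (Suc j) \<omega>) \<partial>M) = (\<integral>\<^sup>+h. \<phi> h \<partial>distr M borel (H (Suc j)))"
            using meas[of "Suc j"] by (intro nn_integral_distr[symmetric]) auto
          also have "distr M borel (H (Suc j)) = D" unfolding D_def using iid_distr[OF H, of "Suc j"] by simp
          finally show "(\<integral>\<^sup>+\<omega>. \<phi> (H (Suc j) \<omega>) \<partial>M) = (\<integral>\<^sup>+h. \<phi> h \<partial>D)" .
        qed simp
        also have "\<dots> \<le> (\<Sum>j<n. ennreal (K * T powr - \<beta> * measure D {z. s n \<le> \<bar>z\<bar>}))"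
          by (intro sum_mono \<phi>_int)
        also have "\<dots> = ennreal (\<Sum>j<n. K * T powr - \<beta> * measure D {z. s n \<le> \<bar>z\<bar>})"
          using K by (intro sum_ennreal) auto
        also have "\<dots> \<le> ennreal (2 * K * T powr (1 - \<beta>))"
        proof (rule ennreal_leI)
          have "(\<Sum>j<n. K * T powr - \<beta> * measure D {z. s n \<le> \<bar>z\<bar>}) = K * T powr - \<beta> * (real n * measure D {z. s n \<le> \<bar>z\<bar>})"
            by simp
          also have "\<dots> \<le> K * T powr - \<beta> * (2 * T)"
            using elim(2) K by (intro mult_left_mono) auto
          also have "\<dots> = 2 * K * T powr (1 - \<beta>)" using T by (simp add: powr_diff powr_minus divide_inverse)
          finally show "(\<Sum>j<n. K * T powr - \<beta> * measure D {z. s n \<le> \<bar>z\<bar>}) \<le> 2 * K * T powr (1 - \<beta>)" .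
        qed
        finally show ?case .
      qed
    qed
  qed
  then show thesis using that[of "2 * K"] unfolding U_def u_def \<beta>_def by simp
qed

lemma sum_max_ratio_measurable:
  assumes [measurable]: "d n \<in> borel_measurable M"
    and X: "\<And>i. 1 \<le> i \<Longrightarrow> X n i \<in> borel_measurable M"
  shows "sum_max_ratio d X A n \<in> borel_measurable M"
proof -
  have 1[measurable]: "(\<lambda>\<omega>. \<bar>X n i \<omega>\<bar> powr A) \<in> borel_measurable M" if "i \<in> {1..n}" for i
  proof -
    have [measurable]: "X n i \<in> borel_measurable M" using X that by simp
    show ?thesis by measurable
  qed
  have [measurable]: "(\<lambda>\<omega>. Max ((\<lambda>i. \<bar>X n i \<omega>\<bar> powr A) ` {1..n})) \<in> borel_measurable M"
    using 1 by (intro borel_measurable_Max) auto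
  have [measurable]: "(\<lambda>\<omega>. \<Sum>i=1..n. \<bar>X n i \<omega>\<bar> powr A) \<in> borel_measurable M"
    using 1 by (intro borel_measurable_sum)
  show ?thesis unfolding sum_max_ratio_def Let_def by measurable
qed

text \<open>The scale b enters sum and maximum through the same factor \<open>1 / b powr A\<close>
  and cancels; indices beyond n have weight 0 and affect neither.\<close>

lemma is_sum_max_ratio_sample:
  fixes H :: "nat \<Rightarrow> 'a \<Rightarrow> real"
  assumes "1 \<le> n" "0 < \<alpha>" "0 < b"
  shows "is_sum_max_ratio (A / \<alpha>) (\<lambda>j. if j \<le> n then (\<bar>H j \<omega>\<bar> / b) powr - \<alpha> else 0)
    (sum_max_ratio d (\<lambda>_. H) A n \<omega>)"
proof -
  let ?f = "\<lambda>i. \<bar>H i \<omega>\<bar> powr A"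
  have V: "(if j \<le> n then (\<bar>H j \<omega>\<bar> / b) powr - \<alpha> else 0) powr - (A / \<alpha>) = (if j \<le> n then ?f j / b powr A else 0)" for j
    using assms by (simp add: powr_powr powr_divide)
  have "Max (?f ` {1..n}) \<in> ?f ` {1..n}" using assms by (intro Max_in) auto
  then obtain j where j: "j \<in> {1..n}" "Max (?f ` {1..n}) = ?f j" by auto
  have le: "?f i \<le> ?f j" if "i \<in> {1..n}" for i using that by (simp flip: j(2))
  have "(\<Sum>i. (if Suc i \<le> n then ?f (Suc i) / b powr A else 0)) = (\<Sum>i<n. ?f (Suc i) / b powr A)"
    by (subst suminf_finite[of "{..<n}"]) auto
  also have "\<dots> = (\<Sum>i=1..n. ?f i / b powr A)"
    by (rule sum.reindex_bij_witness[of _ "\<lambda>i. i - 1" Suc]) auto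
  finally have sum: "(\<Sum>i. (if Suc i \<le> n then ?f (Suc i) / b powr A else 0)) = (\<Sum>i=1..n. ?f i) / b powr A"
    by (simp add: sum_divide_distrib)
  show ?thesis unfolding is_sum_max_ratio_def V sum
  proof (intro exI[of _ j] conjI allI impI)
    show "1 \<le> j" using j by simp
    show "(if i \<le> n then ?f i / b powr A else 0) \<le> (if j \<le> n then ?f j / b powr A else 0)" if "1 \<le> i" for i
      using le[of i] that j by (auto intro: divide_right_mono)
    assume "0 < (if j \<le> n then ?f j / b powr A else 0)"
    then have "0 < ?f j" using assms by (auto simp: zero_less_divide_iff split: if_splits)
    then show "sum_max_ratio d (\<lambda>_. H) A n \<omega> = (\<Sum>i=1..n. ?f i) / b powr A / (if j \<le> n then ?f j / b powr A else 0)"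
      using j assms by (simp add: sum_max_ratio_def)
  qed
qed

section \<open>Soft truncation\<close>

text \<open>Lets the sample and the Poisson process share one constant, so that one grid serves
  both.\<close>

lemma asymptotically_poisson_mono:
  assumes "asymptotically_poisson M U \<beta> K" "K \<le> K'"
  shows "asymptotically_poisson M U \<beta> K'"
proof -
  interpret asymptotically_poisson M U \<beta> K by fact
  show ?thesis
  proof unfold_locales
    show "\<forall>\<^sub>F n in sequentially. (\<integral>\<^sup>+\<omega>. (\<Sum>j. ennreal (U n (Suc j) \<omega> powr - \<beta> * indicator {T<..} (U n (Suc j) \<omega>))) \<partial>M)
        \<le> ennreal (K' * T powr (1 - \<beta>))" if "0 < T" for T
      using tail_sum_bound[OF that]
    proof eventually_elim
      case (elim n)
      have "K * T powr (1 - \<beta>) \<le> K' * T powr (1 - \<beta>)" using assms(2) by (rule mult_right_mono) simp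
      then show ?case using elim by (meson ennreal_leI order_trans)
    qed
  qed (fact \<beta> measurable_U U_nonneg U_summable bin_counts_tendsto)+
qed

lemma cdf_distr:
  assumes "f \<in> borel_measurable N"
  shows "cdf (distr N borel f) x = measure N {\<omega>\<in>space N. f \<omega> \<le> x}"
  unfolding cdf_def using assms
  by (subst measure_distr) (auto intro!: arg_cong[where f = "measure N"])

lemma truncated_sample_eq:
  assumes "0 < L n" "\<bar>H j \<omega>\<bar> \<le> L n" shows "truncated_sample H R L n j \<omega> = H j \<omega>"
  using assms by (simp add: truncated_sample_def)

lemma truncated_sample_measurable:
  assumes [measurable]: "H j \<in> borel_measurable M" "R j \<in> borel_measurable M"
  shows "truncated_sample H R L n j \<in> borel_measurable M"
  unfolding truncated_sample_def by measurable

text \<open>By a union bound, some observation is truncated with probability at most the quantity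
  assumed to tend to 0. Up to this error the distribution function is that of \<open>Z'\<close>,
  formed from the untruncated variables.\<close>

lemma soft_truncation:
  fixes M :: "'a measure" and P :: "'b measure" and H R d :: "nat \<Rightarrow> 'a \<Rightarrow> real"
  assumes M: "prob_space M" and \<alpha>: "0 < \<alpha>" "\<alpha> < A"
    and H: "iid M {1..} H" and rv: "regularly_varying_tails (distr M borel (H 1)) \<alpha>"
    and R: "iid M {1..} R" and L: "\<And>n. 1 \<le> n \<Longrightarrow> 0 < L n" and d: "\<And>n. d n \<in> borel_measurable M"
    and soft: "(\<lambda>n. real n * measure M {\<omega>\<in>space M. \<bar>H 1 \<omega>\<bar> > L n}) \<longlonglongrightarrow> 0"
    and P: "prob_space P" and \<Gamma>: "unit_poisson_arrival_times P \<Gamma>"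
  shows "weak_conv_m (\<lambda>n. distr M borel (sum_max_ratio d (truncated_sample H R L) A n))
    (distr P borel (\<lambda>\<omega>. \<Gamma> 1 \<omega> powr (A / \<alpha>) * (\<Sum>j. \<Gamma> (Suc j) \<omega> powr (- A / \<alpha>))))"
proof -
  interpret prob_space M by fact
  have meas: "H j \<in> borel_measurable M" "R j \<in> borel_measurable M" if "1 \<le> j" for j
    using iid_measurable[OF M H that] iid_measurable[OF M R that] .
  define \<beta> where "\<beta> = A / \<alpha>"
  have \<beta>: "1 < \<beta>" using \<alpha> by (simp add: \<beta>_def)
  have pD: "prob_space (distr M borel (H 1))" using meas(1)[of 1] by (intro prob_space_distr) simp
  obtain a where a: "\<And>n. 0 < a n" "incseq a" "filterlim a at_top sequentially"
    "\<And>x. 0 < x \<Longrightarrow> (\<lambda>n. real n * measure (distr M borel (H 1)) {z. a n * x \<le> \<bar>z\<bar>}) \<longlonglongrightarrow> x powr - \<alpha>"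
    using regularly_varying_tails_tail_limit[OF rv pD sets_distr \<alpha>(1)] by blast
  define U where "U n j \<omega> = (if j \<le> n then (\<bar>H j \<omega>\<bar> / a n) powr - \<alpha> else 0)" for n j \<omega>
  obtain K where K: "asymptotically_poisson M U \<beta> K"
    using asymptotically_poisson_sample[OF M H \<alpha> a] unfolding U_def[abs_def] \<beta>_def by blast
  define K' where "K' = max K (1 / (1 - 2 powr (1 - \<beta>)))"
  have MU: "asymptotically_poisson M U \<beta> K'" using K by (rule asymptotically_poisson_mono) (simp add: K'_def)
  have PU: "asymptotically_poisson P (\<lambda>_. \<Gamma>) \<beta> K'"
    using asymptotically_poisson_arrivals[OF P \<Gamma> \<beta>] by (rule asymptotically_poisson_mono) (simp add: K'_def)
  define W where "W \<omega> = \<Gamma> 1 \<omega> powr \<beta> * (\<Sum>j. \<Gamma> (Suc j) \<omega> powr - \<beta>)" for \<omega>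
  have W_eq: "(\<lambda>\<omega>. \<Gamma> 1 \<omega> powr (A / \<alpha>) * (\<Sum>j. \<Gamma> (Suc j) \<omega> powr (- A / \<alpha>))) = W"
    by (simp add: W_def \<beta>_def fun_eq_iff)
  have W: "W \<in> borel_measurable P"
  proof -
    have [measurable]: "\<Gamma> (Suc j) \<in> borel_measurable P" "\<Gamma> 1 \<in> borel_measurable P" for j
      using \<Gamma> by (auto simp: unit_poisson_arrival_times_def)
    show ?thesis unfolding W_def by measurable
  qed
  have W_ratio: "AE \<omega> in P. is_sum_max_ratio \<beta> (\<lambda>j. \<Gamma> j \<omega>) (W \<omega>)"
    unfolding W_def using \<beta> by (intro is_sum_max_ratio_arrivals[OF \<Gamma>]) simp
  define Z where "Z = sum_max_ratio d (truncated_sample H R L) A"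
  define Z' where "Z' = sum_max_ratio d (\<lambda>_. H) A"
  have Z: "Z n \<in> borel_measurable M" for n
    unfolding Z_def using d meas by (intro sum_max_ratio_measurable truncated_sample_measurable)
  have Z': "Z' n \<in> borel_measurable M" for n
    unfolding Z'_def using d meas(1) by (rule sum_max_ratio_measurable)
  have Z'_ratio: "AE \<omega> in M. is_sum_max_ratio \<beta> (\<lambda>j. U n j \<omega>) (Z' n \<omega>)" if "1 \<le> n" for n
    unfolding \<beta>_def U_def Z'_def using is_sum_max_ratio_sample[OF that \<alpha>(1) a(1)] by (intro always_eventually allI)
  have main: "(\<lambda>n. prob {\<omega>\<in>space M. Z' n \<omega> \<le> x}) \<longlonglongrightarrow> measure P {\<omega>\<in>space P. W \<omega> \<le> x}"
    if "isCont (\<lambda>x. measure P {\<omega>\<in>space P. W \<omega> \<le> x}) x" for x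
    by (rule cdf_convergence_of_asymptotically_poisson[OF MU PU Z' Z'_ratio W W_ratio that])
  have diff: "\<bar>prob {\<omega>\<in>space M. Z n \<omega> \<le> x} - prob {\<omega>\<in>space M. Z' n \<omega> \<le> x}\<bar>
      \<le> real n * prob {\<omega>\<in>space M. \<bar>H 1 \<omega>\<bar> > L n}" if n: "1 \<le> n" for n x
  proof -
    let ?E = "\<Union>i\<in>{1..n}. H i -` {z. L n < \<bar>z\<bar>} \<inter> space M"
    have Ei: "H i -` {z. L n < \<bar>z\<bar>} \<inter> space M \<in> events" if "i \<in> {1..n}" for i
      using meas(1)[of i] that by (intro measurable_sets[of "H i" M borel]) auto
    then have E: "?E \<in> events" by blast
    have "prob ?E \<le> (\<Sum>i\<in>{1..n}. prob (H i -` {z. L n < \<bar>z\<bar>} \<inter> space M))"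
      using Ei by (intro finite_measure_subadditive_finite) auto
    also have "\<dots> = (\<Sum>i\<in>{1..n}. prob {\<omega>\<in>space M. \<bar>H 1 \<omega>\<bar> > L n})"
    proof (rule sum.cong)
      fix i assume "i \<in> {1..n}"
      then have "prob (H i -` {z. L n < \<bar>z\<bar>} \<inter> space M) = prob (H 1 -` {z. L n < \<bar>z\<bar>} \<inter> space M)"
        using iid_prob[OF M H, of i "{z. L n < \<bar>z\<bar>}"] iid_prob[OF M H, of 1 "{z. L n < \<bar>z\<bar>}"] by simp
      also have "H 1 -` {z. L n < \<bar>z\<bar>} \<inter> space M = {\<omega>\<in>space M. \<bar>H 1 \<omega>\<bar> > L n}" by auto
      finally show "prob (H i -` {z. L n < \<bar>z\<bar>} \<inter> space M) = prob {\<omega>\<in>space M. \<bar>H 1 \<omega>\<bar> > L n}" .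
    qed simp
    finally have PE: "prob ?E \<le> real n * prob {\<omega>\<in>space M. \<bar>H 1 \<omega>\<bar> > L n}" by simp
    \<comment> \<open>Both ratios use the same \<open>d\<close>, so they agree also where the
      denominator is 0.\<close>
    have eq: "Z n \<omega> = Z' n \<omega>" if "\<omega> \<in> space M" "\<omega> \<notin> ?E" for \<omega>
    proof -
      have X: "truncated_sample H R L n i \<omega> = H i \<omega>" if "i \<in> {1..n}" for i
        using \<open>\<omega> \<notin> ?E\<close> \<open>\<omega> \<in> space M\<close> that L[OF n] by (intro truncated_sample_eq) (auto simp: not_less)
      have "(\<lambda>i. \<bar>truncated_sample H R L n i \<omega>\<bar> powr A) ` {1..n} = (\<lambda>i. \<bar>H i \<omega>\<bar> powr A) ` {1..n}"
        by (intro image_cong) (simp_all only: X)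
      moreover have "(\<Sum>i=1..n. \<bar>truncated_sample H R L n i \<omega>\<bar> powr A) = (\<Sum>i=1..n. \<bar>H i \<omega>\<bar> powr A)"
        by (intro sum.cong) (simp_all only: X)
      ultimately show ?thesis unfolding Z_def Z'_def sum_max_ratio_def by (simp only:)
    qed
    have s: "{\<omega>\<in>space M. Z n \<omega> \<le> x} \<in> events" "{\<omega>\<in>space M. Z' n \<omega> \<le> x} \<in> events"
      using Z[of n] Z'[of n] by measurable
    have "prob {\<omega>\<in>space M. Z n \<omega> \<le> x} \<le> prob ({\<omega>\<in>space M. Z' n \<omega> \<le> x} \<union> ?E)"
      using eq s E by (intro finite_measure_mono) auto
    also have "\<dots> \<le> prob {\<omega>\<in>space M. Z' n \<omega> \<le> x} + prob ?E" using s E by (intro measure_Un_le)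
    finally have 1: "prob {\<omega>\<in>space M. Z n \<omega> \<le> x} \<le> prob {\<omega>\<in>space M. Z' n \<omega> \<le> x} + prob ?E" .
    have "prob {\<omega>\<in>space M. Z' n \<omega> \<le> x} \<le> prob ({\<omega>\<in>space M. Z n \<omega> \<le> x} \<union> ?E)"
      using eq s E by (intro finite_measure_mono) auto
    also have "\<dots> \<le> prob {\<omega>\<in>space M. Z n \<omega> \<le> x} + prob ?E" using s E by (intro measure_Un_le)
    finally show ?thesis using 1 PE by linarith
  qed
  show ?thesis
    unfolding weak_conv_m_def weak_conv_def W_eq Z_def[symmetric]
  proof (intro allI impI)
    fix x assume cont: "isCont (cdf (distr P borel W)) x"
    have "cdf (distr P borel W) = (\<lambda>x. measure P {\<omega>\<in>space P. W \<omega> \<le> x})"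
      by (intro ext cdf_distr W)
    with cont have "isCont (\<lambda>x. measure P {\<omega>\<in>space P. W \<omega> \<le> x}) x" by (simp only:)
    note main[OF this]
    moreover have "(\<lambda>n. prob {\<omega>\<in>space M. Z n \<omega> \<le> x} - prob {\<omega>\<in>space M. Z' n \<omega> \<le> x}) \<longlonglongrightarrow> 0"
    proof (rule Lim_null_comparison[OF _ soft])
      show "\<forall>\<^sub>F n in sequentially. norm (prob {\<omega>\<in>space M. Z n \<omega> \<le> x} - prob {\<omega>\<in>space M. Z' n \<omega> \<le> x})
          \<le> real n * prob {\<omega>\<in>space M. \<bar>H 1 \<omega>\<bar> > L n}"
        using eventually_ge_at_top[of "1::nat"]
        by eventually_elim (simp only: real_norm_def diff)
    qed
    ultimately show "(\<lambda>n. cdf (distr M borel (Z n)) x) \<longlonglongrightarrow> cdf (distr P borel W) x"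
      unfolding cdf_distr[OF Z] cdf_distr[OF W] by (rule Lim_transform)
  qed
qed

section \<open>Hard truncation\<close>

text \<open>Two factors on each side make this serve for first moments, with a constant factor 1,
  and for second moments, with \<open>i = j\<close> or not. Boundedness provides
  integrability.\<close>

lemma (in prob_space) expectation_indep_sequences:
  fixes f f' g g' :: "real \<Rightarrow> real"
  assumes ind: "indep_sequences M {1..} H R"
    and H: "\<And>j. 1 \<le> j \<Longrightarrow> H j \<in> borel_measurable M" and R: "\<And>j. 1 \<le> j \<Longrightarrow> R j \<in> borel_measurable M"
    and [measurable]: "f \<in> borel_measurable borel" "f' \<in> borel_measurable borel"
      "g \<in> borel_measurable borel" "g' \<in> borel_measurable borel"
    and bd: "\<And>x. \<bar>f x\<bar> \<le> b" "\<And>x. \<bar>f' x\<bar> \<le> b" "\<And>x. \<bar>g x\<bar> \<le> b" "\<And>x. \<bar>g' x\<bar> \<le> b"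
    and ij: "1 \<le> i" "1 \<le> j"
  shows "expectation (\<lambda>\<omega>. (f (H i \<omega>) * f' (H j \<omega>)) * (g (R i \<omega>) * g' (R j \<omega>))) =
    expectation (\<lambda>\<omega>. f (H i \<omega>) * f' (H j \<omega>)) * expectation (\<lambda>\<omega>. g (R i \<omega>) * g' (R j \<omega>))"
proof -
  have [measurable]: "H i \<in> borel_measurable M" "H j \<in> borel_measurable M" "R i \<in> borel_measurable M" "R j \<in> borel_measurable M"
    using H R ij by auto
  let ?F = "\<lambda>x :: nat \<Rightarrow> real. f (x i) * f' (x j)" and ?G = "\<lambda>x :: nat \<Rightarrow> real. g (x i) * g' (x j)"
  have c: "(\<lambda>x. x k) \<in> borel_measurable (Pi\<^sub>M {1..} (\<lambda>_. borel :: real measure))" if "1 \<le> k" for k :: nat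
    using that by (intro measurable_component_singleton) simp
  have "?F \<in> borel_measurable (Pi\<^sub>M {1..} (\<lambda>_. borel))" "?G \<in> borel_measurable (Pi\<^sub>M {1..} (\<lambda>_. borel))"
    using c[OF ij(1)] c[OF ij(2)] by measurable
  from indep_var_compose[OF ind[unfolded indep_sequences_def] this]
  have "indep_var borel (\<lambda>\<omega>. f (H i \<omega>) * f' (H j \<omega>)) borel (\<lambda>\<omega>. g (R i \<omega>) * g' (R j \<omega>))"
    using ij by (simp add: comp_def)
  moreover have prod_bd: "\<bar>p * q\<bar> \<le> b * b" if "\<bar>p\<bar> \<le> b" "\<bar>q\<bar> \<le> b" for p q :: real
    using that unfolding abs_mult by (intro mult_mono) auto
  have "integrable M (\<lambda>\<omega>. f (H i \<omega>) * f' (H j \<omega>))" "integrable M (\<lambda>\<omega>. g (R i \<omega>) * g' (R j \<omega>))"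
    by (rule integrable_const_bound[of _ "b * b"]; use prod_bd bd in \<open>simp\<close>)+
  ultimately show ?thesis by (rule indep_var_lebesgue_integral)
qed

lemma (in prob_space) expectation_iid:
  fixes f :: "real \<Rightarrow> real"
  assumes X: "iid M {1..} X" and i: "1 \<le> i" and [measurable]: "f \<in> borel_measurable borel"
  shows "expectation (\<lambda>\<omega>. f (X i \<omega>)) = expectation (\<lambda>\<omega>. f (X 1 \<omega>))"
proof -
  have [measurable]: "X i \<in> borel_measurable M" "X 1 \<in> borel_measurable M"
    using iid_measurable[OF prob_space_axioms X] i by auto
  have "expectation (\<lambda>\<omega>. f (X i \<omega>)) = integral\<^sup>L (distr M borel (X i)) f" by (simp add: integral_distr)
  also have "\<dots> = integral\<^sup>L (distr M borel (X 1)) f" by (simp only: iid_distr[OF X i])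
  also have "\<dots> = expectation (\<lambda>\<omega>. f (X 1 \<omega>))" by (rule integral_distr) measurable
  finally show ?thesis .
qed

lemma (in prob_space) expectation_iid_product:
  fixes f :: "real \<Rightarrow> real"
  assumes X: "iid M {1..} X" and ij: "1 \<le> i" "1 \<le> j" "i \<noteq> j" and f[measurable]: "f \<in> borel_measurable borel"
    and bd: "\<And>x. \<bar>f x\<bar> \<le> b"
  shows "expectation (\<lambda>\<omega>. f (X i \<omega>) * f (X j \<omega>)) = (expectation (\<lambda>\<omega>. f (X 1 \<omega>)))\<^sup>2"
proof -
  have X_meas: "X k \<in> borel_measurable M" if "1 \<le> k" for k
    using iid_measurable[OF prob_space_axioms X that] .
  have "indep_vars (\<lambda>_. borel) X {1..}" using X by (simp only: iid_def)
  then have "indep_vars (\<lambda>_. borel) X {i, j}" by (rule indep_vars_subset) (use ij in auto)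
  then have "indep_vars (\<lambda>_. borel) (\<lambda>k \<omega>. f (X k \<omega>)) {i, j}" by (rule indep_vars_compose2) (rule f)
  then have "expectation (\<lambda>\<omega>. \<Prod>k\<in>{i, j}. f (X k \<omega>)) = (\<Prod>k\<in>{i, j}. expectation (\<lambda>\<omega>. f (X k \<omega>)))"
  proof (intro indep_vars_lebesgue_integral)
    fix k assume "k \<in> {i, j}"
    then have [measurable]: "X k \<in> borel_measurable M" using X_meas ij by auto
    show "integrable M (\<lambda>\<omega>. f (X k \<omega>))" by (rule integrable_const_bound[of _ b]) (use bd in auto)
  qed simp_all
  moreover have "expectation (\<lambda>\<omega>. f (X k \<omega>)) = expectation (\<lambda>\<omega>. f (X 1 \<omega>))" if "k \<in> {i, j}" for k
    using that ij by (intro expectation_iid[OF X _ f]) auto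
  ultimately show ?thesis using ij(3) by (simp add: power2_eq_square)
qed

text \<open>Dominated convergence: where \<open>c * x n < Y\<close>, a positive \<open>x n\<close>
  is below \<open>\<bar>Y\<bar> / c\<close>, and at each point the indicator vanishes once
  \<open>x n\<close> has passed \<open>Y / c\<close>.\<close>

lemma tail_times_tendsto_0:
  fixes Y :: "'a \<Rightarrow> real"
  assumes Y: "integrable M Y" "finite_measure M" and x: "filterlim x at_top sequentially" and c: "0 < c"
  shows "(\<lambda>n. x n * measure M {\<omega>\<in>space M. c * x n < Y \<omega>}) \<longlonglongrightarrow> 0"
proof -
  interpret finite_measure M by fact
  have [measurable]: "Y \<in> borel_measurable M" using Y(1) by simp
  \<comment> \<open>The condition \<open>0 < x n\<close> inside the event makes the domination valid
    for every n, also while \<open>x n\<close> is still negative.\<close>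
  have "(\<lambda>n. \<integral>\<omega>. x n * indicator {\<omega>\<in>space M. 0 < x n \<and> c * x n < Y \<omega>} \<omega> \<partial>M) \<longlonglongrightarrow> (\<integral>\<omega>. 0 \<partial>M)"
  proof (rule integral_dominated_convergence[where w = "\<lambda>\<omega>. \<bar>Y \<omega>\<bar> / c"])
    show "integrable M (\<lambda>\<omega>. \<bar>Y \<omega>\<bar> / c)" using Y(1) by (intro integrable_divide integrable_abs)
    show "AE \<omega> in M. (\<lambda>n. x n * indicator {\<omega>\<in>space M. 0 < x n \<and> c * x n < Y \<omega>} \<omega>) \<longlonglongrightarrow> 0"
    proof (rule AE_I2)
      fix \<omega>
      have "\<forall>\<^sub>F n in sequentially. Y \<omega> / c \<le> x n" using x unfolding filterlim_at_top by blast
      then have "\<forall>\<^sub>F n in sequentially. x n * indicator {\<omega>\<in>space M. 0 < x n \<and> c * x n < Y \<omega>} \<omega> = 0"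
        by eventually_elim (use c in \<open>simp add: field_simps\<close>)
      then show "(\<lambda>n. x n * indicator {\<omega>\<in>space M. 0 < x n \<and> c * x n < Y \<omega>} \<omega>) \<longlonglongrightarrow> 0"
        by (rule tendsto_eventually)
    qed
    show "AE \<omega> in M. norm (x n * indicator {\<omega>\<in>space M. 0 < x n \<and> c * x n < Y \<omega>} \<omega>) \<le> \<bar>Y \<omega>\<bar> / c" for n
      using c by (intro AE_I2) (auto simp: indicator_def field_simps)
  qed auto
  then have lim: "(\<lambda>n. x n * measure M {\<omega>\<in>space M. 0 < x n \<and> c * x n < Y \<omega>}) \<longlonglongrightarrow> 0"
    by (simp add: Int_def conj_ac cong: conj_cong)
  have "\<forall>\<^sub>F n in sequentially. 0 < x n" using x by (simp add: filterlim_at_top_dense)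
  then have "\<forall>\<^sub>F n in sequentially. x n * measure M {\<omega>\<in>space M. 0 < x n \<and> c * x n < Y \<omega>} =
      x n * measure M {\<omega>\<in>space M. c * x n < Y \<omega>}"
    by eventually_elim simp
  with lim show ?thesis by (rule Lim_transform_eventually)
qed

lemma (in prob_space) expectation_indicator_comp:
  "expectation (\<lambda>\<omega>. indicator A (X \<omega>)) = prob {\<omega>\<in>space M. X \<omega> \<in> A}"
proof -
  have "expectation (\<lambda>\<omega>. indicat_real A (X \<omega>)) = expectation (indicator {\<omega>\<in>space M. X \<omega> \<in> A})"
    by (intro Bochner_Integration.integral_cong) (auto simp: indicator_def)
  then show ?thesis by (simp add: Int_absorb2 subset_eq)
qed

text \<open>Chebyshev's inequality asks for a second moment, which \<open>R 1 powr A\<close> may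
  lack. The cap at 1 provides it: since the capped variable dominates its square, the second moment
  of g is at most the square of its mean times \<open>max 1 (1 / m)\<close>. This constant does not
  depend on l, as it must not when the truncation level varies with n.\<close>

lemma (in prob_space) exceedance_sum_lower_tail:
  fixes H R :: "nat \<Rightarrow> 'a \<Rightarrow> real" and l A :: real
  defines "g \<equiv> \<lambda>r. l powr A + min (r powr A) 1" and "B \<equiv> indicator {h. l < \<bar>h\<bar>} :: real \<Rightarrow> real"
  defines "m \<equiv> expectation (\<lambda>\<omega>. min (R 1 \<omega> powr A) 1)" and "p \<equiv> prob {\<omega>\<in>space M. l < \<bar>H 1 \<omega>\<bar>}"
  assumes H: "iid M {1..} H" and R: "iid M {1..} R" and ind: "indep_sequences M {1..} H R"
    and pos: "0 < l" "0 < real n * p"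
  shows "prob {\<omega>\<in>space M. (\<Sum>i=1..n. B (H i \<omega>) * g (R i \<omega>)) \<le> real n * p * (l powr A + m) / 2}
    \<le> 4 * max 1 (1 / m) / (real n * p)"
proof -
  have H_meas: "H j \<in> borel_measurable M" and R_meas: "R j \<in> borel_measurable M" if "1 \<le> j" for j
    using iid_measurable[OF prob_space_axioms H that] iid_measurable[OF prob_space_axioms R that] .
  have B_meas[measurable]: "B \<in> borel_measurable borel" unfolding B_def by measurable
  have g_meas[measurable]: "g \<in> borel_measurable borel" unfolding g_def by measurable
  define a where "a = l powr A"
  have a: "0 < a" using pos by (simp add: a_def)
  have g_bd: "\<bar>g r\<bar> \<le> a + 1" for r using a by (simp add: g_def a_def abs_le_iff)
  have B_bd: "\<bar>B h\<bar> \<le> a + 1" for h using a by (simp add: B_def indicator_def)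
  have one_bd: "\<bar>1::real\<bar> \<le> a + 1" using a by simp
  have m0: "0 \<le> m" unfolding m_def by (intro Bochner_Integration.integral_nonneg) simp
  note [measurable] = R_meas[OF order_refl] H_meas[OF order_refl]
  have int_min: "integrable M (\<lambda>\<omega>. min (R 1 \<omega> powr A) 1)" by (rule integrable_const_bound[of _ 1]) (simp, measurable)
  have EB: "expectation (\<lambda>\<omega>. B (H 1 \<omega>)) = p"
    by (simp only: B_def p_def expectation_indicator_comp mem_Collect_eq)
  have Eg: "expectation (\<lambda>\<omega>. g (R 1 \<omega>)) = a + m"
    unfolding g_def m_def a_def using int_min by (subst Bochner_Integration.integral_add) (auto simp: prob_space)
  define v where "v = expectation (\<lambda>\<omega>. g (R 1 \<omega>) * g (R 1 \<omega>))"
  \<comment> \<open>for \<open>m = 0\<close> this is \<open>1\<close>, since \<open>1 / 0 = 0\<close>\<close>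
  define \<kappa> where "\<kappa> = max 1 (1 / m)"
  have v: "v \<le> \<kappa> * (a + m)\<^sup>2"
  proof -
    have "v \<le> expectation (\<lambda>\<omega>. a\<^sup>2 + (2 * a + 1) * min (R 1 \<omega> powr A) 1)"
      unfolding v_def
    proof (rule integral_mono)
      show "integrable M (\<lambda>\<omega>. g (R 1 \<omega>) * g (R 1 \<omega>))"
      proof (rule integrable_const_bound[of _ "(a + 1) * (a + 1)"])
        have "\<bar>g r * g r\<bar> \<le> (a + 1) * (a + 1)" for r
          unfolding abs_mult using a by (intro mult_mono g_bd) auto
        then show "AE \<omega> in M. norm (g (R 1 \<omega>) * g (R 1 \<omega>)) \<le> (a + 1) * (a + 1)"
          by (intro AE_I2) (simp only: real_norm_def)
      qed measurable
      show "integrable M (\<lambda>\<omega>. a\<^sup>2 + (2 * a + 1) * min (R 1 \<omega> powr A) 1)"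
        using int_min by simp
      fix \<omega>
      define y where "y = min (R 1 \<omega> powr A) 1"
      have y: "0 \<le> y" "y \<le> 1" by (auto simp: y_def)
      have "y * y \<le> y" using mult_left_mono[OF y(2) y(1)] by simp
      then show "g (R 1 \<omega>) * g (R 1 \<omega>) \<le> a\<^sup>2 + (2 * a + 1) * min (R 1 \<omega> powr A) 1"
        unfolding g_def a_def[symmetric] y_def[symmetric] by (simp add: algebra_simps power2_eq_square)
    qed
    also have "\<dots> = a\<^sup>2 + (2 * a + 1) * m"
      unfolding m_def using int_min by (subst Bochner_Integration.integral_add) (auto simp: prob_space)
    also have "\<dots> \<le> \<kappa> * (a + m)\<^sup>2"
    proof -
      have "m \<le> \<kappa> * m\<^sup>2"
      proof (cases "m = 0")
        case False
        then have "m = (1 / m) * m\<^sup>2" by (simp add: power2_eq_square)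
        also have "\<dots> \<le> \<kappa> * m\<^sup>2" by (intro mult_right_mono) (auto simp: \<kappa>_def)
        finally show ?thesis .
      qed simp
      moreover have "1 * (a\<^sup>2 + 2 * a * m) \<le> \<kappa> * (a\<^sup>2 + 2 * a * m)"
        using a m0 by (intro mult_right_mono) (auto simp: \<kappa>_def)
      ultimately show ?thesis by (simp add: power2_eq_square algebra_simps)
    qed
    finally show ?thesis .
  qed
  define Y where "Y i \<omega> = B (H i \<omega>) * g (R i \<omega>)" for i \<omega>
  have Y_meas: "Y i \<in> borel_measurable M" if "1 \<le> i" for i
  proof -
    have [measurable]: "H i \<in> borel_measurable M" "R i \<in> borel_measurable M" using H_meas R_meas that by auto
    show ?thesis unfolding Y_def by measurable
  qed
  have Y_bd: "\<bar>Y i \<omega>\<bar> \<le> (a + 1) * (a + 1)" for i \<omega>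
    unfolding Y_def abs_mult using g_bd B_bd a by (intro mult_mono) auto
  have Y_int: "integrable M (Y i)" if "1 \<le> i" for i
    by (rule integrable_const_bound[of _ "(a + 1) * (a + 1)"]) (use Y_bd Y_meas that in auto)
  have YY_int: "integrable M (\<lambda>\<omega>. Y i \<omega> * Y j \<omega>)" if "1 \<le> i" "1 \<le> j" for i j
  proof (rule integrable_const_bound[of _ "((a + 1) * (a + 1)) * ((a + 1) * (a + 1))"])
    have "\<bar>Y i \<omega> * Y j \<omega>\<bar> \<le> ((a + 1) * (a + 1)) * ((a + 1) * (a + 1))" for \<omega>
      unfolding abs_mult using a by (intro mult_mono Y_bd) auto
    then show "AE \<omega> in M. norm (Y i \<omega> * Y j \<omega>) \<le> ((a + 1) * (a + 1)) * ((a + 1) * (a + 1))" by simp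
    show "(\<lambda>\<omega>. Y i \<omega> * Y j \<omega>) \<in> borel_measurable M"
      using Y_meas[OF that(1)] Y_meas[OF that(2)] by (rule borel_measurable_times)
  qed
  have EY: "expectation (Y i) = p * (a + m)" if "1 \<le> i" for i
  proof -
    have "expectation (\<lambda>\<omega>. (B (H i \<omega>) * 1) * (g (R i \<omega>) * 1)) =
        expectation (\<lambda>\<omega>. B (H i \<omega>) * 1) * expectation (\<lambda>\<omega>. g (R i \<omega>) * 1)"
      by (rule expectation_indep_sequences[OF ind H_meas R_meas B_meas borel_measurable_const g_meas borel_measurable_const
          B_bd one_bd g_bd one_bd that that])
    also have "\<dots> = expectation (\<lambda>\<omega>. B (H i \<omega>)) * expectation (\<lambda>\<omega>. g (R i \<omega>))" by (simp only: mult_1_right)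
    also have "\<dots> = p * (a + m)"
      by (simp only: expectation_iid[OF H that B_meas] expectation_iid[OF R that g_meas] EB Eg)
    finally show ?thesis by (simp add: Y_def[abs_def])
  qed
  \<comment> \<open>On the diagonal the indicator equals its square, which leaves a single factor p;
    off the diagonal the two indices are independent.\<close>
  have EYY: "expectation (\<lambda>\<omega>. Y i \<omega> * Y j \<omega>) = (if i = j then p * v else (p * (a + m))\<^sup>2)"
    if ij: "1 \<le> i" "1 \<le> j" for i j
  proof -
    have "expectation (\<lambda>\<omega>. Y i \<omega> * Y j \<omega>) = expectation (\<lambda>\<omega>. (B (H i \<omega>) * B (H j \<omega>)) * (g (R i \<omega>) * g (R j \<omega>)))"
      by (simp only: Y_def mult_ac)
    also have "\<dots> = expectation (\<lambda>\<omega>. B (H i \<omega>) * B (H j \<omega>)) * expectation (\<lambda>\<omega>. g (R i \<omega>) * g (R j \<omega>))"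
      by (rule expectation_indep_sequences[OF ind H_meas R_meas B_meas B_meas g_meas g_meas B_bd B_bd g_bd g_bd ij])
    also have "\<dots> = (if i = j then p * v else (p * (a + m))\<^sup>2)"
    proof (cases "i = j")
      case True
      have "expectation (\<lambda>\<omega>. B (H i \<omega>) * B (H j \<omega>)) = expectation (\<lambda>\<omega>. B (H i \<omega>))"
        unfolding True by (intro Bochner_Integration.integral_cong) (auto simp: B_def indicator_def)
      moreover have "expectation (\<lambda>\<omega>. g (R i \<omega>) * g (R j \<omega>)) = v"
        unfolding True v_def by (rule expectation_iid[OF R ij(2), of "\<lambda>r. g r * g r"]) measurable
      ultimately show ?thesis using True by (simp only: expectation_iid[OF H ij(2) B_meas] EB if_True simp_thms)
    next
      case False
      then show ?thesis
        by (simp only: expectation_iid_product[OF H ij False B_meas B_bd] expectation_iid_product[OF R ij False g_meas g_bd]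
            EB Eg power_mult_distrib if_False)
    qed
    finally show ?thesis .
  qed
  define S where "S \<omega> = (\<Sum>i=1..n. Y i \<omega>)" for \<omega>
  define \<mu> where "\<mu> = real n * (p * (a + m))"
  have S_meas[measurable]: "S \<in> borel_measurable M"
    unfolding S_def[abs_def] using Y_meas by (intro borel_measurable_sum) auto
  have ES: "expectation S = \<mu>"
    unfolding S_def[abs_def] using Y_int EY by (subst Bochner_Integration.integral_sum) (auto simp: \<mu>_def)
  have SS: "(S \<omega>)\<^sup>2 = (\<Sum>i=1..n. \<Sum>j=1..n. Y i \<omega> * Y j \<omega>)" for \<omega>
    by (simp add: S_def power2_eq_square sum_product)
  have SS_int: "integrable M (\<lambda>\<omega>. (S \<omega>)\<^sup>2)"
    unfolding SS using YY_int by (intro Bochner_Integration.integrable_sum) auto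
  have S_int: "integrable M S"
    unfolding S_def[abs_def] using Y_int by (intro Bochner_Integration.integrable_sum) auto
  have ESS: "expectation (\<lambda>\<omega>. (S \<omega>)\<^sup>2) = real n * (p * v) + (real n * real n - real n) * (p * (a + m))\<^sup>2"
  proof -
    have "expectation (\<lambda>\<omega>. (S \<omega>)\<^sup>2) = (\<Sum>i=1..n. expectation (\<lambda>\<omega>. \<Sum>j=1..n. Y i \<omega> * Y j \<omega>))"
      unfolding SS using YY_int
      by (intro Bochner_Integration.integral_sum Bochner_Integration.integrable_sum) auto
    also have "\<dots> = (\<Sum>i=1..n. \<Sum>j=1..n. expectation (\<lambda>\<omega>. Y i \<omega> * Y j \<omega>))"
      using YY_int by (intro sum.cong Bochner_Integration.integral_sum) auto
    also have "\<dots> = (\<Sum>i=1..n. \<Sum>j=1..n. (p * (a + m))\<^sup>2 + (if i = j then p * v - (p * (a + m))\<^sup>2 else 0))"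
      by (intro sum.cong) (auto simp: EYY)
    also have "\<dots> = (\<Sum>i=1..n. real n * (p * (a + m))\<^sup>2 + (p * v - (p * (a + m))\<^sup>2))"
      by (intro sum.cong) (auto simp: sum.distrib sum.delta)
    also have "\<dots> = real n * (p * v) + (real n * real n - real n) * (p * (a + m))\<^sup>2"
      by (simp add: algebra_simps)
    finally show ?thesis .
  qed
  have p: "0 < p" "0 < real n" using pos(2) measure_nonneg[of M] by (auto simp: zero_less_mult_iff p_def)
  have \<mu>: "0 < \<mu>" using p a m0 by (simp add: \<mu>_def)
  have "variance S = real n * (p * v) + (real n * real n - real n) * (p * (a + m))\<^sup>2 - \<mu>\<^sup>2"
    using variance_eq[OF S_int SS_int] by (simp only: ESS ES)
  also have "\<dots> = real n * (p * v) - real n * (p * (a + m))\<^sup>2"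
    by (simp add: \<mu>_def power2_eq_square algebra_simps)
  also have "\<dots> \<le> real n * (p * v)" by simp
  also have "\<dots> \<le> real n * (p * (\<kappa> * (a + m)\<^sup>2))" using v p by (intro mult_left_mono) auto
  finally have var: "variance S \<le> real n * (p * (\<kappa> * (a + m)\<^sup>2))" .
  have "prob {\<omega>\<in>space M. S \<omega> \<le> real n * p * (a + m) / 2} \<le> prob {\<omega>\<in>space M. \<mu> / 2 \<le> \<bar>S \<omega> - expectation S\<bar>}"
  proof (rule finite_measure_mono)
    show "{\<omega>\<in>space M. S \<omega> \<le> real n * p * (a + m) / 2} \<subseteq> {\<omega>\<in>space M. \<mu> / 2 \<le> \<bar>S \<omega> - expectation S\<bar>}"
    proof
      fix \<omega> assume "\<omega> \<in> {\<omega>\<in>space M. S \<omega> \<le> real n * p * (a + m) / 2}"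
      then have "\<omega> \<in> space M" "S \<omega> \<le> \<mu> / 2" by (auto simp: \<mu>_def mult.assoc)
      moreover have "\<mu> / 2 \<le> \<bar>S \<omega> - \<mu>\<bar>" using \<open>S \<omega> \<le> \<mu> / 2\<close> by linarith
      ultimately show "\<omega> \<in> {\<omega>\<in>space M. \<mu> / 2 \<le> \<bar>S \<omega> - expectation S\<bar>}" by (simp only: ES mem_Collect_eq simp_thms)
    qed
  qed measurable
  \<comment> \<open>A deviation by half the mean is the origin of the factor 4 in the bound.\<close>
  also have "\<dots> \<le> variance S / (\<mu> / 2)\<^sup>2" using \<mu> by (intro Chebyshev_inequality SS_int S_meas) simp
  also have "\<dots> \<le> (real n * (p * (\<kappa> * (a + m)\<^sup>2))) / (\<mu> / 2)\<^sup>2"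
    using var by (rule divide_right_mono) simp
  also have "\<dots> = 4 * \<kappa> / (real n * p)"
  proof -
    have "real n * (p * (\<kappa> * z\<^sup>2)) / (real n * (p * z) / 2)\<^sup>2 = 4 * \<kappa> / (real n * p)" if "z \<noteq> 0" for z :: real
      using p that by (simp add: power2_eq_square field_simps)
    from this[of "a + m"] show ?thesis using a m0 unfolding \<mu>_def by simp
  qed
  finally show ?thesis unfolding S_def Y_def \<kappa>_def a_def .
qed

text \<open>A residual matters only if \<open>\<bar>H i\<bar>\<close> exceeds l, and independence
  turns this into an extra factor p. That factor is essential: c will be of order
  \<open>n * p\<close>, and integrability makes the tail of \<open>R 1 powr A\<close> at c small
  against \<open>1 / (n * p)\<close>, not against \<open>1 / n\<close>.\<close>

lemma (in prob_space) exceedance_residual_bound: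
  fixes H R :: "nat \<Rightarrow> 'a \<Rightarrow> real"
  assumes H: "iid M {1..} H" and R: "iid M {1..} R" and ind: "indep_sequences M {1..} H R"
  shows "prob (\<Union>i\<in>{1..n}. {\<omega>\<in>space M. l < \<bar>H i \<omega>\<bar> \<and> c < R i \<omega> powr A})
    \<le> real n * prob {\<omega>\<in>space M. l < \<bar>H 1 \<omega>\<bar>} * prob {\<omega>\<in>space M. c < R 1 \<omega> powr A}"
proof -
  have H_meas: "H j \<in> borel_measurable M" and R_meas: "R j \<in> borel_measurable M" if "1 \<le> j" for j
    using iid_measurable[OF prob_space_axioms H that] iid_measurable[OF prob_space_axioms R that] .
  define f where "f = (indicator {h. l < \<bar>h\<bar>} :: real \<Rightarrow> real)"
  define g where "g = (indicator {r. c < r powr A} :: real \<Rightarrow> real)"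
  have f_meas[measurable]: "f \<in> borel_measurable borel" unfolding f_def by measurable
  have g_meas[measurable]: "g \<in> borel_measurable borel" unfolding g_def by measurable
  have bd: "\<bar>f x\<bar> \<le> 1" "\<bar>g x\<bar> \<le> 1" "\<bar>1::real\<bar> \<le> 1" for x by (auto simp: f_def g_def indicator_def)
  have Ef: "expectation (\<lambda>\<omega>. f (H 1 \<omega>)) = prob {\<omega>\<in>space M. l < \<bar>H 1 \<omega>\<bar>}"
    and Eg: "expectation (\<lambda>\<omega>. g (R 1 \<omega>)) = prob {\<omega>\<in>space M. c < R 1 \<omega> powr A}"
    by (simp_all only: f_def g_def expectation_indicator_comp mem_Collect_eq)
  have one: "prob {\<omega>\<in>space M. l < \<bar>H i \<omega>\<bar> \<and> c < R i \<omega> powr A} =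
      prob {\<omega>\<in>space M. l < \<bar>H 1 \<omega>\<bar>} * prob {\<omega>\<in>space M. c < R 1 \<omega> powr A}"
    and ev: "{\<omega>\<in>space M. l < \<bar>H i \<omega>\<bar> \<and> c < R i \<omega> powr A} \<in> events" if i: "i \<in> {1..n}" for i
  proof -
    have i1: "1 \<le> i" using i by simp
    have [measurable]: "H i \<in> borel_measurable M" "R i \<in> borel_measurable M" using H_meas[OF i1] R_meas[OF i1] .
    show "{\<omega>\<in>space M. l < \<bar>H i \<omega>\<bar> \<and> c < R i \<omega> powr A} \<in> events" by measurable
    have "prob {\<omega>\<in>space M. l < \<bar>H i \<omega>\<bar> \<and> c < R i \<omega> powr A} =
        expectation (indicator {\<omega>\<in>space M. l < \<bar>H i \<omega>\<bar> \<and> c < R i \<omega> powr A})"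
      by (simp add: Int_absorb2 subset_eq)
    also have "\<dots> = expectation (\<lambda>\<omega>. (f (H i \<omega>) * 1) * (g (R i \<omega>) * 1))"
      by (intro Bochner_Integration.integral_cong) (auto simp: f_def g_def indicator_def)
    also have "\<dots> = expectation (\<lambda>\<omega>. f (H i \<omega>) * 1) * expectation (\<lambda>\<omega>. g (R i \<omega>) * 1)"
      by (rule expectation_indep_sequences[OF ind H_meas R_meas f_meas borel_measurable_const g_meas borel_measurable_const
          bd(1) bd(3) bd(2) bd(3) i1 i1])
    also have "\<dots> = expectation (\<lambda>\<omega>. f (H i \<omega>)) * expectation (\<lambda>\<omega>. g (R i \<omega>))" by (simp only: mult_1_right)
    finally show "prob {\<omega>\<in>space M. l < \<bar>H i \<omega>\<bar> \<and> c < R i \<omega> powr A} =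
      prob {\<omega>\<in>space M. l < \<bar>H 1 \<omega>\<bar>} * prob {\<omega>\<in>space M. c < R 1 \<omega> powr A}"
      by (simp only: expectation_iid[OF H i1 f_meas] expectation_iid[OF R i1 g_meas] Ef Eg)
  qed
  have "prob (\<Union>i\<in>{1..n}. {\<omega>\<in>space M. l < \<bar>H i \<omega>\<bar> \<and> c < R i \<omega> powr A})
    \<le> (\<Sum>i\<in>{1..n}. prob {\<omega>\<in>space M. l < \<bar>H i \<omega>\<bar> \<and> c < R i \<omega> powr A})"
    using ev by (intro finite_measure_subadditive_finite) auto
  also have "\<dots> = real n * prob {\<omega>\<in>space M. l < \<bar>H 1 \<omega>\<bar>} * prob {\<omega>\<in>space M. c < R 1 \<omega> powr A}"
    using one by (simp only: sum_constant cong: sum.cong) simp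
  finally show ?thesis .
qed

text \<open>With \<open>\<mu> = x * (L n powr A + m)\<close> the sum exceeds
  \<open>\<mu> / 4\<close> and each term is at most \<open>\<delta> * \<mu>\<close>. The factors
  \<open>2 powr A\<close> in the hypotheses come from bounding \<open>L n + R i\<close> by twice the
  larger summand.\<close>

lemma truncated_ratio_lower_bound:
  fixes H R :: "nat \<Rightarrow> 'a \<Rightarrow> real"
  assumes A: "0 < A" and l: "0 < L n" and R: "\<And>i. i \<in> {1..n} \<Longrightarrow> 0 \<le> R i \<omega>"
    and m: "0 \<le> m" and x: "2 powr A \<le> \<delta> * x" and \<delta>: "0 < \<delta>"
    and S: "x * (L n powr A + m) / 2 < (\<Sum>i=1..n. indicator {h. L n < \<bar>h\<bar>} (H i \<omega>) * (L n powr A + min (R i \<omega> powr A) 1))"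
    and Big: "\<And>i. i \<in> {1..n} \<Longrightarrow> L n < \<bar>H i \<omega>\<bar> \<Longrightarrow> 2 powr A * R i \<omega> powr A \<le> \<delta> * x * m"
  shows "1 / (4 * \<delta>) < sum_max_ratio d (truncated_sample H R L) A n \<omega>"
proof -
  define X where "X i = truncated_sample H R L n i \<omega>" for i
  define \<mu> where "\<mu> = x * (L n powr A + m)"
  have x0: "0 < x" using x \<delta> by (metis less_le_trans powr_gt_zero zero_less_mult_pos zero_less_numeral less_numeral_extra(3))
  have La: "0 < L n powr A" using l by simp
  have \<mu>: "0 < \<mu>" unfolding \<mu>_def by (intro mult_pos_pos add_pos_nonneg x0 La m)
  have abs_X: "\<bar>X i\<bar> = (if L n < \<bar>H i \<omega>\<bar> then L n + R i \<omega> else \<bar>H i \<omega>\<bar>)" if "i \<in> {1..n}" for i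
    using R[OF that] l by (simp add: X_def truncated_sample_def abs_mult)
  have up: "\<bar>X i\<bar> powr A \<le> \<delta> * \<mu>" if i: "i \<in> {1..n}" for i
  proof -
    have l1: "2 powr A * L n powr A \<le> \<delta> * \<mu>"
    proof -
      have "2 powr A * L n powr A \<le> \<delta> * x * L n powr A" using x by (intro mult_right_mono) auto
      also have "\<dots> \<le> \<delta> * \<mu>" using x0 \<delta> m by (simp add: \<mu>_def mult.assoc)
      finally show ?thesis .
    qed
    show ?thesis
    proof (cases "L n < \<bar>H i \<omega>\<bar>")
      case True
      define y where "y = max (L n) (R i \<omega>)"
      have "\<bar>X i\<bar> \<le> 2 * y" using abs_X[OF i] True by (simp add: y_def)
      then have "\<bar>X i\<bar> powr A \<le> (2 * y) powr A" using A by (intro powr_mono2) auto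
      also have "\<dots> = 2 powr A * y powr A" using l by (intro powr_mult)
      also have "\<dots> \<le> \<delta> * \<mu>"
      proof (cases "L n \<le> R i \<omega>")
        case True
        have "\<delta> * x * m \<le> \<delta> * \<mu>" using x0 \<delta> La by (simp add: \<mu>_def mult.assoc)
        then show ?thesis using True Big[OF i \<open>L n < \<bar>H i \<omega>\<bar>\<close>] by (simp add: y_def max_def)
      qed (use l1 in \<open>simp add: y_def max_def\<close>)
      finally show ?thesis .
    next
      case False
      then have "\<bar>X i\<bar> powr A \<le> L n powr A" using abs_X[OF i] A by (intro powr_mono2) auto
      also have "1 * L n powr A \<le> 2 powr A * L n powr A" using A by (intro mult_right_mono ge_one_powr_ge_zero) auto
      also note l1
      finally show ?thesis by simp
    qed
  qed
  \<comment> \<open>Both \<open>L n powr A\<close> and \<open>R i powr A\<close> are at most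
    \<open>(L n + R i) powr A\<close>, hence the factor 2; this is valid for every positive A, also
    below 1.\<close>
  have low: "indicator {h. L n < \<bar>h\<bar>} (H i \<omega>) * (L n powr A + min (R i \<omega> powr A) 1) \<le> 2 * \<bar>X i\<bar> powr A" if i: "i \<in> {1..n}" for i
  proof (cases "L n < \<bar>H i \<omega>\<bar>")
    case True
    have "L n powr A \<le> (L n + R i \<omega>) powr A" "R i \<omega> powr A \<le> (L n + R i \<omega>) powr A"
      using R[OF i] l A by (auto intro!: powr_mono2)
    then show ?thesis using True abs_X[OF i] by simp
  qed simp
  have sum_low: "\<mu> / 4 < (\<Sum>i=1..n. \<bar>X i\<bar> powr A)"
  proof -
    have "(\<Sum>i=1..n. indicator {h. L n < \<bar>h\<bar>} (H i \<omega>) * (L n powr A + min (R i \<omega> powr A) 1)) \<le> (\<Sum>i=1..n. 2 * \<bar>X i\<bar> powr A)"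
      by (intro sum_mono low)
    then show ?thesis using S by (simp add: \<mu>_def flip: sum_distrib_left)
  qed
  define mx where "mx = Max ((\<lambda>i. \<bar>X i\<bar> powr A) ` {1..n})"
  have "n \<noteq> 0" using sum_low \<mu> by (intro notI) simp
  then have ne: "(\<lambda>i. \<bar>X i\<bar> powr A) ` {1..n} \<noteq> {}" by simp
  have mx_le: "mx \<le> \<delta> * \<mu>" unfolding mx_def using ne up by (subst Max_le_iff) auto
  have mx_ge: "\<bar>X i\<bar> powr A \<le> mx" if "i \<in> {1..n}" for i unfolding mx_def using that by (intro Max_ge) auto
  \<comment> \<open>A positive maximum excludes the arbitrary value \<open>d\<close>.\<close>
  have mx_pos: "0 < mx"
  proof (rule ccontr)
    assume "\<not> 0 < mx"
    then have "\<bar>X i\<bar> powr A \<le> 0" if "i \<in> {1..n}" for i using mx_ge[OF that] by linarith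
    then have "(\<Sum>i=1..n. \<bar>X i\<bar> powr A) \<le> 0" by (intro sum_nonpos)
    then show False using sum_low \<mu> by simp
  qed
  have "1 / (4 * \<delta>) = (\<mu> / 4) / (\<delta> * \<mu>)" using \<mu> by simp
  also have "\<dots> < (\<Sum>i=1..n. \<bar>X i\<bar> powr A) / (\<delta> * \<mu>)" using sum_low \<mu> \<delta> by (intro divide_strict_right_mono) auto
  also have "\<dots> \<le> (\<Sum>i=1..n. \<bar>X i\<bar> powr A) / mx"
    using mx_le mx_pos by (intro divide_left_mono sum_nonneg mult_pos_pos) (use \<delta> \<mu> in auto)
  also have "\<dots> = sum_max_ratio d (truncated_sample H R L) A n \<omega>"
    using mx_pos by (simp add: sum_max_ratio_def Let_def mx_def X_def)
  finally show ?thesis .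
qed

text \<open>If \<open>m = 0\<close>, then Y vanishes almost everywhere and the event is null for
  every n. Otherwise \<open>b * m\<close> is a positive constant, as
  \<open>tail_times_tendsto_0\<close> requires.\<close>

lemma (in prob_space) residual_tail_tendsto_0:
  fixes Y :: "'a \<Rightarrow> real"
  assumes Y: "integrable M Y" "\<And>\<omega>. 0 \<le> Y \<omega>" and x: "filterlim x at_top sequentially" and b: "0 < b"
  defines "m \<equiv> expectation (\<lambda>\<omega>. min (Y \<omega>) 1)"
  shows "(\<lambda>n. x n * prob {\<omega>\<in>space M. b * m * x n < Y \<omega>}) \<longlonglongrightarrow> 0"
proof (cases "m = 0")
  case True
  have Y_meas[measurable]: "Y \<in> borel_measurable M" using Y(1) by simp
  have i: "integrable M (\<lambda>\<omega>. min (Y \<omega>) 1)" by (rule integrable_const_bound[of _ 1]) (use Y(2) in auto)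
  have "AE \<omega> in M. min (Y \<omega>) 1 = 0"
    using True Y(2) by (subst integral_nonneg_eq_0_iff_AE[symmetric, OF i]) (auto simp: m_def)
  then have "AE \<omega> in M. \<omega> \<notin> {\<omega>\<in>space M. 0 < Y \<omega>}" by eventually_elim (auto simp: min_def split: if_splits)
  then have "prob {\<omega>\<in>space M. 0 < Y \<omega>} = 0" by (intro prob_eq_0[THEN iffD2]) measurable
  then show ?thesis using True by simp
next
  case False
  moreover have "0 \<le> m" unfolding m_def using Y(2) by (intro Bochner_Integration.integral_nonneg) simp
  ultimately have "0 < b * m" using b by simp
  then show ?thesis by (intro tail_times_tendsto_0 Y(1) x finite_measure_axioms)
qed

text \<open>For large n the ratio fails to exceed C with probability at most
  \<open>4 * \<kappa> / x n + x n * q n\<close>: the first term accounts for a sum that is too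
  small, the second for a residual that is too large. The first tends to 0 because \<kappa> does not
  depend on n, the second by integrability.\<close>

lemma hard_truncation:
  fixes M :: "'a measure" and H R d :: "nat \<Rightarrow> 'a \<Rightarrow> real"
  assumes M: "prob_space M" and A: "0 < A"
    and H: "iid M {1..} H" and R: "iid M {1..} R"
    and R_nonneg: "\<And>j. 1 \<le> j \<Longrightarrow> AE \<omega> in M. 0 \<le> R j \<omega>"
    and ind: "indep_sequences M {1..} H R"
    and L: "\<And>n. 1 \<le> n \<Longrightarrow> 0 < L n" and d: "\<And>n. d n \<in> borel_measurable M"
    and int: "integrable M (\<lambda>\<omega>. R 1 \<omega> powr A)"
    and hard: "filterlim (\<lambda>n. real n * measure M {\<omega>\<in>space M. \<bar>H 1 \<omega>\<bar> > L n}) at_top sequentially"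
  shows "tends_to_infinity_in_prob M (sum_max_ratio d (truncated_sample H R L) A)"
  unfolding tends_to_infinity_in_prob_def
proof
  fix C :: real
  interpret prob_space M by fact
  define Z where "Z = sum_max_ratio d (truncated_sample H R L) A"
  \<comment> \<open>Then \<open>1 / (4 * \<delta>)\<close> is \<open>max C 1\<close>, so the lower
    bound for the ratio is at least C.\<close>
  define \<delta> where "\<delta> = 1 / (4 * max C 1)"
  have \<delta>: "0 < \<delta>" "C \<le> 1 / (4 * \<delta>)" by (auto simp: \<delta>_def)
  define p where "p n = prob {\<omega>\<in>space M. L n < \<bar>H 1 \<omega>\<bar>}" for n
  define x where "x n = real n * p n" for n
  have x: "filterlim x at_top sequentially" using hard by (simp only: x_def[abs_def] p_def)
  define m where "m = expectation (\<lambda>\<omega>. min (R 1 \<omega> powr A) 1)"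
  have m: "0 \<le> m" unfolding m_def by (intro Bochner_Integration.integral_nonneg) simp
  define \<kappa> where "\<kappa> = max 1 (1 / m)"
  \<comment> \<open>Chosen so that \<open>R i powr A \<le> b * m * x n\<close> is the same as
    \<open>2 powr A * R i powr A \<le> \<delta> * x n * m\<close>.\<close>
  define b where "b = \<delta> / 2 powr A"
  have b: "0 < b" using \<delta> by (simp add: b_def)
  define q where "q n = prob {\<omega>\<in>space M. b * m * x n < R 1 \<omega> powr A}" for n
  have q: "(\<lambda>n. x n * q n) \<longlonglongrightarrow> 0"
    unfolding q_def m_def using residual_tail_tendsto_0[OF int _ x b] by simp
  have Z_meas: "Z n \<in> borel_measurable M" for n
    unfolding Z_def using d iid_measurable[OF M H] iid_measurable[OF M R]
    by (intro sum_max_ratio_measurable truncated_sample_measurable)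
  have "\<forall>\<^sub>F n in sequentially. 2 powr A / \<delta> \<le> x n" using x unfolding filterlim_at_top by blast
  moreover have "\<forall>\<^sub>F n in sequentially. 0 < x n" using x by (simp add: filterlim_at_top_dense)
  ultimately have low: "\<forall>\<^sub>F n in sequentially. 1 - (4 * \<kappa> / x n + x n * q n) \<le> prob {\<omega>\<in>space M. Z n \<omega> > C}"
    using eventually_ge_at_top[of "1::nat"]
  proof eventually_elim
    case (elim n)
    let ?S = "{\<omega>\<in>space M. (\<Sum>i=1..n. indicator {h. L n < \<bar>h\<bar>} (H i \<omega>) * (L n powr A + min (R i \<omega> powr A) 1)) \<le> x n * (L n powr A + m) / 2}"
    let ?B = "\<Union>i\<in>{1..n}. {\<omega>\<in>space M. L n < \<bar>H i \<omega>\<bar> \<and> b * m * x n < R i \<omega> powr A}"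
    have meas[measurable]: "H i \<in> borel_measurable M" "R i \<in> borel_measurable M" if "i \<in> {1..n}" for i
      using iid_measurable[OF M H, of i] iid_measurable[OF M R, of i] that by auto
    have S_ev: "?S \<in> events"
    proof -
      have "(\<lambda>\<omega>. \<Sum>i=1..n. indicator {h. L n < \<bar>h\<bar>} (H i \<omega>) * (L n powr A + min (R i \<omega> powr A) 1)) \<in> borel_measurable M"
      proof (rule borel_measurable_sum)
        fix i assume "i \<in> {1..n}"
        note [measurable] = meas[OF this]
        show "(\<lambda>\<omega>. indicator {h. L n < \<bar>h\<bar>} (H i \<omega>) * (L n powr A + min (R i \<omega> powr A) 1)) \<in> borel_measurable M" by measurable
      qed
      then show ?thesis by (rule borel_measurable_le) simp
    qed
    have B_ev: "?B \<in> events"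
    proof (intro sets.finite_UN)
      fix i assume "i \<in> {1..n}"
      note [measurable] = meas[OF this]
      show "{\<omega>\<in>space M. L n < \<bar>H i \<omega>\<bar> \<and> b * m * x n < R i \<omega> powr A} \<in> events" by measurable
    qed simp
    have Z_ev: "{\<omega>\<in>space M. Z n \<omega> > C} \<in> events" using Z_meas[of n] by measurable
    have SB_ev: "?S \<union> ?B \<in> events" by (rule sets.Un[OF S_ev B_ev])
    have "1 = prob (space M)" by (simp add: prob_space)
    also have "\<dots> \<le> prob ({\<omega>\<in>space M. Z n \<omega> > C} \<union> (?S \<union> ?B))"
    proof (rule finite_measure_mono_AE)
      have "AE \<omega> in M. \<forall>i\<in>{1..n}. 0 \<le> R i \<omega>"
        using R_nonneg by (intro AE_finite_allI) auto
      then show "AE \<omega> in M. \<omega> \<in> space M \<longrightarrow> \<omega> \<in> {\<omega>\<in>space M. Z n \<omega> > C} \<union> (?S \<union> ?B)"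
      proof eventually_elim
        case (elim \<omega>)
        show ?case
        proof (intro impI, rule ccontr)
          assume \<omega>: "\<omega> \<in> space M" and "\<omega> \<notin> {\<omega>\<in>space M. Z n \<omega> > C} \<union> (?S \<union> ?B)"
          then have nZ: "\<not> C < Z n \<omega>" and nS: "\<omega> \<notin> ?S" and nB: "\<omega> \<notin> ?B" by auto
          have "1 / (4 * \<delta>) < Z n \<omega>"
            unfolding Z_def
          proof (rule truncated_ratio_lower_bound[where x = "x n" and m = m])
            show "x n * (L n powr A + m) / 2 < (\<Sum>i=1..n. indicator {h. L n < \<bar>h\<bar>} (H i \<omega>) * (L n powr A + min (R i \<omega> powr A) 1))"
              using nS \<omega> by simp
            show "2 powr A \<le> \<delta> * x n" using \<open>2 powr A / \<delta> \<le> x n\<close> \<delta>(1) by (simp add: field_simps)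
            fix i assume "i \<in> {1..n}" "L n < \<bar>H i \<omega>\<bar>"
            then have "\<not> b * m * x n < R i \<omega> powr A" using nB \<omega> by blast
            then have "R i \<omega> powr A \<le> b * m * x n" by (simp only: not_less)
            then have "2 powr A * R i \<omega> powr A \<le> 2 powr A * (b * m * x n)" by (rule mult_left_mono) simp
            also have "\<dots> = \<delta> * x n * m" by (simp add: b_def)
            finally show "2 powr A * R i \<omega> powr A \<le> \<delta> * x n * m" .
          qed (use A L[OF \<open>1 \<le> n\<close>] elim m \<delta>(1) in auto)
          then show False using nZ \<delta>(2) by simp
        qed
      qed
      show "{\<omega>\<in>space M. Z n \<omega> > C} \<union> (?S \<union> ?B) \<in> events" by (rule sets.Un[OF Z_ev SB_ev])
    qed
    also have "\<dots> \<le> prob {\<omega>\<in>space M. Z n \<omega> > C} + prob (?S \<union> ?B)"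
      by (rule measure_Un_le[OF Z_ev SB_ev])
    finally have "1 \<le> prob {\<omega>\<in>space M. Z n \<omega> > C} + prob (?S \<union> ?B)" .
    moreover have "prob (?S \<union> ?B) \<le> prob ?S + prob ?B" by (rule measure_Un_le[OF S_ev B_ev])
    moreover have "prob ?S \<le> 4 * \<kappa> / x n"
    proof -
      have "0 < real n * prob {\<omega>\<in>space M. L n < \<bar>H 1 \<omega>\<bar>}" using \<open>0 < x n\<close> by (simp only: x_def p_def)
      from exceedance_sum_lower_tail[where n = n and A = A, OF H R ind L[OF \<open>1 \<le> n\<close>] this]
      show ?thesis unfolding x_def p_def \<kappa>_def m_def .
    qed
    moreover have "prob ?B \<le> x n * q n"
      unfolding x_def p_def q_def by (rule exceedance_residual_bound[OF H R ind])
    ultimately show ?case by linarith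
  qed
  have "(\<lambda>n. 4 * \<kappa> / x n) \<longlonglongrightarrow> 0"
    by (rule tendsto_divide_0[OF tendsto_const filterlim_at_top_imp_at_infinity[OF x]])
  from tendsto_diff[OF tendsto_const tendsto_add[OF this q], of 1]
  have lim: "(\<lambda>n. 1 - (4 * \<kappa> / x n + x n * q n)) \<longlonglongrightarrow> 1" by simp
  show "(\<lambda>n. prob {\<omega>\<in>space M. sum_max_ratio d (truncated_sample H R L) A n \<omega> > C}) \<longlonglongrightarrow> 1"
    unfolding Z_def[symmetric] by (rule tendsto_sandwich[OF low _ lim tendsto_const]) simp
qed

theorem proposition4p1:
  fixes M :: "'a measure"
    and H R d :: "nat \<Rightarrow> 'a \<Rightarrow> real"
    and L :: "nat \<Rightarrow> real"
    and \<alpha> A :: real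
  defines "Z \<equiv> sum_max_ratio d (truncated_sample H R L) A"
  assumes "prob_space M"
    and "0 < \<alpha>"
    and "iid M {1..} H"
    and "regularly_varying_tails (distr M borel (H 1)) \<alpha>"
    and "iid M {1..} R"
    and "\<And>j. j \<ge> 1 \<Longrightarrow> AE \<omega> in M. 0 \<le> R j \<omega>"
    and "indep_sequences M {1..} H R"
    and "\<And>n. n \<ge> 1 \<Longrightarrow> 0 < L n"
    and "\<And>n. d n \<in> borel_measurable M"
    and "\<alpha> < A"
  shows "((\<lambda>n. real n * measure M {\<omega>\<in>space M. \<bar>H 1 \<omega>\<bar> > L n}) \<longlonglongrightarrow> 0 \<longrightarrow>
           (\<forall>(P :: 'b measure) \<Gamma>. prob_space P \<and> unit_poisson_arrival_times P \<Gamma> \<longrightarrow>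
              weak_conv_m (\<lambda>n. distr M borel (Z n))
                (distr P borel (\<lambda>\<omega>. \<Gamma> 1 \<omega> powr (A / \<alpha>) *
                                    (\<Sum>j. \<Gamma> (Suc j) \<omega> powr (- A / \<alpha>))))))
       \<and> (integrable M (\<lambda>\<omega>. R 1 \<omega> powr A) \<and>
          filterlim (\<lambda>n. real n * measure M {\<omega>\<in>space M. \<bar>H 1 \<omega>\<bar> > L n}) at_top sequentially \<longrightarrow>
            tends_to_infinity_in_prob M Z)"
proof (intro conjI impI allI)
  fix P :: "'b measure" and \<Gamma>
  assume soft: "(\<lambda>n. real n * measure M {\<omega>\<in>space M. \<bar>H 1 \<omega>\<bar> > L n}) \<longlonglongrightarrow> 0"
    and "prob_space P \<and> unit_poisson_arrival_times P \<Gamma>"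
  then have P: "prob_space P" "unit_poisson_arrival_times P \<Gamma>" by auto
  show "weak_conv_m (\<lambda>n. distr M borel (Z n))
      (distr P borel (\<lambda>\<omega>. \<Gamma> 1 \<omega> powr (A / \<alpha>) * (\<Sum>j. \<Gamma> (Suc j) \<omega> powr (- A / \<alpha>))))"
    unfolding Z_def by (rule soft_truncation) (fact assms soft P)+
next
  assume "integrable M (\<lambda>\<omega>. R 1 \<omega> powr A) \<and>
    filterlim (\<lambda>n. real n * measure M {\<omega>\<in>space M. \<bar>H 1 \<omega>\<bar> > L n}) at_top sequentially"
  then have hard: "integrable M (\<lambda>\<omega>. R 1 \<omega> powr A)"
    "filterlim (\<lambda>n. real n * measure M {\<omega>\<in>space M. \<bar>H 1 \<omega>\<bar> > L n}) at_top sequentially" by auto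
  have "0 < A" using assms(3,11) by simp
  show "tends_to_infinity_in_prob M Z"
    unfolding Z_def by (rule hard_truncation) (fact assms hard \<open>0 < A\<close>)+
qed

end
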